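(* A graphon property $\mathcal R\subseteq\mathcal W_0$ is testable if and only if the distance $W\mapsto d_1(W,\mathcal R)$ is a testable functional.
   Context: Graphs are finite and simple; a graph property is a class of graphs invariant under isomorphism; a graph parameter is a real function defined on isomorphism types of graphs. $\mathcal W_0$ is the set of symmetric measurable functions $W:[0,1]^2\to[0,1]$. For a graph $F$ on $[k]$, $t(F,W)=\int_{[0,1]^k}\prod_{ij\in E(F)}W(x_i,x_j)\,dx$. Two functions $W_1,W_2\in\mathcal W_0$ are isomorphic if $t(F,W_1)=t(F,W_2)$ for every graph $F$. A graphon property is a subset of $\mathcal W_0$ invariant under isomorphism; a graphon functional is a real valued function on $\mathcal W_0$ invariant under isomorphism. $d_1(U,W)=\|U-W\|_1=\int_{[0,1]^2}|U-W|$ and $d_1(W,\mathcal R)=\inf_{U\in\mathcal R}d_1(W,U)$. $W$-random graph: $\mathbb G(k,W)$ is obtained by choosing $X_1,\dots,X_k\in[0,1]$ independently and uniformly and then, for each $i<j$ independently, connecting $i$ and $j$ with probability $W(X_i,X_j)$. A graphon property $\mathcal R$ is testable if there is a graph property $\mathcal R'$ such that (a) $\Pr(\mathbb G(k,W)\in\mathcal R')\ge 2/3$ for every $W\in\mathcal R$ and every $k\ge1$, and (b) for every $\varepsilon>0$ there is a $k_\varepsilon\ge1$ such that $\Pr(\mathbb G(k,W)\in\mathcal R')\le1/3$ for every $k\ge k_\varepsilon$ and every $W\in\mathcal W_0$ with $d_1(W,\mathcal R)\ge\varepsilon$. A graphon functional $f$ is testable if there is a graph parameter $g$ such that for every $\varepsilon>0$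 there is a positive integer $k(\varepsilon)$ such that for every $W\in\mathcal W_0$ and $k\ge k(\varepsilon)$, $\Pr(|f(W)-g(\mathbb G(k,W))|>\varepsilon)<1/3$. *)

theory Defs
  imports "HOL-Probability.Probability"
begin

subsection \<open>Finite simple graphs\<close>

text \<open>
  A graph is a pair of a vertex set and a set of unordered edges. Every finite graph is isomorphic
  to one whose vertices are natural numbers, so graph properties and graph parameters, being
  isomorphism invariant, lose nothing by the choice of \<^typ>\<open>nat\<close> as the type of vertices.
\<close>

type_synonym ugraph = "nat set \<times> nat set set"

definition simple_graph :: "ugraph \<Rightarrow> bool" where
  "simple_graph G \<longleftrightarrow> finite (fst G) \<and> (\<forall>e\<in>snd G. e \<subseteq> fst G \<and> card e = 2)"

definition graph_iso :: "ugraph \<Rightarrow> ugraph \<Rightarrow> bool" where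
  "graph_iso G H \<longleftrightarrow> (\<exists>\<phi>. bij_betw \<phi> (fst G) (fst H) \<and> snd H = (\<lambda>e. \<phi> ` e) ` snd G)"

definition graph_property :: "ugraph set \<Rightarrow> bool" where
  "graph_property P \<longleftrightarrow> P \<subseteq> Collect simple_graph \<and>
     (\<forall>G H. simple_graph G \<and> simple_graph H \<and> graph_iso G H \<and> G \<in> P \<longrightarrow> H \<in> P)"

definition graph_parameter :: "(ugraph \<Rightarrow> real) \<Rightarrow> bool" where
  "graph_parameter g \<longleftrightarrow>
     (\<forall>G H. simple_graph G \<and> simple_graph H \<and> graph_iso G H \<longrightarrow> g G = g H)"


subsection \<open>Graphons\<close>

text \<open>
  A graphon is a total function on the reals of which only the values on the unit square matter:
  the densities, the distance and the random graphs below ignore all other values. In particular,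
  two functions that agree on the unit square are isomorphic as graphons, and an invariant set or
  functional does not distinguish them. Measurability is Lebesgue measurability.
\<close>

definition graphons :: "(real \<Rightarrow> real \<Rightarrow> real) set" where
  "graphons = {W. (\<lambda>(x, y). W x y) \<in> borel_measurable (lebesgue_on ({0..1} \<times> {0..1})) \<and>
     (\<forall>x\<in>{0..1}. \<forall>y\<in>{0..1}. W x y = W y x \<and> 0 \<le> W x y \<and> W x y \<le> 1)}"

text \<open>
  Lebesgue measure on the cube of points with coordinates indexed by \<open>V\<close>. The completion is needed
  because for a Lebesgue measurable \<open>W\<close> the map taking \<open>x\<close> to \<open>W (x i) (x j)\<close> need not be
  measurable with respect to the product sigma-algebra.
\<close>

definition unit_cube :: "nat set \<Rightarrow> (nat \<Rightarrow> real) measure" where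
  "unit_cube V = completion (\<Pi>\<^sub>M i\<in>V. restrict_space lborel {0..1})"

text \<open>
  In the product every edge occurs once, as the pair of its endpoints in increasing order; for
  symmetric \<open>W\<close> this order is irrelevant.
\<close>

definition hom_density :: "ugraph \<Rightarrow> (real \<Rightarrow> real \<Rightarrow> real) \<Rightarrow> real" where
  "hom_density F W =
     (LINT x|unit_cube (fst F).
       (\<Prod>(i, j)\<in>{(i, j). i < j \<and> {i, j} \<in> snd F}. W (x i) (x j)))"

definition graphon_iso :: "(real \<Rightarrow> real \<Rightarrow> real) \<Rightarrow> (real \<Rightarrow> real \<Rightarrow> real) \<Rightarrow> bool" where
  "graphon_iso U W \<longleftrightarrow> (\<forall>F. simple_graph F \<longrightarrow> hom_density F U = hom_density F W)"

definition graphon_property :: "(real \<Rightarrow> real \<Rightarrow> real) set \<Rightarrow> bool" where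
  "graphon_property R \<longleftrightarrow> R \<subseteq> graphons \<and>
     (\<forall>U\<in>graphons. \<forall>W\<in>graphons. graphon_iso U W \<and> U \<in> R \<longrightarrow> W \<in> R)"

definition graphon_functional :: "((real \<Rightarrow> real \<Rightarrow> real) \<Rightarrow> real) \<Rightarrow> bool" where
  "graphon_functional f \<longleftrightarrow>
     (\<forall>U\<in>graphons. \<forall>W\<in>graphons. graphon_iso U W \<longrightarrow> f U = f W)"

definition d1 :: "(real \<Rightarrow> real \<Rightarrow> real) \<Rightarrow> (real \<Rightarrow> real \<Rightarrow> real) \<Rightarrow> real" where
  "d1 U W = (LINT (x, y)|lebesgue_on ({0..1} \<times> {0..1}). \<bar>U x y - W x y\<bar>)"

text \<open>
  For empty \<open>R\<close> the infimum is a constant that does not depend on \<open>W\<close>.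
\<close>

definition d1_set :: "(real \<Rightarrow> real \<Rightarrow> real) \<Rightarrow> (real \<Rightarrow> real \<Rightarrow> real) set \<Rightarrow> real" where
  "d1_set W R = (INF U\<in>R. d1 W U)"


subsection \<open>Random graphs and testability\<close>

text \<open>The edges of the \<open>W\<close>-random graph once the points \<open>x i\<close> have been chosen.\<close>

definition edge_choice_pmf :: "nat \<Rightarrow> (real \<Rightarrow> real \<Rightarrow> real) \<Rightarrow> (nat \<Rightarrow> real) \<Rightarrow> ugraph pmf" where
  "edge_choice_pmf k W x =
     map_pmf (\<lambda>b. ({1..k}, {{i, j} | i j. 1 \<le> i \<and> i < j \<and> j \<le> k \<and> b (i, j)}))
       (Pi_pmf {(i, j). 1 \<le> i \<and> i < j \<and> j \<le> k} False (\<lambda>(i, j). bernoulli_pmf (W (x i) (x j))))"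

definition random_graph :: "nat \<Rightarrow> (real \<Rightarrow> real \<Rightarrow> real) \<Rightarrow> ugraph measure" where
  "random_graph k W = unit_cube {1..k} \<bind> (\<lambda>x. measure_pmf (edge_choice_pmf k W x))"

definition testable_property :: "(real \<Rightarrow> real \<Rightarrow> real) set \<Rightarrow> bool" where
  "testable_property R \<longleftrightarrow> (\<exists>P. graph_property P \<and>
     (\<forall>W\<in>R. \<forall>k\<ge>1. measure (random_graph k W) P \<ge> 2/3) \<and>
     (\<forall>\<epsilon>>0. \<exists>k\<^sub>0\<ge>1. \<forall>k\<ge>k\<^sub>0. \<forall>W\<in>graphons.
        d1_set W R \<ge> \<epsilon> \<longrightarrow> measure (random_graph k W) P \<le> 1/3))"

definition testable_functional :: "((real \<Rightarrow> real \<Rightarrow> real) \<Rightarrow> real) \<Rightarrow> bool" where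
  "testable_functional f \<longleftrightarrow> graphon_functional f \<and>
     (\<exists>g. graph_parameter g \<and>
       (\<forall>\<epsilon>>0. \<exists>k\<^sub>0\<ge>1. \<forall>W\<in>graphons. \<forall>k\<ge>k\<^sub>0.
          measure (random_graph k W) {G. \<bar>f W - g G\<bar> > \<epsilon>} < 1/3))"

end

theory Submission
  imports Defs
begin

text \<open>
  If the distance \<open>d\<^sub>1(W, R)\<close> can be estimated with error tending to zero, then "the estimate is at most
  the error" is a test for \<open>R\<close>.

  Conversely, a large sample \<open>G\<close> of \<open>W\<close> is close to \<open>W\<close> in cut distance: some equipartition of \<open>[0, 1]\<close>
  indexed by the vertices makes \<open>W - G\<close> small in cut norm. The estimate for \<open>G\<close> is the distance to \<open>R\<close> of
  any graphon \<open>V\<close> that is close to \<open>G\<close> in this sense, so one has to compare two graphons \<open>V\<close> and \<open>W\<close>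
  close to the same \<open>G\<close>. Given \<open>W' \<in> R\<close> almost nearest to \<open>W\<close>, choose a partition into boundedly many
  classes that is regular for \<open>W\<close> and \<open>W'\<close>, transport it to \<open>V\<close> through \<open>G\<close>, and change \<open>V\<close> on every
  pair of classes as little as possible to give it the density of \<open>W'\<close>. The resulting \<open>V'\<close> satisfies
  \<open>d\<^sub>1(V, V') \<le> d\<^sub>1(W, W') + \<epsilon>\<close> and has almost the same random graphs of a fixed size as \<open>W'\<close>. As the
  tester accepts \<open>W'\<close> with probability at least 2/3 it accepts \<open>V'\<close> with probability above 1/3, hence
  \<open>V'\<close> is close to \<open>R\<close>. Only the boundedness of the number of classes matters, not its size.
\<close>

subsection \<open>Cut norm bounds on a probability space\<close>

text \<open>Recolouring is chosen for this reason: its cost \<open>q + t * r\<close> and the new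
  density \<open>q + t * \<rho>\<close> are affine in the density \<open>t\<close>, with step
  functions of the labels as coefficients. Multiplying by a step function on \<open>K\<close>
  classes costs a factor \<open>K * K\<close> in the cut norm. For the approximation of
  \<open>V\<close> and \<open>W\<close> by \<open>G\<close> this is affordable, since the precision
  \<open>c\<close> can be chosen after \<open>K\<close>, namely as \<open>\<eta> / (K * K)\<close>.
  For the regularity error \<open>\<eta>\<close> it is not, since \<open>K\<close> grows as
  \<open>\<eta>\<close> shrinks. Hence regularity has to include the error bound after
  multiplication by every step function bounded by 1. It follows from near-optimality of a
  least-squares fit under one further split of the classes. The order of choices is therefore:
  sample size of the tester, then \<open>\<eta>\<close>, then \<open>K\<close>, then
  \<open>c\<close>, then the size of the large sample.\<close>

lemma (in prob_space) abs_integral_le: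
  fixes h :: "'a \<Rightarrow> real"
  assumes h: "\<And>x. \<bar>h x\<bar> \<le> B" shows "\<bar>\<integral>x. h x \<partial>M\<bar> \<le> B"
proof (cases "integrable M h")
  case True
  have "\<bar>\<integral>x. h x \<partial>M\<bar> \<le> (\<integral>x. \<bar>h x\<bar> \<partial>M)"
    using integral_norm_bound[of M h] by simp
  also have "\<dots> \<le> (\<integral>x. B \<partial>M)" using True h by (intro integral_mono) auto
  finally show ?thesis by (simp add: prob_space)
next
  case False
  \<comment> \<open>The integral of a non-integrable function is 0 by convention, and any single
    value of \<open>h\<close> shows \<open>0 \<le> B\<close>.\<close>
  then show ?thesis using h[of undefined] by (simp add: not_integrable_integral_eq)
qed

locale kernel_space = prob_space M for M :: "'a measure"
begin

sublocale P: pair_prob_space M M ..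

abbreviation measurable2 :: "('a \<Rightarrow> 'a \<Rightarrow> real) \<Rightarrow> bool" where
  "measurable2 A \<equiv> case_prod A \<in> borel_measurable (M \<Otimes>\<^sub>M M)"

text \<open>Symmetry and bounds hold at every point of the type, even outside
  \<open>space M\<close>, which spares later estimates all almost-everywhere conditions. By
  \<open>graphon_kernel\<close> every graphon has such a representative.\<close>

definition kernel :: "('a \<Rightarrow> 'a \<Rightarrow> real) \<Rightarrow> bool" where
  "kernel W \<longleftrightarrow> measurable2 W \<and>
     (\<forall>x y. W x y = W y x \<and> 0 \<le> W x y \<and> W x y \<le> 1)"

abbreviation labelling :: "('a \<Rightarrow> 'b) \<Rightarrow> bool" where
  "labelling \<alpha> \<equiv> \<alpha> \<in> M \<rightarrow>\<^sub>M count_space UNIV"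

definition avg :: "('a \<Rightarrow> 'a \<Rightarrow> real) \<Rightarrow> real" where
  "avg A = (\<integral>p. A (fst p) (snd p) \<partial>(M \<Otimes>\<^sub>M M))"

text \<open>A bound on the cut norm in its functional form, with test functions into [-1, 1]; it
  agrees with the supremum over measurable rectangles up to a factor 4.\<close>

definition cut_bound :: "('a \<Rightarrow> 'a \<Rightarrow> real) \<Rightarrow> real \<Rightarrow> bool" where
  "cut_bound A c \<longleftrightarrow>
     (\<forall>f\<in>borel_measurable M. \<forall>g\<in>borel_measurable M. (\<forall>x. \<bar>f x\<bar> \<le> 1) \<longrightarrow> (\<forall>x. \<bar>g x\<bar> \<le> 1) \<longrightarrow>
        \<bar>avg (\<lambda>x y. A x y * f x * g y)\<bar> \<le> c)"

definition bdd_fun :: "('a \<Rightarrow> 'a \<Rightarrow> real) \<Rightarrow> bool" where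
  "bdd_fun A \<longleftrightarrow> measurable2 A \<and> (\<exists>B. \<forall>x y. \<bar>A x y\<bar> \<le> B)"

lemma bdd_funI: "measurable2 A \<Longrightarrow> (\<And>x y. \<bar>A x y\<bar> \<le> B) \<Longrightarrow> bdd_fun A"
  unfolding bdd_fun_def by blast

lemma bdd_fun_measurable: "bdd_fun A \<Longrightarrow> measurable2 A"
  unfolding bdd_fun_def by blast

lemma bdd_fun_integrable:
  assumes "bdd_fun A" shows "integrable (M \<Otimes>\<^sub>M M) (\<lambda>p. A (fst p) (snd p))"
proof -
  have [measurable]: "measurable2 A"
    using assms by (rule bdd_fun_measurable)
  obtain B where "\<And>x y. \<bar>A x y\<bar> \<le> B" using assms unfolding bdd_fun_def by blast
  then show ?thesis by (intro P.integrable_const_bound[where B=B]) auto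
qed

lemma bdd_fun_const [simp]: "bdd_fun (\<lambda>x y. c)"
  by (rule bdd_funI[where B="\<bar>c\<bar>"]) auto

lemma bdd_fun_add:
  assumes "bdd_fun A" "bdd_fun B" shows "bdd_fun (\<lambda>x y. A x y + B x y)"
proof -
  have [measurable]: "measurable2 A" "measurable2 B"
    using assms by (auto intro: bdd_fun_measurable)
  obtain a b where "\<And>x y. \<bar>A x y\<bar> \<le> a" "\<And>x y. \<bar>B x y\<bar> \<le> b" using assms unfolding bdd_fun_def by blast
  then show ?thesis
    by (intro bdd_funI[where B="a+b"]) (auto intro!: order_trans[OF abs_triangle_ineq] add_mono)
qed

lemma bdd_fun_mult:
  assumes "bdd_fun A" "bdd_fun B" shows "bdd_fun (\<lambda>x y. A x y * B x y)"
proof -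
  have [measurable]: "measurable2 A" "measurable2 B"
    using assms by (auto intro: bdd_fun_measurable)
  obtain a b where *: "\<And>x y. \<bar>A x y\<bar> \<le> a" "\<And>x y. \<bar>B x y\<bar> \<le> b" using assms unfolding bdd_fun_def by blast
  then have "0 \<le> a" "0 \<le> b" using abs_ge_zero order_trans by blast+
  with * show ?thesis
    by (intro bdd_funI[where B="a*b"]) (auto simp: abs_mult intro!: mult_mono)
qed

lemma bdd_fun_diff:
  assumes "bdd_fun A" "bdd_fun B" shows "bdd_fun (\<lambda>x y. A x y - B x y)"
  using bdd_fun_add[OF assms(1) bdd_fun_mult[OF bdd_fun_const[of "-1"] assms(2)]] by simp

lemma bdd_fun_abs:
  assumes "bdd_fun A" shows "bdd_fun (\<lambda>x y. \<bar>A x y\<bar>)"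
proof -
  have [measurable]: "measurable2 A"
    using assms by (rule bdd_fun_measurable)
  obtain B where "\<And>x y. \<bar>A x y\<bar> \<le> B" using assms unfolding bdd_fun_def by blast
  then show ?thesis by (intro bdd_funI[where B=B]) auto
qed

lemma bdd_fun_left:
  assumes [measurable]: "f \<in> borel_measurable M" and "\<And>x. \<bar>f x\<bar> \<le> B" shows "bdd_fun (\<lambda>x y. f x)"
  using assms(2) by (intro bdd_funI[where B=B]) auto

lemma bdd_fun_right:
  assumes [measurable]: "f \<in> borel_measurable M" and "\<And>x. \<bar>f x\<bar> \<le> B" shows "bdd_fun (\<lambda>x y. f y)"
  using assms(2) by (intro bdd_funI[where B=B]) auto

lemma bdd_fun_label:
  fixes T :: "'b::countable \<Rightarrow> 'b \<Rightarrow> real"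
  assumes [measurable]: "labelling \<alpha>" and "\<And>i j. \<bar>T i j\<bar> \<le> B"
  shows "bdd_fun (\<lambda>x y. T (\<alpha> x) (\<alpha> y))"
proof (rule bdd_funI[where B=B])
  have "(\<lambda>p. T (\<alpha> (fst p)) (\<alpha> (snd p))) \<in> borel_measurable (M \<Otimes>\<^sub>M M)"
    by measurable
  then show "(\<lambda>(x, y). T (\<alpha> x) (\<alpha> y)) \<in> borel_measurable (M \<Otimes>\<^sub>M M)"
    by (simp add: case_prod_unfold)
qed (use assms in auto)

lemma bdd_fun_kernel: "kernel W \<Longrightarrow> bdd_fun W"
  unfolding kernel_def by (intro bdd_funI[where B=1]) (auto simp: abs_le_iff intro: order_trans[of _ 0])

lemma avg_add: "bdd_fun A \<Longrightarrow> bdd_fun B \<Longrightarrow> avg (\<lambda>x y. A x y + B x y) = avg A + avg B"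
  unfolding avg_def by (intro Bochner_Integration.integral_add bdd_fun_integrable)

lemma avg_diff: "bdd_fun A \<Longrightarrow> bdd_fun B \<Longrightarrow> avg (\<lambda>x y. A x y - B x y) = avg A - avg B"
  unfolding avg_def by (intro Bochner_Integration.integral_diff bdd_fun_integrable)

lemma avg_cmult: "avg (\<lambda>x y. c * A x y) = c * avg A"
  unfolding avg_def by simp

lemma avg_const [simp]: "avg (\<lambda>x y. c) = c"
  unfolding avg_def by (simp add: P.prob_space)

lemma avg_mono: "bdd_fun A \<Longrightarrow> bdd_fun B \<Longrightarrow> (\<And>x y. A x y \<le> B x y) \<Longrightarrow> avg A \<le> avg B"
  unfolding avg_def by (intro integral_mono bdd_fun_integrable)

lemma avg_nonneg: "(\<And>x y. 0 \<le> A x y) \<Longrightarrow> 0 \<le> avg A"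
  unfolding avg_def by (intro Bochner_Integration.integral_nonneg)

lemma avg_abs_le: "bdd_fun A \<Longrightarrow> \<bar>avg A\<bar> \<le> avg (\<lambda>x y. \<bar>A x y\<bar>)"
  unfolding avg_def using integral_norm_bound[of "M \<Otimes>\<^sub>M M" "\<lambda>p. A (fst p) (snd p)"] by simp

lemma avg_swap: "bdd_fun A \<Longrightarrow> avg (\<lambda>x y. A y x) = avg A"
proof -
  assume "bdd_fun A"
  then have [measurable]: "measurable2 A" by (rule bdd_fun_measurable)
  have "avg A = (\<integral>p. A (fst p) (snd p) \<partial>distr (M \<Otimes>\<^sub>M M) (M \<Otimes>\<^sub>M M) (\<lambda>(x, y). (y, x)))"
    unfolding avg_def using P.distr_pair_swap by simp
  also have "\<dots> = avg (\<lambda>x y. A y x)"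
    unfolding avg_def by (subst integral_distr) (auto simp: case_prod_unfold)
  finally show ?thesis by simp
qed

lemma avg_sum:
  "finite I \<Longrightarrow> (\<And>i. i \<in> I \<Longrightarrow> bdd_fun (A i)) \<Longrightarrow> avg (\<lambda>x y. \<Sum>i\<in>I. A i x y) = (\<Sum>i\<in>I. avg (A i))"
  unfolding avg_def by (intro Bochner_Integration.integral_sum bdd_fun_integrable)

lemma avg_fst:
  assumes "bdd_fun A" shows "avg A = (\<integral>x. (\<integral>y. A x y \<partial>M) \<partial>M)"
proof -
  have "integrable (M \<Otimes>\<^sub>M M) (case_prod A)"
    using bdd_fun_integrable[OF assms] by (simp add: case_prod_unfold)
  from P.integral_fst'[OF this] show ?thesis unfolding avg_def by (simp add: case_prod_unfold)
qed

lemma cut_boundD: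
  assumes "cut_bound A c" "f \<in> borel_measurable M" "g \<in> borel_measurable M"
    "\<And>x. \<bar>f x\<bar> \<le> 1" "\<And>x. \<bar>g x\<bar> \<le> 1"
  shows "\<bar>avg (\<lambda>x y. A x y * f x * g y)\<bar> \<le> c"
  using assms unfolding cut_bound_def by blast

lemma cut_bound_avg: "cut_bound A c \<Longrightarrow> \<bar>avg A\<bar> \<le> c"
  using cut_boundD[of A c "\<lambda>_. 1" "\<lambda>_. 1"] by simp

lemma cut_bound_nonneg: "cut_bound A c \<Longrightarrow> 0 \<le> c"
  using cut_bound_avg abs_ge_zero order_trans by blast

lemma cut_bound_mono: "cut_bound A c \<Longrightarrow> c \<le> d \<Longrightarrow> cut_bound A d"
  unfolding cut_bound_def by (meson order_trans)

lemma bdd_fun_test: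
  assumes "bdd_fun A" "f \<in> borel_measurable M" "g \<in> borel_measurable M"
    "\<And>x. \<bar>f x\<bar> \<le> 1" "\<And>x. \<bar>g x\<bar> \<le> 1"
  shows "bdd_fun (\<lambda>x y. A x y * f x * g y)"
  by (intro bdd_fun_mult assms(1) bdd_fun_left[where B=1] bdd_fun_right[where B=1] assms)

lemma cut_bound_add:
  assumes "cut_bound A c" "cut_bound B d" "bdd_fun A" "bdd_fun B"
  shows "cut_bound (\<lambda>x y. A x y + B x y) (c + d)"
  unfolding cut_bound_def
proof safe
  fix f g :: "'a \<Rightarrow> real"
  assume fg: "f \<in> borel_measurable M" "g \<in> borel_measurable M" "\<forall>x. \<bar>f x\<bar> \<le> 1" "\<forall>x. \<bar>g x\<bar> \<le> 1"
  have "avg (\<lambda>x y. (A x y + B x y) * f x * g y) =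
     avg (\<lambda>x y. A x y * f x * g y) + avg (\<lambda>x y. B x y * f x * g y)"
    unfolding distrib_right using fg assms by (intro avg_add bdd_fun_test) auto
  then show "\<bar>avg (\<lambda>x y. (A x y + B x y) * f x * g y)\<bar> \<le> c + d"
    using cut_boundD[OF assms(1), of f g] cut_boundD[OF assms(2), of f g] fg by auto
qed

lemma cut_bound_cmult:
  assumes "cut_bound A c" shows "cut_bound (\<lambda>x y. k * A x y) (\<bar>k\<bar> * c)"
  using assms unfolding cut_bound_def
  by (auto simp: mult.assoc avg_cmult abs_mult mult_left_mono)

lemma cut_bound_minus:
  assumes "cut_bound (\<lambda>x y. A x y - B x y) c" shows "cut_bound (\<lambda>x y. B x y - A x y) c"
  using cut_bound_cmult[OF assms, of "-1"] by simp

lemma cut_bound_trans: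
  assumes "cut_bound (\<lambda>x y. A x y - B x y) c" "cut_bound (\<lambda>x y. B x y - C x y) d"
    "bdd_fun A" "bdd_fun B" "bdd_fun C"
  shows "cut_bound (\<lambda>x y. A x y - C x y) (c + d)"
  using cut_bound_add[OF assms(1,2)] assms(3-) by (simp add: bdd_fun_diff)

lemma cut_bound_avg_abs:
  assumes "bdd_fun A" shows "cut_bound A (avg (\<lambda>x y. \<bar>A x y\<bar>))"
  unfolding cut_bound_def
proof safe
  fix f g :: "'a \<Rightarrow> real"
  assume fg: "f \<in> borel_measurable M" "g \<in> borel_measurable M" "\<forall>x. \<bar>f x\<bar> \<le> 1" "\<forall>x. \<bar>g x\<bar> \<le> 1"
  have b: "bdd_fun (\<lambda>x y. A x y * f x * g y)" using fg assms by (intro bdd_fun_test) auto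
  have "\<bar>A x y\<bar> * \<bar>f x\<bar> * \<bar>g y\<bar> \<le> \<bar>A x y\<bar>" for x y
    using fg mult_mono[of "\<bar>A x y\<bar> * \<bar>f x\<bar>" "\<bar>A x y\<bar>" "\<bar>g y\<bar>" 1] by (simp add: mult_left_le)
  then have "avg (\<lambda>x y. \<bar>A x y * f x * g y\<bar>) \<le> avg (\<lambda>x y. \<bar>A x y\<bar>)"
    using b assms by (intro avg_mono bdd_fun_abs) (auto simp: abs_mult)
  with avg_abs_le[OF b] show "\<bar>avg (\<lambda>x y. A x y * f x * g y)\<bar> \<le> avg (\<lambda>x y. \<bar>A x y\<bar>)" by linarith
qed

text \<open>For fixed \<open>g\<close> the average is the integral of \<open>f x * F x\<close>, with
  \<open>F\<close> the partial integral over the second variable; it is largest when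
  \<open>f\<close> is the sign of \<open>F\<close>.\<close>

lemma avg_le_sign:
  assumes A: "bdd_fun A" and g [measurable]: "g \<in> borel_measurable M" and g1: "\<And>x. \<bar>g x\<bar> \<le> 1"
  obtains S where "S \<in> sets M" "\<And>f. f \<in> borel_measurable M \<Longrightarrow> (\<And>x. \<bar>f x\<bar> \<le> 1) \<Longrightarrow>
     avg (\<lambda>x y. A x y * f x * g y) \<le> avg (\<lambda>x y. A x y * (if x \<in> S then 1 else -1) * g y)"
proof
  have [measurable]: "measurable2 A" using A by (rule bdd_fun_measurable)
  obtain B where B: "\<And>x y. \<bar>A x y\<bar> \<le> B" using A unfolding bdd_fun_def by blast
  then have B0: "0 \<le> B" using abs_ge_zero order_trans by blast
  define F where "F x = (\<integral>y. A x y * g y \<partial>M)" for x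
  have [measurable]: "F \<in> borel_measurable M" unfolding F_def by measurable
  define S where "S = {x\<in>space M. 0 \<le> F x}"
  show S [measurable]: "S \<in> sets M" unfolding S_def by measurable
  define s where "s x = (if x \<in> S then 1 else -1 :: real)" for x
  have s: "s \<in> borel_measurable M" "\<And>x. \<bar>s x\<bar> \<le> 1" unfolding s_def by auto
  have FB: "\<bar>F x\<bar> \<le> B" for x
  proof -
    have "\<bar>A x y * g y\<bar> \<le> B" for y
      using mult_mono[OF B[of x y], of "\<bar>g y\<bar>" 1] g1 B0 by (auto simp: abs_mult)
    then show ?thesis unfolding F_def by (rule abs_integral_le)
  qed
  have int: "integrable M (\<lambda>x. h x * F x)"
    if [measurable]: "h \<in> borel_measurable M" and h: "\<And>x. \<bar>h x\<bar> \<le> 1" for h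
    using mult_mono[OF h FB] by (auto intro!: integrable_const_bound[where B=B] simp: abs_mult)
  have avg_F: "avg (\<lambda>x y. A x y * h x * g y) = (\<integral>x. h x * F x \<partial>M)"
    if h: "h \<in> borel_measurable M" "\<And>x. \<bar>h x\<bar> \<le> 1" for h
  proof -
    have "avg (\<lambda>x y. A x y * h x * g y) = (\<integral>x. (\<integral>y. A x y * h x * g y \<partial>M) \<partial>M)"
      by (intro avg_fst bdd_fun_test A g g1 h)
    also have "(\<lambda>x. \<integral>y. A x y * h x * g y \<partial>M) = (\<lambda>x. h x * F x)"
      unfolding F_def by (intro ext, subst integral_mult_right_zero[symmetric]) (simp add: mult_ac)
    finally show ?thesis .
  qed
  have le: "h * a \<le> \<bar>a\<bar>" if "\<bar>h\<bar> \<le> 1" for h a :: real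
    using that mult_right_mono[of "\<bar>h\<bar>" 1 "\<bar>a\<bar>"] by (simp flip: abs_mult)
  have sF: "s x * F x = \<bar>F x\<bar>" if "x \<in> space M" for x using that by (simp add: s_def S_def)
  fix f :: "'a \<Rightarrow> real" assume f: "f \<in> borel_measurable M" "\<And>x. \<bar>f x\<bar> \<le> 1"
  have "(\<integral>x. f x * F x \<partial>M) \<le> (\<integral>x. s x * F x \<partial>M)"
    using f s by (intro integral_mono int) (simp_all only: sF le)
  then show "avg (\<lambda>x y. A x y * f x * g y) \<le> avg (\<lambda>x y. A x y * (if x \<in> S then 1 else -1) * g y)"
    using avg_F[OF f] avg_F[OF s] by (simp add: s_def)
qed

text \<open>\<open>avg_le_sign\<close> is applied to the first variable and then, for the transposed
  kernel, to the second. Two-valued test functions matter because they cut each label class into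
  finitely many pieces.\<close>

lemma cut_bound_signI:
  assumes A: "bdd_fun A"
    and sign: "\<And>S T. S \<in> sets M \<Longrightarrow> T \<in> sets M \<Longrightarrow>
      avg (\<lambda>x y. A x y * (if x \<in> S then 1 else -1) * (if y \<in> T then 1 else -1)) \<le> c"
  shows "cut_bound A c"
  unfolding cut_bound_def
proof safe
  fix f g :: "'a \<Rightarrow> real"
  assume f: "f \<in> borel_measurable M" "\<forall>x. \<bar>f x\<bar> \<le> 1" and g: "g \<in> borel_measurable M" "\<forall>x. \<bar>g x\<bar> \<le> 1"
  obtain S where S [measurable]: "S \<in> sets M" and le_S: "\<And>f. f \<in> borel_measurable M \<Longrightarrow> (\<And>x. \<bar>f x\<bar> \<le> 1) \<Longrightarrow>
     avg (\<lambda>x y. A x y * f x * g y) \<le> avg (\<lambda>x y. A x y * (if x \<in> S then 1 else -1) * g y)"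
    using avg_le_sign[OF A g(1)] g(2) by blast
  define s where "s x = (if x \<in> S then 1 else -1 :: real)" for x
  have s: "s \<in> borel_measurable M" "\<And>x. \<bar>s x\<bar> \<le> 1" unfolding s_def by auto
  have swap: "avg (\<lambda>x y. A y x * h x * s y) = avg (\<lambda>x y. A x y * s x * h y)"
    if "h \<in> borel_measurable M" "\<And>x. \<bar>h x\<bar> \<le> 1" for h
    using avg_swap[OF bdd_fun_test[OF A s(1) that(1) s(2) that(2)]] by (simp add: mult_ac)
  have [measurable]: "measurable2 A" using A by (rule bdd_fun_measurable)
  obtain B where "\<And>x y. \<bar>A x y\<bar> \<le> B" using A unfolding bdd_fun_def by blast
  then have "bdd_fun (\<lambda>x y. A y x)" by (intro bdd_funI[where B=B]) auto
  then obtain T where T [measurable]: "T \<in> sets M" and le_T: "\<And>h. h \<in> borel_measurable M \<Longrightarrow> (\<And>x. \<bar>h x\<bar> \<le> 1) \<Longrightarrow>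
     avg (\<lambda>x y. A y x * h x * s y) \<le> avg (\<lambda>x y. A y x * (if x \<in> T then 1 else -1) * s y)"
    using avg_le_sign[OF _ s] by blast
  define t where "t x = (if x \<in> T then 1 else -1 :: real)" for x
  have t: "t \<in> borel_measurable M" "\<And>x. \<bar>t x\<bar> \<le> 1" unfolding t_def by auto
  have "avg (\<lambda>x y. A x y * s x * g y) \<le> avg (\<lambda>x y. A x y * s x * t y)"
    using le_T[OF g(1)] g swap[OF g(1)] swap[OF t] by (simp add: t_def)
  also have "\<dots> \<le> c" using sign[OF S T] by (simp add: s_def t_def)
  finally have "avg (\<lambda>x y. A x y * s x * g y) \<le> c" .
  moreover have "- avg (\<lambda>x y. A x y * f x * g y) = avg (\<lambda>x y. A x y * (- f x) * g y)"
    using avg_cmult[of "-1" "\<lambda>x y. A x y * f x * g y"] by simp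
  ultimately show "\<bar>avg (\<lambda>x y. A x y * f x * g y)\<bar> \<le> c"
    using le_S[OF f(1)] le_S[of "\<lambda>x. - f x"] f by (simp add: s_def)
qed

subsection \<open>Weak regularity\<close>


text \<open>Expanding the square changes the error by \<open>- 2 * c\<^sup>2\<close> plus
  \<open>c\<^sup>2\<close> times the average of \<open>h * h\<close>, and the latter average is at
  most 1.\<close>

lemma avg_square_perturb:
  assumes X: "bdd_fun X" and w: "bdd_fun w" and h: "bdd_fun h" and h1: "\<And>x y. \<bar>h x y\<bar> \<le> 1"
  defines "c \<equiv> avg (\<lambda>x y. (X x y - w x y) * h x y)"
  shows "avg (\<lambda>x y. (X x y - (w x y + c * h x y))\<^sup>2) \<le> avg (\<lambda>x y. (X x y - w x y)\<^sup>2) - c\<^sup>2"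
proof -
  note b = bdd_fun_diff bdd_fun_mult bdd_fun_add bdd_fun_const
  have "avg (\<lambda>x y. (X x y - (w x y + c * h x y))\<^sup>2) =
     avg (\<lambda>x y. (X x y - w x y) * (X x y - w x y) - (2 * c) * ((X x y - w x y) * h x y) + c\<^sup>2 * (h x y * h x y))"
    by (simp add: power2_eq_square algebra_simps)
  also have "\<dots> = avg (\<lambda>x y. (X x y - w x y) * (X x y - w x y)) - (2 * c) * c + c\<^sup>2 * avg (\<lambda>x y. h x y * h x y)"
    unfolding c_def by (subst avg_add avg_diff avg_cmult; (intro b X w h)?)+ simp
  also have "\<dots> \<le> avg (\<lambda>x y. (X x y - w x y) * (X x y - w x y)) - (2 * c) * c + c\<^sup>2 * 1"
  proof -
    have "h x y * h x y \<le> 1" for x y using h1[of x y] by (simp add: abs_square_le_1 flip: power2_eq_square)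
    then have "avg (\<lambda>x y. h x y * h x y) \<le> avg (\<lambda>x y. 1)" by (intro avg_mono b h)
    then show ?thesis by (intro add_left_mono mult_left_mono) auto
  qed
  finally show ?thesis by (simp add: power2_eq_square)
qed

abbreviation sq_error :: "('a \<Rightarrow> 'a \<Rightarrow> real) \<Rightarrow> ('a \<Rightarrow> nat) \<Rightarrow> (nat \<Rightarrow> nat \<Rightarrow> real) \<Rightarrow> real" where
  "sq_error X \<alpha> w \<equiv> avg (\<lambda>x y. (X x y - w (\<alpha> x) (\<alpha> y))\<^sup>2)"

text \<open>One labelling serves both kernels. The value matrices are bounded but neither symmetric
  nor confined to [0, 1], because the fit will be improved along directions that respect neither;
  \<open>symmetric_clip_fit\<close> restores both properties.\<close>

definition step_fit :: "nat \<Rightarrow> ('a \<Rightarrow> 'a \<Rightarrow> real) \<Rightarrow> ('a \<Rightarrow> 'a \<Rightarrow> real) \<Rightarrow> real set" where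
  "step_fit K X Y = {sq_error X \<alpha> v + sq_error Y \<alpha> w | \<alpha> v w.
     labelling \<alpha> \<and> (\<forall>x. \<alpha> x < K) \<and> (\<exists>B. \<forall>i j. \<bar>v i j\<bar> \<le> B) \<and> (\<exists>B. \<forall>i j. \<bar>w i j\<bar> \<le> B)}"

lemma step_fitE:
  assumes "z \<in> step_fit K X Y"
  obtains \<alpha> v w B C where "labelling \<alpha>" "\<And>x. \<alpha> x < K"
    "\<And>i j. \<bar>v i j\<bar> \<le> B" "\<And>i j. \<bar>w i j\<bar> \<le> C"
    "z = sq_error X \<alpha> v + sq_error Y \<alpha> w"
  using assms unfolding step_fit_def mem_Collect_eq 
proof (elim exE conjE)
  fix \<alpha> :: "'a \<Rightarrow> nat" and v w B C
  assume "z = sq_error X \<alpha> v + sq_error Y \<alpha> w"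
    "labelling \<alpha>" "\<forall>x. \<alpha> x < K" "\<forall>i j. \<bar>v i j\<bar> \<le> B" "\<forall>i j. \<bar>w i j\<bar> \<le> C"
  then show thesis by (intro that[of \<alpha> v B w C]) simp_all
qed

lemma step_fit_Inf_bounds:
  assumes "\<And>x y. \<bar>X x y\<bar> \<le> 1" "\<And>x y. \<bar>Y x y\<bar> \<le> 1" "bdd_fun X" "bdd_fun Y" "0 < K"
  shows "step_fit K X Y \<noteq> {}" "bdd_below (step_fit K X Y)" "0 \<le> Inf (step_fit K X Y)" "Inf (step_fit K X Y) \<le> 2"
proof -
  have bound: "avg (\<lambda>x y. (Z x y)\<^sup>2) \<le> 1" if "\<And>x y. \<bar>Z x y\<bar> \<le> 1" "bdd_fun Z" for Z
  proof -
    have "avg (\<lambda>x y. (Z x y)\<^sup>2) \<le> avg (\<lambda>x y. 1)"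
      using that by (intro avg_mono) (auto simp: power2_eq_square bdd_fun_mult abs_square_le_1[unfolded power2_eq_square])
    then show ?thesis by simp
  qed
  have mem: "avg (\<lambda>x y. (X x y)\<^sup>2) + avg (\<lambda>x y. (Y x y)\<^sup>2) \<in> step_fit K X Y"
    unfolding step_fit_def using \<open>0 < K\<close>
    by (intro CollectI exI[of _ "\<lambda>_. 0"] exI[of _ "\<lambda>_ _. 0"]) auto
  have nn: "0 \<le> z" if "z \<in> step_fit K X Y" for z
    using that unfolding step_fit_def
    by (elim CollectE exE conjE) (simp add: add_nonneg_nonneg avg_nonneg)
  show ne: "step_fit K X Y \<noteq> {}" using mem by auto
  show bb: "bdd_below (step_fit K X Y)" using nn by (rule bdd_belowI)
  show "0 \<le> Inf (step_fit K X Y)" using ne nn by (rule cInf_greatest)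
  show "Inf (step_fit K X Y) \<le> 2"
    using cInf_lower[OF mem bb] bound[of X] bound[of Y] assms by auto
qed

lemma step_fit_commute: "step_fit K X Y = step_fit K Y X"
proof -
  have "step_fit K X Y \<subseteq> step_fit K Y X" for X Y
    unfolding step_fit_def
  proof safe
    fix \<alpha> :: "'a \<Rightarrow> nat" and v w :: "nat \<Rightarrow> nat \<Rightarrow> real" and B B' assume *: "labelling \<alpha>" "\<forall>x. \<alpha> x < K" "\<forall>i j. \<bar>v i j\<bar> \<le> B" "\<forall>i j. \<bar>w i j\<bar> \<le> B'"
    then show "\<exists>(\<alpha>' :: 'a \<Rightarrow> nat) v' w'. sq_error X \<alpha> v + sq_error Y \<alpha> w =
        sq_error Y \<alpha>' v' + sq_error X \<alpha>' w' \<and>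
        random_variable (count_space UNIV) \<alpha>' \<and> (\<forall>x. \<alpha>' x < K) \<and> (\<exists>B. \<forall>i j. \<bar>v' i j\<bar> \<le> B) \<and> (\<exists>B. \<forall>i j. \<bar>w' i j\<bar> \<le> B)"
      by (intro exI[of _ \<alpha>] exI[of _ w] exI[of _ v]) (auto simp: add.commute)
  qed
  then show ?thesis by blast
qed

text \<open>If one more split of the labels by two sets cannot improve the least-squares fit by much, then
  the residual is orthogonal to every product of a function of the labels and two sign functions.\<close>

lemma cut_bound_of_step_fit:
  assumes X: "bdd_fun X" and Y: "bdd_fun Y"
    and X1: "\<And>x y. \<bar>X x y\<bar> \<le> 1" and Y1: "\<And>x y. \<bar>Y x y\<bar> \<le> 1"
    and \<alpha> [measurable]: "labelling \<alpha>" and \<alpha>K: "\<And>x. \<alpha> x < K"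
    and v: "\<And>i j. \<bar>v i j\<bar> \<le> B" and w: "\<And>i j. \<bar>w i j\<bar> \<le> B"
    and fit: "sq_error X \<alpha> v + sq_error Y \<alpha> w
       \<le> Inf (step_fit (4 * K) X Y) + \<eta>\<^sup>2"
    and r: "\<And>i j. \<bar>r i j\<bar> \<le> 1" and \<eta>: "0 \<le> \<eta>"
  shows "cut_bound (\<lambda>x y. (X x y - v (\<alpha> x) (\<alpha> y)) * r (\<alpha> x) (\<alpha> y)) \<eta>"
proof (rule cut_bound_signI)
  have bv: "bdd_fun (\<lambda>x y. v (\<alpha> x) (\<alpha> y))" and bw: "bdd_fun (\<lambda>x y. w (\<alpha> x) (\<alpha> y))"
    and br: "bdd_fun (\<lambda>x y. r (\<alpha> x) (\<alpha> y))"
    by (rule bdd_fun_label[OF \<alpha>], rule v w r)+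
  show "bdd_fun (\<lambda>x y. (X x y - v (\<alpha> x) (\<alpha> y)) * r (\<alpha> x) (\<alpha> y))"
    by (intro bdd_fun_mult bdd_fun_diff X bv br)
  fix S T assume [measurable]: "S \<in> sets M" "T \<in> sets M"
  define s where "s x = (if x \<in> S then 1 else -1 :: real)" for x
  define t where "t x = (if x \<in> T then 1 else -1 :: real)" for x
  define h where "h x y = r (\<alpha> x) (\<alpha> y) * s x * t y" for x y
  have s1: "\<bar>s x\<bar> \<le> 1" and t1: "\<bar>t x\<bar> \<le> 1" for x unfolding s_def t_def by auto
  have h: "bdd_fun h" unfolding h_def by (rule bdd_fun_test[OF br _ _ s1 t1]) (auto simp: s_def t_def)
  have h1: "\<bar>h x y\<bar> \<le> 1" for x y
    unfolding h_def using r[of "\<alpha> x" "\<alpha> y"] by (auto simp: abs_mult s_def t_def)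
  define c where "c = avg (\<lambda>x y. (X x y - v (\<alpha> x) (\<alpha> y)) * h x y)"
  \<comment> \<open>\<open>\<beta>\<close> packs the label and the memberships in \<open>S\<close>
    and \<open>T\<close> into one number, two binary digits being the source of the factor 4.
    \<open>v'\<close> decodes it and moves the fit along \<open>h\<close> by the correlation
    \<open>c\<close> of \<open>h\<close> with the residual; \<open>w'\<close> leaves the other
    kernel alone.\<close>
  define \<beta> where "\<beta> x = 4 * \<alpha> x + 2 * (if x \<in> S then 1 else 0) + (if x \<in> T then 1 else 0)" for x
  define v' where "v' i j = v (i div 4) (j div 4) + c * (r (i div 4) (j div 4) *
     (if i div 2 mod 2 = 1 then 1 else -1) * (if j mod 2 = 1 then 1 else -1))" for i j
  define w' where "w' i j = w (i div 4) (j div 4)" for i j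
  have [measurable]: "labelling \<beta>" unfolding \<beta>_def by measurable
  have \<beta>K: "\<beta> x < 4 * K" for x using \<alpha>K[of x] unfolding \<beta>_def by auto
  have \<beta>4: "\<beta> x div 4 = \<alpha> x" "\<beta> x div 2 mod 2 = 1 \<longleftrightarrow> x \<in> S" "\<beta> x mod 2 = 1 \<longleftrightarrow> x \<in> T" for x
    unfolding \<beta>_def by (auto; presburger)+
  have v': "v' (\<beta> x) (\<beta> y) = v (\<alpha> x) (\<alpha> y) + c * h x y" and w': "w' (\<beta> x) (\<beta> y) = w (\<alpha> x) (\<alpha> y)" for x y
    unfolding v'_def w'_def h_def s_def t_def by (simp_all only: \<beta>4)
  have "\<bar>v' i j\<bar> \<le> B + \<bar>c\<bar>" for i j
  proof -
    have "\<bar>c * (r (i div 4) (j div 4) * (if i div 2 mod 2 = 1 then 1 else -1) * (if j mod 2 = 1 then 1 else -1))\<bar>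
       \<le> \<bar>c\<bar> * 1"
      unfolding abs_mult using r[of "i div 4" "j div 4"] by (intro mult_left_mono) auto
    then show ?thesis unfolding v'_def using v[of "i div 4" "j div 4"] abs_triangle_ineq
      by (smt (verit) mult.right_neutral)
  qed
  moreover have "\<bar>w' i j\<bar> \<le> B" for i j unfolding w'_def by (rule w)
  ultimately have "sq_error X \<beta> v' + sq_error Y \<beta> w' \<in> step_fit (4 * K) X Y"
    unfolding step_fit_def using \<beta>K by (intro CollectI exI[of _ \<beta>] exI[of _ v'] exI[of _ w']) auto
  moreover have "0 < 4 * K" using \<alpha>K[of undefined] by simp
  ultimately have "Inf (step_fit (4 * K) X Y) \<le>
      avg (\<lambda>x y. (X x y - (v (\<alpha> x) (\<alpha> y) + c * h x y))\<^sup>2) + sq_error Y \<alpha> w"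
    using step_fit_Inf_bounds(2)[of X Y "4 * K"] X Y X1 Y1 by (simp add: cInf_lower v' w')
  moreover have "avg (\<lambda>x y. (X x y - (v (\<alpha> x) (\<alpha> y) + c * h x y))\<^sup>2) \<le> sq_error X \<alpha> v - c\<^sup>2"
    unfolding c_def by (rule avg_square_perturb[OF X bv h h1])
  ultimately have "c\<^sup>2 \<le> \<eta>\<^sup>2" using fit by linarith
  then have "c \<le> \<eta>" using \<eta> by (rule power2_le_imp_le)
  then show "avg (\<lambda>x y. (X x y - v (\<alpha> x) (\<alpha> y)) * r (\<alpha> x) (\<alpha> y) * (if x \<in> S then 1 else -1) * (if y \<in> T then 1 else -1)) \<le> \<eta>"
    unfolding c_def h_def s_def t_def by (simp add: mult.assoc)
qed

text \<open>Clipping to [0, 1] moves each value closer to the values of \<open>W\<close>, and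
  averaging with the transpose does not increase the error, by convexity of the square and symmetry
  of \<open>W\<close>.\<close>

lemma symmetric_clip_fit:
  fixes \<alpha> :: "'a \<Rightarrow> nat"
  assumes W: "kernel W" and \<alpha> [measurable]: "labelling \<alpha>" and v: "\<And>i j. \<bar>v i j\<bar> \<le> B"
  obtains w where "\<And>i j. w i j = w j i" "\<And>i j. 0 \<le> w i j" "\<And>i j. w i j \<le> 1"
    "sq_error W \<alpha> w \<le> sq_error W \<alpha> v"
proof
  define u where "u i j = max 0 (min 1 (v i j))" for i j
  define w where "w i j = (u i j + u j i) / 2" for i j :: nat
  have u1: "0 \<le> u i j" "u i j \<le> 1" for i j unfolding u_def by auto
  show "w i j = w j i" "0 \<le> w i j" "w i j \<le> 1" for i j
    unfolding w_def using u1[of i j] u1[of j i] by auto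
  have Wb: "bdd_fun W" by (rule bdd_fun_kernel[OF W])
  have bu: "bdd_fun (\<lambda>x y. u (\<alpha> x) (\<alpha> y))" "bdd_fun (\<lambda>x y. u (\<alpha> y) (\<alpha> x))"
    using u1 bdd_fun_label[OF \<alpha>, of u 1] bdd_fun_label[OF \<alpha>, of "\<lambda>i j. u j i" 1] by auto
  have bw: "bdd_fun (\<lambda>x y. w (\<alpha> x) (\<alpha> y))" and bv: "bdd_fun (\<lambda>x y. v (\<alpha> x) (\<alpha> y))"
    using \<open>\<And>i j. 0 \<le> w i j\<close> \<open>\<And>i j. w i j \<le> 1\<close> v by (intro bdd_fun_label[OF \<alpha>, of _ 1] bdd_fun_label[OF \<alpha>, of _ B]; auto)+
  have sq: "bdd_fun (\<lambda>x y. (F x y)\<^sup>2)" if "bdd_fun F" for F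
    using bdd_fun_mult[OF that that] by (simp add: power2_eq_square)
  let ?D = "\<lambda>x y. (W x y - u (\<alpha> x) (\<alpha> y))\<^sup>2"
  have bD: "bdd_fun ?D" by (intro sq bdd_fun_diff Wb bu)
  have Wsym: "W x y = W y x" "0 \<le> W x y" "W x y \<le> 1" for x y using W unfolding kernel_def by auto
  have "sq_error W \<alpha> w \<le> avg (\<lambda>x y. (1/2) * ?D x y + (1/2) * ?D y x)"
  proof (rule avg_mono)
    have "bdd_fun (\<lambda>x y. ?D y x)" by (subst Wsym(1)) (intro sq bdd_fun_diff Wb bu)
    then show "bdd_fun (\<lambda>x y. (1/2) * ?D x y + (1/2) * ?D y x)"
      by (intro bdd_fun_add bdd_fun_mult bdd_fun_const bD)
    fix x y
    have "(c - (a + b) / 2)\<^sup>2 \<le> (1/2) * (c - a)\<^sup>2 + (1/2) * (c - b)\<^sup>2" for a b c :: real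
      using zero_le_power2[of "a - b"] by (simp add: power2_eq_square field_simps)
    then show "(W x y - w (\<alpha> x) (\<alpha> y))\<^sup>2 \<le> (1/2) * ?D x y + (1/2) * ?D y x"
      unfolding w_def using Wsym(1)[of y x] by simp
  qed (intro sq bdd_fun_diff Wb bw)
  also have "\<dots> = (1/2) * avg ?D + (1/2) * avg (\<lambda>x y. ?D y x)"
  proof -
    have "bdd_fun (\<lambda>x y. ?D y x)" by (subst Wsym(1)) (intro sq bdd_fun_diff Wb bu)
    then show ?thesis
      unfolding avg_cmult[symmetric] by (intro avg_add bdd_fun_mult bdd_fun_const bD)
  qed
  also have "\<dots> = avg ?D" using avg_swap[OF bD] by simp
  also have "\<dots> \<le> sq_error W \<alpha> v"
  proof (rule avg_mono[OF bD])
    show "bdd_fun (\<lambda>x y. (W x y - v (\<alpha> x) (\<alpha> y))\<^sup>2)" by (intro sq bdd_fun_diff Wb bv)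
    show "(W x y - u (\<alpha> x) (\<alpha> y))\<^sup>2 \<le> (W x y - v (\<alpha> x) (\<alpha> y))\<^sup>2" for x y
      unfolding u_def abs_le_square_iff[symmetric] using Wsym(2,3)[of x y] by (auto simp: max_def min_def)
  qed
  finally show "sq_error W \<alpha> w \<le> sq_error W \<alpha> v" .
qed

end

text \<open>If each of \<open>J\<close> steps dropped by more than \<open>c / J\<close>, the total
  drop would exceed \<open>c\<close> and make \<open>f J\<close> negative.\<close>

lemma bounded_descent:
  fixes f :: "nat \<Rightarrow> real"
  assumes "f 0 \<le> c" "\<And>n. 0 \<le> f n" "0 < J"
  shows "\<exists>j<J. f j \<le> f (Suc j) + c / J"
proof (rule ccontr)
  assume "\<not> ?thesis"
  then have less: "f (Suc j) + c / J < f j" if "j < J" for j using that by force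
  have "f n + n * (c / J) \<le> f 0 \<and> (0 < n \<longrightarrow> f n + n * (c / J) < f 0)" if "n \<le> J" for n
    using that
  proof (induction n)
    case (Suc n)
    with less[of n] show ?case by (auto simp: algebra_simps add_divide_distrib)
  qed simp
  from this[of J] assms show False using assms(2)[of J] by simp
qed

context kernel_space
begin

text \<open>The multiplier \<open>r\<close> is quantified inside, so that it leaves the error at
  \<open>\<eta>\<close>; passing through \<open>cut_bound_step_mult\<close> would give
  \<open>K * K * \<eta>\<close>, which is useless because \<open>K\<close> depends on
  \<open>\<eta>\<close>.\<close>

definition regular_pair :: "real \<Rightarrow> nat \<Rightarrow> ('a \<Rightarrow> 'a \<Rightarrow> real) \<Rightarrow> ('a \<Rightarrow> 'a \<Rightarrow> real) \<Rightarrow>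
    ('a \<Rightarrow> nat) \<Rightarrow> (nat \<Rightarrow> nat \<Rightarrow> real) \<Rightarrow> (nat \<Rightarrow> nat \<Rightarrow> real) \<Rightarrow> bool" where
  "regular_pair \<eta> K W W' \<alpha> w w' \<longleftrightarrow> labelling \<alpha> \<and> (\<forall>x. \<alpha> x < K) \<and>
     (\<forall>i j. w i j = w j i \<and> 0 \<le> w i j \<and> w i j \<le> 1) \<and> (\<forall>i j. w' i j = w' j i \<and> 0 \<le> w' i j \<and> w' i j \<le> 1) \<and>
     (\<forall>r. (\<forall>i j. \<bar>r i j\<bar> \<le> 1) \<longrightarrow>
        cut_bound (\<lambda>x y. (W x y - w (\<alpha> x) (\<alpha> y)) * r (\<alpha> x) (\<alpha> y)) \<eta> \<and>
        cut_bound (\<lambda>x y. (W' x y - w' (\<alpha> x) (\<alpha> y)) * r (\<alpha> x) (\<alpha> y)) \<eta>)"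

text \<open>The least-squares infimum for \<open>4 ^ j\<close> labels lies between 0 and 2, so at
  one of the first \<open>J\<close> stages quadrupling the labels gains little. A near-optimal fit
  at that stage is regular by \<open>cut_bound_of_step_fit\<close>.\<close>

theorem weak_regularity:
  assumes "0 < \<eta>"
  obtains K where "0 < K" "\<And>W W'. kernel W \<Longrightarrow> kernel W' \<Longrightarrow> \<exists>\<alpha> w w'. regular_pair \<eta> K W W' \<alpha> w w'"
proof -
  \<comment> \<open>Of the slack \<open>3 / J\<close>, the part \<open>2 / J\<close> is the drop of
    the infimum at the chosen stage and \<open>1 / J\<close> is the distance of the chosen fit from
    that infimum.\<close>
  obtain J :: nat where J: "3 / \<eta>\<^sup>2 < J" using reals_Archimedean2 by blast
  moreover have "0 < 3 / \<eta>\<^sup>2" using assms by simp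
  ultimately have "0 < real J" by linarith
  then have J0: "0 < J" by simp
  have J': "3 / J \<le> \<eta>\<^sup>2" using J assms \<open>0 < real J\<close> by (simp add: field_simps)
  show thesis
  proof (rule that[of "4 ^ J"])
    fix W W' assume W: "kernel W" and W': "kernel W'"
    have bW: "bdd_fun W" "bdd_fun W'" using W W' by (auto intro: bdd_fun_kernel)
    have W1: "\<bar>W x y\<bar> \<le> 1" "\<bar>W' x y\<bar> \<le> 1" for x y using W W' unfolding kernel_def by (auto simp: abs_le_iff intro: order_trans[of _ 0])
    let ?f = "\<lambda>j. Inf (step_fit (4 ^ j) W W')"
    note bnd = step_fit_Inf_bounds[of W W', OF W1 bW]
    have "\<exists>j<J. ?f j \<le> ?f (Suc j) + 2 / J"
      by (rule bounded_descent) (use bnd J0 in auto)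
    then obtain j where j: "j < J" "?f j \<le> ?f (Suc j) + 2 / J" by blast
    have "?f j < ?f j + 1 / J" using J0 by simp
    then obtain z where z: "z \<in> step_fit (4 ^ j) W W'" "z < ?f j + 1 / J"
      using cInf_lessD[OF bnd(1)[of "4 ^ j"], of "?f j + 1 / J"] by auto
    obtain \<alpha> :: "'a \<Rightarrow> nat" and v v' B B' where \<alpha>: "labelling \<alpha>" "\<And>x. \<alpha> x < 4 ^ j"
      and v: "\<And>i j. \<bar>v i j\<bar> \<le> B" and v': "\<And>i j. \<bar>v' i j\<bar> \<le> B'"
      and z_eq: "z = sq_error W \<alpha> v + sq_error W' \<alpha> v'"
      using z(1) by (rule step_fitE) (rule that)
    obtain w where w: "\<And>i j. w i j = w j i" "\<And>i j. 0 \<le> w i j" "\<And>i j. w i j \<le> 1"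
      "sq_error W \<alpha> w \<le> sq_error W \<alpha> v"
      by (rule symmetric_clip_fit[OF W \<alpha>(1) v]) (rule that)
    obtain w' where w': "\<And>i j. w' i j = w' j i" "\<And>i j. 0 \<le> w' i j" "\<And>i j. w' i j \<le> 1"
      "sq_error W' \<alpha> w' \<le> sq_error W' \<alpha> v'"
      by (rule symmetric_clip_fit[OF W' \<alpha>(1) v']) (rule that)
    have w1: "\<bar>w i j\<bar> \<le> 1" "\<bar>w' i j\<bar> \<le> 1" for i j using w(2,3)[of i j] w'(2,3)[of i j] by auto
    have "2 / real J + 1 / real J = 3 / real J" by (simp add: field_simps)
    then have fit: "sq_error W \<alpha> w + sq_error W' \<alpha> w'
        \<le> Inf (step_fit (4 * 4 ^ j) W W') + \<eta>\<^sup>2"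
      using w(4) w'(4) z(2) z_eq j(2) J' by (simp only: power_Suc)
    have \<alpha>J: "\<alpha> x < 4 ^ J" for x using \<alpha>(2)[of x] j(1) by (meson less_imp_le_nat one_le_numeral order_less_le_trans power_increasing)
    have cb: "cut_bound (\<lambda>x y. (W x y - w (\<alpha> x) (\<alpha> y)) * r (\<alpha> x) (\<alpha> y)) \<eta>"
      "cut_bound (\<lambda>x y. (W' x y - w' (\<alpha> x) (\<alpha> y)) * r (\<alpha> x) (\<alpha> y)) \<eta>" if "\<forall>i j. \<bar>r i j\<bar> \<le> 1" for r
    proof -
      show "cut_bound (\<lambda>x y. (W x y - w (\<alpha> x) (\<alpha> y)) * r (\<alpha> x) (\<alpha> y)) \<eta>"
        using that assms fit by (intro cut_bound_of_step_fit[OF bW W1 \<alpha> w1]) auto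
      show "cut_bound (\<lambda>x y. (W' x y - w' (\<alpha> x) (\<alpha> y)) * r (\<alpha> x) (\<alpha> y)) \<eta>"
        using that assms fit
        by (intro cut_bound_of_step_fit[where v=w' and w=w, OF bW(2,1) W1(2,1) \<alpha> w1(2,1)])
            (auto simp: step_fit_commute[of _ W'] add.commute)
    qed
    show "\<exists>\<alpha> w w'. regular_pair \<eta> (4 ^ J) W W' \<alpha> w w'"
      unfolding regular_pair_def
      by (intro exI[of _ \<alpha>] exI[of _ w] exI[of _ w'] conjI allI impI; (rule \<alpha>(1) \<alpha>J w(1-3) w'(1-3))?)
        (erule cb)+
  qed simp
qed

end

subsection \<open>Counting lemma\<close>

text \<open>The probability that an edge variable with parameter \<open>W x y\<close> takes the
  value \<open>b\<close>. Accordingly \<open>pattern_weight\<close> is the conditional probability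
  of a whole edge pattern, given the points.\<close>

definition edge_weight :: "('a \<Rightarrow> 'a \<Rightarrow> real) \<Rightarrow> bool \<Rightarrow> 'a \<Rightarrow> 'a \<Rightarrow> real" where
  "edge_weight W b x y = (if b then W x y else 1 - W x y)"

definition index_pairs :: "nat \<Rightarrow> (nat \<times> nat) set" where
  "index_pairs k = {(i, j). 1 \<le> i \<and> i < j \<and> j \<le> k}"

abbreviation pattern_weight :: "nat \<Rightarrow> ('a \<Rightarrow> 'a \<Rightarrow> real) \<Rightarrow> (nat \<times> nat \<Rightarrow> bool) \<Rightarrow> (nat \<Rightarrow> 'a) \<Rightarrow> real" where
  "pattern_weight k W b x \<equiv> \<Prod>e\<in>index_pairs k. edge_weight W (b e) (x (fst e)) (x (snd e))"

lemma finite_index_pairs [simp]: "finite (index_pairs k)"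
  by (rule finite_subset[of _ "{1..k} \<times> {1..k}"]) (auto simp: index_pairs_def)

context kernel_space
begin

abbreviation cube :: "nat set \<Rightarrow> (nat \<Rightarrow> 'a) measure" where
  "cube J \<equiv> \<Pi>\<^sub>M i\<in>J. M"

lemma prob_space_cube: "prob_space (cube J)"
  by (intro prob_space_PiM prob_space_axioms)

lemma integral_cube_two:
  fixes F :: "(nat \<Rightarrow> 'a) \<Rightarrow> real"
  assumes J: "finite J" "i \<in> J" "j \<in> J" "i \<noteq> j"
    and F: "F \<in> borel_measurable (cube J)" and FB: "\<And>x. \<bar>F x\<bar> \<le> B"
  shows "(\<integral>x. F x \<partial>cube J) = (\<integral>x. (\<integral>u. (\<integral>v. F (x(i := u, j := v)) \<partial>M) \<partial>M) \<partial>cube (J - {i, j}))"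
proof -
  interpret PP: product_sigma_finite "\<lambda>_::nat. M" ..
  let ?I = "J - {i, j}"
  have J_eq: "J = insert j (insert i ?I)" using J by auto
  have [measurable]: "F \<in> borel_measurable (cube (insert j (insert i ?I)))" using F J_eq by simp
  interpret A: prob_space "cube (insert j (insert i ?I))" by (rule prob_space_cube)
  interpret B: prob_space "cube (insert i ?I)" by (rule prob_space_cube)
  have "(\<integral>x. F x \<partial>cube J) = (\<integral>x. F x \<partial>cube (insert j (insert i ?I)))" using J_eq by simp
  also have "\<dots> = (\<integral>x. (\<integral>v. F (x(j := v)) \<partial>M) \<partial>cube (insert i ?I))"
    using J FB by (intro PP.product_integral_insert A.integrable_const_bound[where B=B]) auto
  also have "\<dots> = (\<integral>x. (\<integral>u. (\<integral>v. F ((x(i := u))(j := v)) \<partial>M) \<partial>M) \<partial>cube ?I)"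
  proof (intro PP.product_integral_insert B.integrable_const_bound[where B=B])
    have "(\<lambda>x. \<integral>v. (\<lambda>(f, y). F (f(j := y))) (x, v) \<partial>M) \<in> borel_measurable (cube (insert i ?I))"
      by measurable
    then show "(\<lambda>x. \<integral>v. F (x(j := v)) \<partial>M) \<in> borel_measurable (cube (insert i ?I))" by simp
    show "AE x in cube (insert i ?I). norm (\<integral>v. F (x(j := v)) \<partial>M) \<le> B"
      using FB by (auto intro!: abs_integral_le)
  qed (use J in auto)
  finally show ?thesis .
qed

lemma integral_cube_pair:
  assumes J: "finite J" "i \<in> J" "j \<in> J" "i \<noteq> j" and F: "bdd_fun F"
  shows "(\<integral>x. F (x i) (x j) \<partial>cube J) = avg F"
proof -
  have [measurable]: "measurable2 F" by (rule bdd_fun_measurable[OF F])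
  obtain B where "\<And>x y. \<bar>F x y\<bar> \<le> B" using F unfolding bdd_fun_def by blast
  moreover have "(\<lambda>x. F (x i) (x j)) \<in> borel_measurable (cube J)" using J by measurable
  ultimately have "(\<integral>x. F (x i) (x j) \<partial>cube J) = (\<integral>x. (\<integral>u. (\<integral>v. F u v \<partial>M) \<partial>M) \<partial>cube (J - {i, j}))"
    using integral_cube_two[OF J, of "\<lambda>x. F (x i) (x j)" B] \<open>i \<noteq> j\<close> by simp
  also have "\<dots> = avg F"
    by (simp add: avg_fst[OF F] prob_space.prob_space[OF prob_space_cube])
  finally show ?thesis .
qed

text \<open>Two different coordinates have joint law \<open>M \<Otimes>\<^sub>M M\<close>, so null
  sets pull back to null sets. This lets a kernel be changed on a null set without affecting
  samples.\<close>

lemma AE_cube_pair: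
  assumes J: "finite J" "i \<in> J" "j \<in> J" "i \<noteq> j" and P: "AE p in M \<Otimes>\<^sub>M M. R (fst p) (snd p)"
  shows "AE x in cube J. R (x i) (x j)"
proof -
  from P obtain N where N: "\<And>p. p \<in> space (M \<Otimes>\<^sub>M M) - N \<Longrightarrow> R (fst p) (snd p)" "N \<in> null_sets (M \<Otimes>\<^sub>M M)"
    by (rule AE_E3) (rule that)
  have [measurable]: "N \<in> sets (M \<Otimes>\<^sub>M M)" using N by auto
  interpret C: prob_space "cube J" by (rule prob_space_cube)
  let ?F = "\<lambda>x y. indicator N (x, y) :: real"
  have "bdd_fun ?F" by (rule bdd_funI[where B=1]) (auto simp: indicator_def)
  from integral_cube_pair[OF J this]
  have "(\<integral>x. indicator N (x i, x j) \<partial>cube J) = avg ?F" .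
  also have "avg ?F = measure (M \<Otimes>\<^sub>M M) N" unfolding avg_def by simp
  also have "\<dots> = 0" using N by (simp add: measure_eq_0_null_sets)
  finally have "(\<integral>x. indicator {x\<in>space (cube J). (x i, x j) \<in> N} x \<partial>cube J) = (0::real)"
    by (subst (asm) Bochner_Integration.integral_cong[OF refl]) (auto simp: indicator_def)
  then have "measure (cube J) {x\<in>space (cube J). (x i, x j) \<in> N} = 0"
    using J by (simp add: Int_absorb2 Collect_mono_iff)
  then have "AE x in cube J. (x i, x j) \<notin> N"
    using J by (subst AE_iff_measurable[OF _ refl]) (auto simp: C.emeasure_eq_measure)
  then show ?thesis
  proof (rule AE_mp, intro AE_I2 impI)
    fix x assume "x \<in> space (cube J)" "(x i, x j) \<notin> N"
    then show "R (x i) (x j)" using N(1)[of "(x i, x j)"] J by (auto simp: space_PiM space_pair_measure)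
  qed
qed

text \<open>Once all points other than \<open>x i\<close> and \<open>x j\<close> are frozen, the factors of the integrand become a
  function of \<open>x i\<close> alone and a function of \<open>x j\<close> alone.\<close>

lemma cut_bound_cube:
  assumes J: "finite J" "i \<in> J" "j \<in> J" "i \<noteq> j"
    and D: "bdd_fun D" "cut_bound D c"
    and P: "P \<in> borel_measurable (cube J)" "\<And>x. \<bar>P x\<bar> \<le> 1" "\<And>x t. P (x(j := t)) = P x"
    and Q: "Q \<in> borel_measurable (cube J)" "\<And>x. \<bar>Q x\<bar> \<le> 1" "\<And>x t. Q (x(i := t)) = Q x"
  shows "\<bar>\<integral>x. D (x i) (x j) * P x * Q x \<partial>cube J\<bar> \<le> c"
proof -
  note [measurable] = P(1) Q(1)
  have [measurable]: "measurable2 D" by (rule bdd_fun_measurable[OF D(1)])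
  obtain B where B: "\<And>x y. \<bar>D x y\<bar> \<le> B" using D unfolding bdd_fun_def by blast
  interpret C: prob_space "cube (J - {i, j})" by (rule prob_space_cube)
  have "\<bar>D (x i) (x j) * P x * Q x\<bar> \<le> B * 1 * 1" for x
    unfolding abs_mult using B[of undefined undefined] by (intro mult_mono B P Q mult_nonneg_nonneg) auto
  moreover have "(\<lambda>x. D (x i) (x j) * P x * Q x) \<in> borel_measurable (cube J)" using J by measurable
  ultimately have "(\<integral>x. D (x i) (x j) * P x * Q x \<partial>cube J) = (\<integral>x. (\<integral>u. (\<integral>v.
      D u v * P (x(i := u, j := v)) * Q (x(i := u, j := v)) \<partial>M) \<partial>M) \<partial>cube (J - {i, j}))"
    using integral_cube_two[OF J, of "\<lambda>x. D (x i) (x j) * P x * Q x" "B * 1 * 1"] \<open>i \<noteq> j\<close> by simp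
  also have "\<bar>\<dots>\<bar> \<le> c"
  proof -
    have "\<bar>\<integral>u. (\<integral>v. D u v * P (x(i := u, j := v)) * Q (x(i := u, j := v)) \<partial>M) \<partial>M\<bar> \<le> c"
      if x: "x \<in> space (cube (J - {i, j}))" for x
    proof -
      obtain y where y: "y \<in> space M" using not_empty by blast
      define f where "f u = P (x(i := u, j := y))" for u
      define g where "g v = Q (x(i := y, j := v))" for v
      have upd: "(\<lambda>u. x(i := h u, j := k u)) \<in> M \<rightarrow>\<^sub>M cube J"
        if [measurable]: "h \<in> M \<rightarrow>\<^sub>M M" "k \<in> M \<rightarrow>\<^sub>M M" for h k
      proof (rule measurable_fun_upd[where J="J - {j}"])
        show "J = (J - {j}) \<union> {j}" using J by auto
        show "(\<lambda>u. x(i := h u)) \<in> M \<rightarrow>\<^sub>M cube (J - {j})"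
          by (rule measurable_fun_upd[where J="J - {i, j}"]) (use J x in auto)
      qed simp
      have meas: "f \<in> borel_measurable M" "g \<in> borel_measurable M"
        unfolding f_def g_def
        by (rule measurable_compose[OF upd[of "\<lambda>u. u" "\<lambda>_. y"] P(1)]
            measurable_compose[OF upd[of "\<lambda>_. y" "\<lambda>u. u"] Q(1)]; simp add: y)+
      have fg1: "\<bar>f u\<bar> \<le> 1" "\<bar>g u\<bar> \<le> 1" for u unfolding f_def g_def by (rule P(2) Q(2))+
      have PQ: "P (x(i := u, j := v)) = f u" "Q (x(i := u, j := v)) = g v" for u v
      proof -
        have "P (x(i := u, j := v)) = P (x(i := u))" by (rule P(3))
        then show "P (x(i := u, j := v)) = f u" unfolding f_def by (simp add: P(3))
        have "x(i := u, j := v) = x(j := v, i := u)" "x(i := y, j := v) = x(j := v, i := y)"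
          using J by (auto simp: fun_upd_twist)
        then show "Q (x(i := u, j := v)) = g v" unfolding g_def by (simp add: Q(3))
      qed
      have "(\<integral>u. (\<integral>v. D u v * P (x(i := u, j := v)) * Q (x(i := u, j := v)) \<partial>M) \<partial>M)
        = avg (\<lambda>u v. D u v * f u * g v)"
        unfolding PQ by (rule avg_fst[symmetric], rule bdd_fun_test[OF D(1) meas fg1])
      then show ?thesis using cut_boundD[OF D(2) meas fg1] by simp
    qed
    \<comment> \<open>\<open>abs_integral_le\<close> asks for a bound at every \<open>x\<close>,
      while the one just shown holds on the space of the cube; hence the default 0
      elsewhere.\<close>
    then have "\<bar>\<integral>x. (if x \<in> space (cube (J - {i, j})) then (\<integral>u. (\<integral>v. D u v * P (x(i := u, j := v)) *
        Q (x(i := u, j := v)) \<partial>M) \<partial>M) else 0) \<partial>cube (J - {i, j})\<bar> \<le> c"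
      using cut_bound_nonneg[OF D(2)] by (intro C.abs_integral_le) auto
    then show ?thesis by (simp cong: Bochner_Integration.integral_cong)
  qed
  finally show ?thesis .
qed

text \<open>The factors are exchanged one edge at a time, each exchange costing \<open>c\<close> by
  \<open>cut_bound_cube\<close>; the hybrid \<open>H D\<close> has \<open>A\<close> on
  \<open>D\<close> and \<open>B\<close> elsewhere. The kernels may depend on the edge because
  patterns mix \<open>W\<close> with \<open>1 - W\<close>.\<close>

lemma counting_lemma:
  fixes A B :: "nat \<times> nat \<Rightarrow> 'a \<Rightarrow> 'a \<Rightarrow> real"
  assumes J: "finite J" and E: "E \<subseteq> {(i, j). i \<in> J \<and> j \<in> J \<and> i < j}"
    and A: "\<And>e. bdd_fun (A e)" "\<And>e x y. \<bar>A e x y\<bar> \<le> 1"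
    and B: "\<And>e. bdd_fun (B e)" "\<And>e x y. \<bar>B e x y\<bar> \<le> 1"
    and c: "\<And>e. cut_bound (\<lambda>x y. A e x y - B e x y) c"
  shows "\<bar>(\<integral>x. (\<Prod>e\<in>E. A e (x (fst e)) (x (snd e))) \<partial>cube J) -
     (\<integral>x. (\<Prod>e\<in>E. B e (x (fst e)) (x (snd e))) \<partial>cube J)\<bar> \<le> real (card E) * c"
proof -
  interpret C: prob_space "cube J" by (rule prob_space_cube)
  have [measurable]: "measurable2 (A e)" "measurable2 (B e)" for e
    by (rule bdd_fun_measurable, rule A B)+
  have finE: "finite E" using E by (rule finite_subset) (rule finite_subset[of _ "J \<times> J"], use J in auto)
  define H where "H D e = (if e \<in> D then A e else B e)" for D e
  have H1: "\<bar>H D e x y\<bar> \<le> 1" for D e x y unfolding H_def using A B by auto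
  have [measurable]: "measurable2 (H D e)" for D e unfolding H_def by auto
  have prod1: "\<bar>\<Prod>e\<in>F. H D e (x (fst e)) (x (snd e))\<bar> \<le> 1" for F D x
    unfolding abs_prod by (intro prod_le_1) (auto simp: H1)
  have prod_meas: "(\<lambda>x. \<Prod>e\<in>F. H D e (x (fst e)) (x (snd e))) \<in> borel_measurable (cube J)" if "F \<subseteq> E" for F D
  proof (intro borel_measurable_prod)
    fix e assume "e \<in> F"
    then have [measurable]: "fst e \<in> J" "snd e \<in> J" using that E by auto
    show "(\<lambda>x. H D e (x (fst e)) (x (snd e))) \<in> borel_measurable (cube J)" by measurable
  qed
  have "\<bar>(\<integral>x. (\<Prod>e\<in>E. H D e (x (fst e)) (x (snd e))) \<partial>cube J) -
     (\<integral>x. (\<Prod>e\<in>E. H {} e (x (fst e)) (x (snd e))) \<partial>cube J)\<bar> \<le> real (card D) * c" if "finite D" "D \<subseteq> E" for D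
    using that
  proof (induction D rule: finite_induct)
    case (insert e D)
    define i j where "i = fst e" and "j = snd e"
    have e: "e = (i, j)" "e \<in> E" "i \<in> J" "j \<in> J" "i < j" using insert.prems E by (auto simp: i_def j_def)
    define F where "F = E - {e}"
    \<comment> \<open>Edges in \<open>E1\<close> avoid \<open>j\<close>. An edge outside
      \<open>E1\<close> contains \<open>j\<close> and differs from \<open>(i, j)\<close>, so it
      cannot contain \<open>i\<close>, as pairs are increasing. Thus the two products are functions
      of the kind that \<open>cut_bound_cube\<close> wants.\<close>
    define E1 where "E1 = {e\<in>F. fst e \<noteq> j \<and> snd e \<noteq> j}"
    define E2 where "E2 = {e\<in>F. \<not> (fst e \<noteq> j \<and> snd e \<noteq> j)}"
    have F_eq: "F = E1 \<union> E2" "E1 \<inter> E2 = {}" and fin: "finite E1" "finite E2" "finite F"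
      using finE by (auto simp: E1_def E2_def F_def)
    let ?P = "\<lambda>F x. \<Prod>e\<in>F. H D e (x (fst e)) (x (snd e))"
    have E_eq: "E = insert e F" "e \<notin> F" using e by (auto simp: F_def)
    have split: "(\<Prod>e\<in>E. H D' e (x (fst e)) (x (snd e))) =
       H D' e (x i) (x j) * (?P E1 x * ?P E2 x)" if "D' = D \<or> D' = insert e D" for x D'
    proof -
      have "H D' e' = H D e'" if "e' \<in> F" for e' using that \<open>D' = _ \<or> _\<close> E_eq by (auto simp: H_def)
      then have "(\<Prod>e\<in>F. H D' e (x (fst e)) (x (snd e))) = ?P F x" by (intro prod.cong) auto
      also have "\<dots> = ?P E1 x * ?P E2 x" unfolding F_eq(1) using F_eq fin by (intro prod.union_disjoint) auto
      finally show ?thesis unfolding E_eq(1) using E_eq fin by (simp add: i_def j_def)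
    qed
    have int: "integrable (cube J) (\<lambda>x. \<Prod>e\<in>E. H D' e (x (fst e)) (x (snd e)))" for D'
      using prod1 prod_meas by (intro C.integrable_const_bound[where B=1]) auto
    have "(\<integral>x. (\<Prod>a\<in>E. H (insert e D) a (x (fst a)) (x (snd a))) \<partial>cube J) -
       (\<integral>x. (\<Prod>e\<in>E. H D e (x (fst e)) (x (snd e))) \<partial>cube J) =
       (\<integral>x. (A e (x i) (x j) - B e (x i) (x j)) * ?P E1 x * ?P E2 x \<partial>cube J)"
    proof -
      have "(\<Prod>a\<in>E. H (insert e D) a (x (fst a)) (x (snd a))) - (\<Prod>e\<in>E. H D e (x (fst e)) (x (snd e))) =
        (A e (x i) (x j) - B e (x i) (x j)) * ?P E1 x * ?P E2 x" for x
        using split[of "insert e D" x] split[of D x] \<open>e \<notin> D\<close> H_def[of "insert e D" e] H_def[of D e]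
        by (simp add: algebra_simps)
      then show ?thesis
        using Bochner_Integration.integral_diff[OF int int, of "insert e D" D] by simp
    qed
    also have "\<bar>\<dots>\<bar> \<le> c"
    proof (rule cut_bound_cube)
      show "?P E1 (x(j := t)) = ?P E1 x" for x t
        by (intro prod.cong) (auto simp: E1_def)
      show "?P E2 (x(i := t)) = ?P E2 x" for x t
      proof (intro prod.cong refl)
        fix e' assume e': "e' \<in> E2"
        then have "fst e' < snd e'" "fst e' = j \<or> snd e' = j" "e' \<noteq> (i, j)" using E e by (auto simp: E2_def F_def)
        then have "fst e' \<noteq> i" "snd e' \<noteq> i" using \<open>i < j\<close> by (auto simp: prod_eq_iff)
        then show "H D e' ((x(i := t)) (fst e')) ((x(i := t)) (snd e')) = H D e' (x (fst e')) (x (snd e'))" by simp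
      qed
      have "E1 \<subseteq> E" "E2 \<subseteq> E" by (auto simp: E1_def E2_def F_def)
      then show "?P E1 \<in> borel_measurable (cube J)" "?P E2 \<in> borel_measurable (cube J)" by (simp_all only: prod_meas)
      show "bdd_fun (\<lambda>x y. A e x y - B e x y)" by (intro bdd_fun_diff A B)
    qed (use J e in \<open>auto intro!: c prod1\<close>)
    finally have "\<bar>(\<integral>x. (\<Prod>a\<in>E. H (insert e D) a (x (fst a)) (x (snd a))) \<partial>cube J) -
       (\<integral>x. (\<Prod>e\<in>E. H D e (x (fst e)) (x (snd e))) \<partial>cube J)\<bar> \<le> c" .
    moreover have "real (card (insert e D)) * c = real (card D) * c + c"
      using insert.hyps by (simp add: algebra_simps)
    ultimately show ?case using insert.IH insert.prems by auto
  qed simp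
  from this[OF finE] show ?thesis by (simp add: H_def)
qed

definition pattern_prob :: "nat \<Rightarrow> ('a \<Rightarrow> 'a \<Rightarrow> real) \<Rightarrow> (nat \<times> nat \<Rightarrow> bool) \<Rightarrow> real" where
  "pattern_prob k W b = (\<integral>x. pattern_weight k W b x \<partial>cube {1..k})"

lemma kernel_bounds: "kernel W \<Longrightarrow> 0 \<le> W x y" "kernel W \<Longrightarrow> W x y \<le> 1" "kernel W \<Longrightarrow> \<bar>W x y\<bar> \<le> 1"
  unfolding kernel_def by (auto simp: abs_le_iff intro: order_trans[of _ 0])

lemma edge_weight_bdd:
  assumes "kernel W" shows "bdd_fun (edge_weight W b)" "\<bar>edge_weight W b x y\<bar> \<le> 1" "0 \<le> edge_weight W b x y"
proof -
  show "bdd_fun (edge_weight W b)"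
    using bdd_fun_kernel[OF assms] bdd_fun_diff[OF bdd_fun_const[of 1] bdd_fun_kernel[OF assms]]
    by (cases b) (simp_all add: edge_weight_def[abs_def])
  show "\<bar>edge_weight W b x y\<bar> \<le> 1" "0 \<le> edge_weight W b x y"
    using kernel_bounds[OF assms, of x y] by (auto simp: edge_weight_def)
qed

lemma edge_measurable:
  assumes F: "bdd_fun F" and e: "e \<in> index_pairs k"
  shows "(\<lambda>x. F (x (fst e)) (x (snd e))) \<in> borel_measurable (cube {1..k})"
proof -
  have [measurable]: "fst e \<in> {1..k}" "snd e \<in> {1..k}" using e by (auto simp: index_pairs_def)
  have [measurable]: "measurable2 F" by (rule bdd_fun_measurable[OF F])
  show ?thesis by measurable
qed

lemma AE_edges:
  assumes "AE p in M \<Otimes>\<^sub>M M. R (fst p) (snd p)"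
  shows "AE x in cube {1..k}. \<forall>e\<in>index_pairs k. R (x (fst e)) (x (snd e))"
proof (rule AE_finite_allI[OF finite_index_pairs])
  fix e assume "e \<in> index_pairs k"
  then show "AE x in cube {1..k}. R (x (fst e)) (x (snd e))"
    by (intro AE_cube_pair[OF _ _ _ _ assms]) (auto simp: index_pairs_def)
qed

lemma pattern_prob_diff:
  assumes U: "kernel U" and W: "kernel W" and c: "cut_bound (\<lambda>x y. U x y - W x y) c"
  shows "\<bar>pattern_prob k U b - pattern_prob k W b\<bar> \<le> real (card (index_pairs k)) * c"
  unfolding pattern_prob_def
proof (rule counting_lemma)
  show "cut_bound (\<lambda>x y. edge_weight U (b e) x y - edge_weight W (b e) x y) c" for e
    using c cut_bound_minus[OF c] by (cases "b e") (simp_all add: edge_weight_def)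
qed (use edge_weight_bdd U W in \<open>auto simp: index_pairs_def\<close>)

text \<open>Labels of independent points are independent, so the label vector is distributed as a
  product of the single label law.\<close>

lemma integral_cube_label:
  fixes \<zeta> \<xi> :: "'a \<Rightarrow> 'b" and \<Phi> :: "(nat \<Rightarrow> 'b) \<Rightarrow> real"
  assumes J: "finite J" and [measurable]: "labelling \<zeta>" "labelling \<xi>"
    and law: "distr M (count_space UNIV) \<zeta> = distr M (count_space UNIV) \<xi>"
    and \<Phi> [measurable]: "\<Phi> \<in> borel_measurable (\<Pi>\<^sub>M i\<in>J. count_space UNIV)"
  shows "(\<integral>x. \<Phi> (compose J \<zeta> x) \<partial>cube J) = (\<integral>x. \<Phi> (compose J \<xi> x) \<partial>cube J)"
proof -
  define a :: 'b where "a = undefined"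
  have comp: "compose J \<eta> \<in> cube J \<rightarrow>\<^sub>M (\<Pi>\<^sub>M i\<in>J. count_space UNIV)"
    if [measurable]: "labelling \<eta>" for \<eta> :: "'a \<Rightarrow> 'b"
    unfolding compose_def by measurable
  have "distr (cube J) (\<Pi>\<^sub>M i\<in>J. count_space UNIV) (compose J \<eta>) = (\<Pi>\<^sub>M i\<in>J. distr M (count_space UNIV) \<eta>)"
    if [measurable]: "labelling \<eta>" for \<eta> :: "'a \<Rightarrow> 'b"
  proof -
    \<comment> \<open>The rule for image measures of products wants probability spaces as targets.
      \<open>return (count_space UNIV) a\<close> is one, with the same measurable sets as
      \<open>count_space UNIV\<close>, and only these sets matter to \<open>distr\<close>.\<close>
    have "distr (cube J) (\<Pi>\<^sub>M i\<in>J. return (count_space UNIV) a) (compose J \<eta>) =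
       (\<Pi>\<^sub>M i\<in>J. distr M (return (count_space UNIV) a) \<eta>)"
      by (rule distr_PiM_finite_prob_space') (use J in \<open>auto intro: prob_space_axioms prob_space_return\<close>)
    moreover have "distr M (return (count_space UNIV) a) \<eta> = distr M (count_space UNIV) \<eta>"
      by (rule distr_cong) auto
    moreover have "distr (cube J) (\<Pi>\<^sub>M i\<in>J. return (count_space UNIV) a) (compose J \<eta>) =
        distr (cube J) (\<Pi>\<^sub>M i\<in>J. count_space UNIV) (compose J \<eta>)"
      by (intro distr_cong sets_PiM_cong refl) auto
    ultimately show ?thesis by simp
  qed
  then have "distr (cube J) (\<Pi>\<^sub>M i\<in>J. count_space UNIV) (compose J \<zeta>) =
    distr (cube J) (\<Pi>\<^sub>M i\<in>J. count_space UNIV) (compose J \<xi>)" by (simp add: law)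
  then have "(\<integral>y. \<Phi> y \<partial>distr (cube J) (\<Pi>\<^sub>M i\<in>J. count_space UNIV) (compose J \<zeta>)) =
    (\<integral>y. \<Phi> y \<partial>distr (cube J) (\<Pi>\<^sub>M i\<in>J. count_space UNIV) (compose J \<xi>))" by simp
  then show ?thesis by (simp add: integral_distr comp)
qed

lemma avg_label_cong:
  fixes \<zeta> \<xi> :: "'a \<Rightarrow> 'b::countable"
  assumes [measurable]: "labelling \<zeta>" "labelling \<xi>"
    and law: "distr M (count_space UNIV) \<zeta> = distr M (count_space UNIV) \<xi>" and z: "\<And>i j. \<bar>z i j\<bar> \<le> B"
  shows "avg (\<lambda>x y. z (\<zeta> x) (\<zeta> y)) = avg (\<lambda>x y. z (\<xi> x) (\<xi> y))"
proof -
  let ?J = "{0, 1 :: nat}"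
  have eq: "avg (\<lambda>x y. z (\<eta> x) (\<eta> y)) = (\<integral>x. (\<lambda>t. z (t 0) (t 1)) (compose ?J \<eta> x) \<partial>cube ?J)"
    if "labelling \<eta>" for \<eta>
    using integral_cube_pair[of ?J 0 1 "\<lambda>x y. z (\<eta> x) (\<eta> y)"] bdd_fun_label[OF that, of z B] z
    by (simp add: compose_def)
  have meas: "(\<lambda>t. z (t 0) (t 1)) \<in> borel_measurable (\<Pi>\<^sub>M i\<in>?J. count_space UNIV)" by measurable
  show ?thesis
    using eq[OF assms(1)] eq[OF assms(2)] integral_cube_label[OF _ assms(1,2) law meas] by simp
qed

lemma pattern_prob_label_cong:
  fixes \<zeta> \<xi> :: "'a \<Rightarrow> 'b::countable"
  assumes [measurable]: "labelling \<zeta>" "labelling \<xi>"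
    and law: "distr M (count_space UNIV) \<zeta> = distr M (count_space UNIV) \<xi>"
  shows "pattern_prob k (\<lambda>x y. z (\<zeta> x) (\<zeta> y)) b = pattern_prob k (\<lambda>x y. z (\<xi> x) (\<xi> y)) b"
proof -
  let ?\<Phi> = "\<lambda>t. \<Prod>e\<in>index_pairs k. (if b e then z (t (fst e)) (t (snd e)) else 1 - z (t (fst e)) (t (snd e)))"
  have eq: "pattern_prob k (\<lambda>x y. z (\<eta> x) (\<eta> y)) b = (\<integral>x. ?\<Phi> (compose {1..k} \<eta> x) \<partial>cube {1..k})" for \<eta>
    unfolding pattern_prob_def edge_weight_def
    by (intro Bochner_Integration.integral_cong prod.cong refl) (auto simp: compose_def index_pairs_def)
  have meas: "?\<Phi> \<in> borel_measurable (\<Pi>\<^sub>M i\<in>{1..k}. count_space UNIV)"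
  proof (intro borel_measurable_prod)
    fix e assume "e \<in> index_pairs k"
    then have [measurable]: "fst e \<in> {1..k}" "snd e \<in> {1..k}" by (auto simp: index_pairs_def)
    show "(\<lambda>t. if b e then z (t (fst e)) (t (snd e)) else 1 - z (t (fst e)) (t (snd e)))
       \<in> borel_measurable (\<Pi>\<^sub>M i\<in>{1..k}. count_space UNIV)" by measurable
  qed
  show ?thesis unfolding eq by (rule integral_cube_label[OF _ assms meas]) simp
qed

end

subsection \<open>Transfer between kernels with the same finite model\<close>

text \<open>Sierpinski's intermediate value property of atomless measures, taken as an assumption.
  It is the source of all labellings with prescribed masses.\<close>

locale divisible_kernel_space = kernel_space +
  assumes divisible: "\<And>E c. E \<in> sets M \<Longrightarrow> 0 \<le> c \<Longrightarrow> c \<le> prob E \<Longrightarrow> \<exists>E'\<in>sets M. E' \<subseteq> E \<and> prob E' = c"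
begin

text \<open>Cut off a piece of mass \<open>m v\<close> for one value and recurse on the rest; as the
  masses add up to \<open>prob E\<close>, the last value receives exactly what is left.\<close>

lemma split_set:
  fixes m :: "'b \<Rightarrow> real"
  assumes "finite S" "S \<noteq> {}" "E \<in> sets M" "\<And>v. v \<in> S \<Longrightarrow> 0 \<le> m v" "sum m S = prob E"
  shows "\<exists>\<phi>\<in>M \<rightarrow>\<^sub>M count_space UNIV. (\<forall>x. \<phi> x \<in> S) \<and> (\<forall>v\<in>S. prob {x\<in>E. \<phi> x = v} = m v)"
  using assms
proof (induction S arbitrary: E rule: finite_ne_induct)
  case (singleton v)
  then show ?case by (intro bexI[of _ "\<lambda>_. v"]) auto
next
  case (insert v S)
  have "0 \<le> sum m S" using insert.prems by (intro sum_nonneg) auto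
  moreover have tot: "prob E = m v + sum m S" using insert.prems(3) insert.hyps by simp
  ultimately have "m v \<le> prob E" by simp
  moreover have "0 \<le> m v" using insert.prems(2) by simp
  ultimately obtain E' where E' [measurable]: "E' \<in> sets M" and sub: "E' \<subseteq> E" and mE': "prob E' = m v"
    using divisible[OF insert.prems(1), of "m v"] by auto
  note [measurable] = insert.prems(1)
  have "prob (E - E') = sum m S"
    using finite_measure_Diff[OF insert.prems(1) E' sub] mE' tot by simp
  then obtain \<phi> where \<phi> [measurable]: "labelling \<phi>" and \<phi>S: "\<And>x. \<phi> x \<in> S"
    and \<phi>m: "\<And>u. u \<in> S \<Longrightarrow> prob {x\<in>E - E'. \<phi> x = u} = m u"
    using insert.IH[of "E - E'"] insert.prems(2) by auto
  let ?\<phi> = "\<lambda>x. if x \<in> E' then v else \<phi> x"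
  have v: "{x\<in>E. ?\<phi> x = v} = E'" using sub \<phi>S insert.hyps by auto
  have u: "{x\<in>E. ?\<phi> x = u} = {x\<in>E - E'. \<phi> x = u}" if "u \<in> S" for u
    using sub that insert.hyps by auto
  have "prob {x\<in>E. ?\<phi> x = u} = m u" if "u \<in> insert v S" for u
  proof (cases "u = v")
    case True
    then show ?thesis using v mE' by simp
  next
    case False
    then show ?thesis using u[of u] \<phi>m that by simp
  qed
  moreover have "labelling ?\<phi>" by measurable
  moreover have "\<forall>x. ?\<phi> x \<in> insert v S" using \<phi>S by auto
  ultimately show ?case by (intro bexI[of _ ?\<phi>]) auto
qed

text \<open>\<open>split_set\<close> is applied within each label class and the pieces are glued
  along \<open>lab\<close>, which is measurable since there are countably many labels. Classes
  outside \<open>L\<close> get a constant map.\<close>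

lemma split_labels:
  fixes lab :: "'a \<Rightarrow> 'c::countable" and m :: "'c \<Rightarrow> 'b \<Rightarrow> real"
  assumes lab [measurable]: "labelling lab" and S: "finite S" "S \<noteq> {}"
    and m: "\<And>l v. l \<in> L \<Longrightarrow> v \<in> S \<Longrightarrow> 0 \<le> m l v" "\<And>l. l \<in> L \<Longrightarrow> sum (m l) S = prob {x\<in>space M. lab x = l}"
  shows "\<exists>\<phi>\<in>M \<rightarrow>\<^sub>M count_space UNIV. (\<forall>x. \<phi> x \<in> S) \<and>
    (\<forall>l\<in>L. \<forall>v\<in>S. prob {x\<in>space M. lab x = l \<and> \<phi> x = v} = m l v)"
proof -
  have "\<exists>\<phi>\<in>M \<rightarrow>\<^sub>M count_space UNIV. (\<forall>x. \<phi> x \<in> S) \<and>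
     (l \<in> L \<longrightarrow> (\<forall>v\<in>S. prob {x\<in>{x\<in>space M. lab x = l}. \<phi> x = v} = m l v))" for l
  proof (cases "l \<in> L")
    case True
    then show ?thesis using split_set[OF S, of "{x\<in>space M. lab x = l}" "m l"] m by auto
  next
    case False
    obtain s where "s \<in> S" using S by auto
    with False show ?thesis by (intro bexI[of _ "\<lambda>_. s"]) auto
  qed
  then have "\<forall>l. \<exists>\<phi>. labelling \<phi> \<and> (\<forall>x. \<phi> x \<in> S) \<and>
     (l \<in> L \<longrightarrow> (\<forall>v\<in>S. prob {x\<in>{x\<in>space M. lab x = l}. \<phi> x = v} = m l v))" by blast
  from choice[OF this] obtain \<Phi> where \<Phi>: "\<And>l. \<Phi> l \<in> M \<rightarrow>\<^sub>M count_space UNIV" "\<And>l x. \<Phi> l x \<in> S"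
    "\<And>l v. l \<in> L \<Longrightarrow> v \<in> S \<Longrightarrow> prob {x\<in>{x\<in>space M. lab x = l}. \<Phi> l x = v} = m l v" by blast
  have "(\<lambda>x. \<Phi> (lab x) x) \<in> M \<rightarrow>\<^sub>M count_space UNIV"
    by (rule measurable_compose_countable[where g=lab]) (use \<Phi> in auto)
  moreover have "prob {x\<in>space M. lab x = l \<and> \<Phi> (lab x) x = v} = m l v" if "l \<in> L" "v \<in> S" for l v
  proof -
    have "{x\<in>space M. lab x = l \<and> \<Phi> (lab x) x = v} = {x\<in>{x\<in>space M. lab x = l}. \<Phi> l x = v}" by auto
    then show ?thesis using \<Phi>(3)[OF that] by simp
  qed
  ultimately show ?thesis using \<Phi>(2) by (intro bexI[of _ "\<lambda>x. \<Phi> (lab x) x"]) auto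
qed

lemma law_eqI:
  fixes \<zeta> \<xi> :: "'a \<Rightarrow> 'b::countable"
  assumes [measurable]: "labelling \<zeta>" "labelling \<xi>"
    and eq: "\<And>a. prob {x\<in>space M. \<zeta> x = a} = prob {x\<in>space M. \<xi> x = a}"
  shows "distr M (count_space UNIV) \<zeta> = distr M (count_space UNIV) \<xi>"
proof (rule measure_eqI_countable[where A=UNIV])
  fix a :: 'b
  have "{x\<in>space M. \<eta> x = a} = \<eta> -` {a} \<inter> space M" for \<eta> :: "'a \<Rightarrow> 'b" by auto
  then show "emeasure (distr M (count_space UNIV) \<zeta>) {a} = emeasure (distr M (count_space UNIV) \<xi>) {a}"
    using eq[of a] by (simp add: emeasure_distr emeasure_eq_measure)
qed auto

text \<open>The conditional distribution of \<open>\<alpha>\<close> on each class of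
  \<open>\<psi>\<close> is copied to the class of \<open>\<phi>\<close> with the same name and mass.
  Equality of the joint laws is the goal because \<open>h\<close> and the step functions will be
  multiplied together.\<close>

lemma transport_labels:
  fixes \<phi> \<psi> \<alpha> :: "'a \<Rightarrow> nat"
  assumes [measurable]: "labelling \<phi>" "labelling \<psi>" "labelling \<alpha>"
    and S: "\<And>x. \<phi> x \<in> S" "\<And>x. \<psi> x \<in> S" "finite S" and K: "\<And>x. \<alpha> x < K"
    and eq: "\<And>v. v \<in> S \<Longrightarrow> prob {x\<in>space M. \<phi> x = v} = prob {x\<in>space M. \<psi> x = v}"
  obtains \<beta> where "labelling \<beta>" "\<And>x. \<beta> x < K"
    "distr M (count_space UNIV) (\<lambda>x. (\<phi> x, \<beta> x)) = distr M (count_space UNIV) (\<lambda>x. (\<psi> x, \<alpha> x))"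
proof -
  define m where "m v a = prob {x\<in>space M. \<psi> x = v \<and> \<alpha> x = a}" for v a
  have "sum (m v) {..<K} = prob {x\<in>space M. \<phi> x = v}" if "v \<in> S" for v
  proof -
    have "prob (\<Union>a<K. {x\<in>space M. \<psi> x = v \<and> \<alpha> x = a}) = sum (m v) {..<K}"
      unfolding m_def by (intro finite_measure_finite_Union) (auto simp: disjoint_family_on_def)
    moreover have "(\<Union>a<K. {x\<in>space M. \<psi> x = v \<and> \<alpha> x = a}) = {x\<in>space M. \<psi> x = v}" using K by auto
    ultimately show ?thesis using eq[OF that] by simp
  qed
  moreover have "{..<K} \<noteq> {}" using K[of undefined] by auto
  ultimately have "\<exists>\<beta>\<in>M \<rightarrow>\<^sub>M count_space UNIV. (\<forall>x. \<beta> x \<in> {..<K}) \<and>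
      (\<forall>v\<in>S. \<forall>a\<in>{..<K}. prob {x\<in>space M. \<phi> x = v \<and> \<beta> x = a} = m v a)"
    by (intro split_labels) (auto simp: m_def)
  then obtain \<beta> where \<beta> [measurable]: "labelling \<beta>" and \<beta>K: "\<And>x. \<beta> x < K"
    and \<beta>m: "\<And>v a. v \<in> S \<Longrightarrow> a < K \<Longrightarrow> prob {x\<in>space M. \<phi> x = v \<and> \<beta> x = a} = m v a" by auto
  have "prob {x\<in>space M. (\<phi> x, \<beta> x) = va} = prob {x\<in>space M. (\<psi> x, \<alpha> x) = va}" for va
  proof (cases "fst va \<in> S \<and> snd va < K")
    case True
    then show ?thesis using \<beta>m[of "fst va" "snd va"] by (simp add: m_def prod_eq_iff)
  next
    case False
    then have "(\<phi> x, \<beta> x) \<noteq> va" "(\<psi> x, \<alpha> x) \<noteq> va" for x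
      using S(1,2)[of x] \<beta>K[of x] K[of x] by auto
    then show ?thesis by simp
  qed
  then have "distr M (count_space UNIV) (\<lambda>x. (\<phi> x, \<beta> x)) = distr M (count_space UNIV) (\<lambda>x. (\<psi> x, \<alpha> x))"
    by (intro law_eqI) measurable
  with \<beta> \<beta>K show thesis by (rule that)
qed

end

context kernel_space
begin

text \<open>A step function is a combination of \<open>K * K\<close> products of class indicators,
  which can be absorbed into the two test functions; each product costs \<open>c\<close>.\<close>

lemma cut_bound_step_mult:
  assumes A: "bdd_fun A" "cut_bound A c" and \<alpha> [measurable]: "labelling \<alpha>"
    and K: "\<And>x. \<alpha> x < K" and r: "\<And>i j. \<bar>r i j\<bar> \<le> 1"
  shows "cut_bound (\<lambda>x y. A x y * r (\<alpha> x) (\<alpha> y)) (real K * real K * c)"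
  unfolding cut_bound_def
proof safe
  fix f g :: "'a \<Rightarrow> real"
  assume fg [measurable]: "f \<in> borel_measurable M" "g \<in> borel_measurable M"
    and f1: "\<forall>x. \<bar>f x\<bar> \<le> 1" and g1: "\<forall>x. \<bar>g x\<bar> \<le> 1"
  define F where "F a x = (if \<alpha> x = a then f x else 0)" for a x
  define G where "G a x = (if \<alpha> x = a then g x else 0)" for a x
  have FG [measurable]: "F a \<in> borel_measurable M" "G a \<in> borel_measurable M" for a
    unfolding F_def G_def by measurable
  have FG1: "\<bar>F a x\<bar> \<le> 1" "\<bar>G a x\<bar> \<le> 1" for a x unfolding F_def G_def using f1 g1 by auto
  have "avg (\<lambda>x y. A x y * r (\<alpha> x) (\<alpha> y) * f x * g y) =
    avg (\<lambda>x y. \<Sum>ab\<in>{..<K} \<times> {..<K}. r (fst ab) (snd ab) * (A x y * F (fst ab) x * G (snd ab) y))"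
  proof (rule arg_cong[of _ _ avg], intro ext)
    fix x y
    have "(\<Sum>ab\<in>{..<K} \<times> {..<K}. r (fst ab) (snd ab) * (A x y * F (fst ab) x * G (snd ab) y)) =
      (\<Sum>ab\<in>{..<K} \<times> {..<K}. if ab = (\<alpha> x, \<alpha> y) then A x y * r (\<alpha> x) (\<alpha> y) * f x * g y else 0)"
      by (intro sum.cong) (auto simp: F_def G_def)
    also have "\<dots> = A x y * r (\<alpha> x) (\<alpha> y) * f x * g y"
      using K by (subst sum.delta) auto
    finally show "A x y * r (\<alpha> x) (\<alpha> y) * f x * g y =
      (\<Sum>ab\<in>{..<K} \<times> {..<K}. r (fst ab) (snd ab) * (A x y * F (fst ab) x * G (snd ab) y))" by simp
  qed
  also have "\<dots> = (\<Sum>ab\<in>{..<K} \<times> {..<K}. r (fst ab) (snd ab) * avg (\<lambda>x y. A x y * F (fst ab) x * G (snd ab) y))"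
    by (subst avg_sum) (auto simp: avg_cmult intro!: bdd_fun_mult[OF bdd_fun_const] bdd_fun_test A FG1)
  also have "\<bar>\<dots>\<bar> \<le> (\<Sum>ab\<in>{..<K} \<times> {..<K}. c)"
  proof (rule sum_abs[THEN order_trans], rule sum_mono)
    fix ab
    have "\<bar>r (fst ab) (snd ab)\<bar> * \<bar>avg (\<lambda>x y. A x y * F (fst ab) x * G (snd ab) y)\<bar> \<le> 1 * c"
      by (intro mult_mono r cut_boundD[OF A(2)] FG FG1) auto
    then show "\<bar>r (fst ab) (snd ab) * avg (\<lambda>x y. A x y * F (fst ab) x * G (snd ab) y)\<bar> \<le> c"
      by (simp add: abs_mult)
  qed
  finally show "\<bar>avg (\<lambda>x y. A x y * r (\<alpha> x) (\<alpha> y) * f x * g y)\<bar> \<le> real K * real K * c" by simp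
qed

end

text \<open>At most one of the two rates is positive, so no mass moves in opposite directions and
  the cost equals the change of density.\<close>

lemma recolour_identities:
  fixes w w' :: real
  assumes "0 \<le> w" "w \<le> 1" "0 \<le> w'" "w' \<le> 1"
  defines "p \<equiv> if w' \<le> w then 1 - w' / w else 0" and "q \<equiv> if w' \<le> w then 0 else (w' - w) / (1 - w)"
  shows "0 \<le> p" "p \<le> 1" "0 \<le> q" "q \<le> 1" "p = 0 \<or> q = 0"
    "q + w * (1 - p - q) = w'" "q + w * (p - q) = \<bar>w - w'\<bar>"
proof -
  consider "w = 0" "w' = 0" | "0 < w" "w' \<le> w" | "w < w'" "0 < 1 - w" using assms by linarith
  then have "0 \<le> p \<and> p \<le> 1 \<and> 0 \<le> q \<and> q \<le> 1 \<and> (p = 0 \<or> q = 0) \<and> q + w * (1 - p - q) = w' \<and> q + w * (p - q) = \<bar>w - w'\<bar>"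
  proof cases
    \<comment> \<open>Division by zero gives \<open>p = 1\<close> here, which is harmless: at
      density 0 there are no edges to delete.\<close>
    case 1
    then show ?thesis by (simp add: p_def q_def)
  next
    case 2
    then show ?thesis using assms by (simp add: p_def q_def algebra_simps)
  next
    case 3
    then have pq: "p = 0" "(1 - w) * q = w' - w" by (auto simp: p_def q_def)
    moreover have "0 \<le> q" "q \<le> 1" using 3 assms(4) by (auto simp: q_def divide_le_eq_1)
    ultimately show ?thesis using 3 by (auto simp: algebra_simps)
  qed
  then show "0 \<le> p" "p \<le> 1" "0 \<le> q" "q \<le> 1" "p = 0 \<or> q = 0"
    "q + w * (1 - p - q) = w'" "q + w * (p - q) = \<bar>w - w'\<bar>" by auto
qed

context divisible_kernel_space
begin

text \<open>The new kernel recolours an edge of \<open>V\<close> to a non-edge with probability \<open>p\<close> and a non-edge to an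
  edge with probability \<open>q\<close>, where \<open>p\<close> and \<open>q\<close> depend only on the transported labels and turn the
  density \<open>w\<close> into \<open>w'\<close> at minimal cost.\<close>

theorem transfer:
  fixes \<phi> \<psi> \<alpha> :: "'a \<Rightarrow> nat"
  assumes V: "kernel V" and W: "kernel W" and W': "kernel W'" and reg: "regular_pair \<eta> K W W' \<alpha> w w'"
    and meas [measurable]: "labelling \<phi>" "labelling \<psi>"
    and S: "\<And>x. \<phi> x \<in> S" "\<And>x. \<psi> x \<in> S" "finite S"
    and eq: "\<And>v. v \<in> S \<Longrightarrow> prob {x\<in>space M. \<phi> x = v} = prob {x\<in>space M. \<psi> x = v}"
    and h: "\<And>u v. h u v = h v u" "\<And>u v. 0 \<le> h u v" "\<And>u v. h u v \<le> (1::real)"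
    and cV: "cut_bound (\<lambda>x y. V x y - h (\<phi> x) (\<phi> y)) c"
    and cW: "cut_bound (\<lambda>x y. W x y - h (\<psi> x) (\<psi> y)) c"
  obtains V' where "kernel V'"
    "avg (\<lambda>x y. \<bar>V x y - V' x y\<bar>) \<le> avg (\<lambda>x y. \<bar>W x y - W' x y\<bar>) + 3 * \<eta> + 2 * (real K * real K * c)"
    "\<And>k b. \<bar>pattern_prob k V' b - pattern_prob k W' b\<bar> \<le> real (card (index_pairs k)) * (2 * \<eta> + 2 * (real K * real K * c))"
proof -
  have \<alpha> [measurable]: "labelling \<alpha>" and K: "\<And>x. \<alpha> x < K"
    and w: "\<And>i j. w i j = w j i" "\<And>i j. 0 \<le> w i j" "\<And>i j. w i j \<le> 1"
    and w': "\<And>i j. w' i j = w' j i" "\<And>i j. 0 \<le> w' i j" "\<And>i j. w' i j \<le> 1"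
    and reg1: "\<And>r. (\<And>i j. \<bar>r i j\<bar> \<le> 1) \<Longrightarrow> cut_bound (\<lambda>x y. (W x y - w (\<alpha> x) (\<alpha> y)) * r (\<alpha> x) (\<alpha> y)) \<eta>"
    and reg2: "\<And>r. (\<And>i j. \<bar>r i j\<bar> \<le> 1) \<Longrightarrow> cut_bound (\<lambda>x y. (W' x y - w' (\<alpha> x) (\<alpha> y)) * r (\<alpha> x) (\<alpha> y)) \<eta>"
    using reg unfolding regular_pair_def by simp_all
  obtain \<beta> where \<beta> [measurable]: "labelling \<beta>" and \<beta>K: "\<And>x. \<beta> x < K"
    and law: "distr M (count_space UNIV) (\<lambda>x. (\<phi> x, \<beta> x)) = distr M (count_space UNIV) (\<lambda>x. (\<psi> x, \<alpha> x))"
    using transport_labels[OF meas \<alpha> S K eq] by blast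
  define p where "p i j = (if w' i j \<le> w i j then 1 - w' i j / w i j else 0)" for i j
  define q where "q i j = (if w' i j \<le> w i j then 0 else (w' i j - w i j) / (1 - w i j))" for i j
  have pq: "0 \<le> p i j" "p i j \<le> 1" "0 \<le> q i j" "q i j \<le> 1" "p i j = 0 \<or> q i j = 0"
    "q i j + w i j * (1 - p i j - q i j) = w' i j" "q i j + w i j * (p i j - q i j) = \<bar>w i j - w' i j\<bar>" for i j
    unfolding p_def q_def using recolour_identities[OF w(2,3) w'(2,3), of i j i j] by auto
  have pq_sym: "p i j = p j i" "q i j = q j i" for i j
    unfolding p_def q_def by (simp_all only: w(1)[of i j] w'(1)[of i j])
  \<comment> \<open>At density \<open>t\<close> recolouring costs \<open>q + t * r\<close> and
    leaves density \<open>q + t * \<rho>\<close>. Both are affine in \<open>t\<close>, so cut norm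
    approximations pass through them.\<close>
  define r where "r i j = p i j - q i j" for i j
  define \<rho> where "\<rho> i j = 1 - p i j - q i j" for i j
  have r1: "\<bar>r i j\<bar> \<le> 1" and \<rho>1: "\<bar>\<rho> i j\<bar> \<le> 1" for i j
    using pq(1-5)[of i j] by (auto simp: r_def \<rho>_def)
  have mix: "0 \<le> q i j + t * \<rho> i j" "q i j + t * \<rho> i j \<le> 1" if "0 \<le> t" "t \<le> 1" for i j t
  proof -
    have "q i j + t * \<rho> i j = t * (1 - p i j) + (1 - t) * q i j" by (simp add: \<rho>_def algebra_simps)
    moreover have "t * (1 - p i j) + (1 - t) * q i j \<le> t * 1 + (1 - t) * 1"
      using that pq[of i j] by (intro add_mono mult_left_mono) auto
    ultimately show "0 \<le> q i j + t * \<rho> i j" "q i j + t * \<rho> i j \<le> 1" using that pq[of i j] by auto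
  qed
  have w1: "\<bar>w i j\<bar> \<le> 1" "\<bar>w' i j\<bar> \<le> 1" "\<bar>h i j\<bar> \<le> 1" "\<bar>q i j\<bar> \<le> 1" for i j
    using w(2,3)[of i j] w'(2,3)[of i j] h(2,3)[of i j] pq(3,4)[of i j] by auto
  note kb = bdd_fun_kernel[OF V] bdd_fun_kernel[OF W] bdd_fun_kernel[OF W']
  have lb: "bdd_fun (\<lambda>x y. T (\<alpha> x) (\<alpha> y))" "bdd_fun (\<lambda>x y. T (\<beta> x) (\<beta> y))"
    "bdd_fun (\<lambda>x y. T (\<phi> x) (\<phi> y))" "bdd_fun (\<lambda>x y. T (\<psi> x) (\<psi> y))" if "\<And>i j. \<bar>T i j\<bar> \<le> 1" for T
    by (rule bdd_fun_label[where B=1]; fact)+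
  note b = bdd_fun_add bdd_fun_mult bdd_fun_diff kb lb[OF w1(1)] lb[OF w1(2)] lb[OF w1(3)] lb[OF w1(4)] lb[OF r1] lb[OF \<rho>1]
  let ?C = "real K * real K * c"

  define V' where "V' x y = q (\<beta> x) (\<beta> y) + V x y * \<rho> (\<beta> x) (\<beta> y)" for x y
  \<comment> \<open>The recoloured step function \<open>h\<close>, as a function of joint labels.
    Since \<open>(\<phi>, \<beta>)\<close> and \<open>(\<psi>, \<alpha>)\<close> have the same law,
    its two realisations have the same pattern probabilities.\<close>
  define Z where "Z = (\<lambda>s t. q (snd s) (snd t) + h (fst s) (fst t) * \<rho> (snd s) (snd t))"
  define Z\<beta> where "Z\<beta> x y = Z (\<phi> x, \<beta> x) (\<phi> y, \<beta> y)" for x y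
  define Z\<alpha> where "Z\<alpha> x y = Z (\<psi> x, \<alpha> x) (\<psi> y, \<alpha> y)" for x y
  have kernelI: "kernel (\<lambda>x y. q (\<gamma> x) (\<gamma> y) + F x y * \<rho> (\<gamma> x) (\<gamma> y))"
    if "bdd_fun F" "\<And>x y. F x y = F y x" "\<And>x y. 0 \<le> F x y" "\<And>x y. F x y \<le> 1"
      and [measurable]: "labelling \<gamma>" for F and \<gamma> :: "'a \<Rightarrow> nat"
    unfolding kernel_def
  proof (intro conjI allI)
    show "(\<lambda>(x, y). q (\<gamma> x) (\<gamma> y) + F x y * \<rho> (\<gamma> x) (\<gamma> y)) \<in> borel_measurable (M \<Otimes>\<^sub>M M)"
      by (intro bdd_fun_measurable bdd_fun_add bdd_fun_mult that bdd_fun_label[where B=1] w1 \<rho>1)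
    show "q (\<gamma> x) (\<gamma> y) + F x y * \<rho> (\<gamma> x) (\<gamma> y) = q (\<gamma> y) (\<gamma> x) + F y x * \<rho> (\<gamma> y) (\<gamma> x)" for x y
      unfolding \<rho>_def using that(2)[of x y] pq_sym[of "\<gamma> x" "\<gamma> y"] by simp
  qed (use mix that in auto)
  have V': "kernel V'"
    unfolding V'_def using V by (intro kernelI) (auto simp: kernel_def bdd_fun_kernel[OF V])
  have Zk: "kernel Z\<beta>" "kernel Z\<alpha>"
    unfolding Z\<beta>_def Z\<alpha>_def Z_def fst_conv snd_conv using h by (intro kernelI lb w1; simp)+

  have V_h: "cut_bound (\<lambda>x y. (V x y - h (\<phi> x) (\<phi> y)) * s (\<beta> x) (\<beta> y)) ?C"
    and W_h: "cut_bound (\<lambda>x y. (W x y - h (\<psi> x) (\<psi> y)) * s (\<alpha> x) (\<alpha> y)) ?C" if "\<And>i j. \<bar>s i j\<bar> \<le> 1" for s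
    by (rule cut_bound_step_mult; (rule cV cW \<beta> \<beta>K \<alpha> K that | intro b))+

  \<comment> \<open>The cost is moved from \<open>V\<close> to \<open>h\<close> (error
    \<open>?C\<close>), across the two labellings by equality of laws, from \<open>h\<close> to
    \<open>W\<close> (\<open>?C\<close>) and from \<open>W\<close> to \<open>w\<close>
    (\<open>\<eta>\<close>). Comparing \<open>w\<close> and \<open>w'\<close> with \<open>W\<close>
    and \<open>W'\<close> adds \<open>2 * \<eta>\<close>.\<close>
  have "avg (\<lambda>x y. \<bar>V x y - V' x y\<bar>) \<le> avg (\<lambda>x y. q (\<beta> x) (\<beta> y) + V x y * r (\<beta> x) (\<beta> y))"
  proof (rule avg_mono)
    fix x y
    have "V x y - V' x y = V x y * p (\<beta> x) (\<beta> y) - (1 - V x y) * q (\<beta> x) (\<beta> y)"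
      unfolding V'_def \<rho>_def by (simp add: algebra_simps)
    moreover have "0 \<le> V x y * p (\<beta> x) (\<beta> y)" "0 \<le> (1 - V x y) * q (\<beta> x) (\<beta> y)"
      using pq[of "\<beta> x" "\<beta> y"] kernel_bounds[OF V, of x y] by auto
    moreover have "V x y * p (\<beta> x) (\<beta> y) + (1 - V x y) * q (\<beta> x) (\<beta> y) = q (\<beta> x) (\<beta> y) + V x y * r (\<beta> x) (\<beta> y)"
      by (simp add: r_def algebra_simps)
    ultimately show "\<bar>V x y - V' x y\<bar> \<le> q (\<beta> x) (\<beta> y) + V x y * r (\<beta> x) (\<beta> y)" by linarith
  qed (intro b bdd_fun_abs bdd_fun_kernel[OF V'])+
  also have "\<dots> = avg (\<lambda>x y. q (\<beta> x) (\<beta> y)) + avg (\<lambda>x y. V x y * r (\<beta> x) (\<beta> y))"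
    by (intro avg_add b)
  also have "avg (\<lambda>x y. V x y * r (\<beta> x) (\<beta> y)) \<le> avg (\<lambda>x y. h (\<phi> x) (\<phi> y) * r (\<beta> x) (\<beta> y)) + ?C"
    using cut_bound_avg[OF V_h[of r, OF r1]]
    by (subst (asm) left_diff_distrib, subst (asm) avg_diff) (auto intro!: b)
  also have "avg (\<lambda>x y. h (\<phi> x) (\<phi> y) * r (\<beta> x) (\<beta> y)) = avg (\<lambda>x y. h (\<psi> x) (\<psi> y) * r (\<alpha> x) (\<alpha> y))"
  proof -
    have "\<bar>h (fst s) (fst t) * r (snd s) (snd t)\<bar> \<le> 1" for s t
      unfolding abs_mult using w1 r1 by (intro mult_le_one) auto
    from avg_label_cong[OF _ _ law, of "\<lambda>s t. h (fst s) (fst t) * r (snd s) (snd t)", OF _ _ this] show ?thesis by simp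
  qed
  also have "avg (\<lambda>x y. q (\<beta> x) (\<beta> y)) = avg (\<lambda>x y. q (\<alpha> x) (\<alpha> y))"
    using avg_label_cong[OF _ _ law, of "\<lambda>s t. q (snd s) (snd t)" 1] w1(4) by simp
  also have "avg (\<lambda>x y. h (\<psi> x) (\<psi> y) * r (\<alpha> x) (\<alpha> y)) \<le> avg (\<lambda>x y. W x y * r (\<alpha> x) (\<alpha> y)) + ?C"
    using cut_bound_avg[OF W_h[of r, OF r1]]
    by (subst (asm) left_diff_distrib, subst (asm) avg_diff) (auto intro!: b)
  also have "avg (\<lambda>x y. W x y * r (\<alpha> x) (\<alpha> y)) \<le> avg (\<lambda>x y. w (\<alpha> x) (\<alpha> y) * r (\<alpha> x) (\<alpha> y)) + \<eta>"
    using cut_bound_avg[OF reg1[of r, OF r1]]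
    by (subst (asm) left_diff_distrib, subst (asm) avg_diff) (auto intro!: b)
  finally have "avg (\<lambda>x y. \<bar>V x y - V' x y\<bar>) \<le>
      avg (\<lambda>x y. q (\<alpha> x) (\<alpha> y)) + avg (\<lambda>x y. w (\<alpha> x) (\<alpha> y) * r (\<alpha> x) (\<alpha> y)) + \<eta> + 2 * ?C" by (simp only: mult_2 add_ac)
  also have "avg (\<lambda>x y. q (\<alpha> x) (\<alpha> y)) + avg (\<lambda>x y. w (\<alpha> x) (\<alpha> y) * r (\<alpha> x) (\<alpha> y)) =
      avg (\<lambda>x y. \<bar>w (\<alpha> x) (\<alpha> y) - w' (\<alpha> x) (\<alpha> y)\<bar>)"
  proof -
    have "avg (\<lambda>x y. q (\<alpha> x) (\<alpha> y)) + avg (\<lambda>x y. w (\<alpha> x) (\<alpha> y) * r (\<alpha> x) (\<alpha> y)) =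
        avg (\<lambda>x y. q (\<alpha> x) (\<alpha> y) + w (\<alpha> x) (\<alpha> y) * r (\<alpha> x) (\<alpha> y))"
      by (intro avg_add[symmetric] b)
    then show ?thesis by (simp add: r_def pq(7))
  qed
  also have "\<dots> \<le> avg (\<lambda>x y. \<bar>W x y - W' x y\<bar>) + 2 * \<eta>"
  proof -
    \<comment> \<open>Multiplication by the sign of \<open>w - w'\<close>, itself a step function,
      removes the absolute value, so that regularity can be applied to a linear expression.\<close>
    define s where "s i j = (if w' i j \<le> w i j then 1 else -1 :: real)" for i j
    have s1: "\<bar>s i j\<bar> \<le> 1" for i j by (auto simp: s_def)
    note b' = b lb[OF s1]
    have "avg (\<lambda>x y. \<bar>w (\<alpha> x) (\<alpha> y) - w' (\<alpha> x) (\<alpha> y)\<bar>) = avg (\<lambda>x y. (W x y - W' x y) * s (\<alpha> x) (\<alpha> y)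
        - (W x y - w (\<alpha> x) (\<alpha> y)) * s (\<alpha> x) (\<alpha> y) + (W' x y - w' (\<alpha> x) (\<alpha> y)) * s (\<alpha> x) (\<alpha> y))"
      by (intro arg_cong[of _ _ avg] ext) (auto simp: s_def)
    also have "\<dots> = avg (\<lambda>x y. (W x y - W' x y) * s (\<alpha> x) (\<alpha> y))
        - avg (\<lambda>x y. (W x y - w (\<alpha> x) (\<alpha> y)) * s (\<alpha> x) (\<alpha> y))
        + avg (\<lambda>x y. (W' x y - w' (\<alpha> x) (\<alpha> y)) * s (\<alpha> x) (\<alpha> y))"
      by (subst avg_add avg_diff; (intro b')?)+ simp
    also have "avg (\<lambda>x y. (W x y - W' x y) * s (\<alpha> x) (\<alpha> y)) \<le> avg (\<lambda>x y. \<bar>W x y - W' x y\<bar>)"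
      by (intro avg_mono b' bdd_fun_abs) (auto simp: s_def)
    finally show ?thesis using cut_bound_avg[OF reg1[of s, OF s1]] cut_bound_avg[OF reg2[of s, OF s1]] by linarith
  qed
  finally have dist: "avg (\<lambda>x y. \<bar>V x y - V' x y\<bar>) \<le> avg (\<lambda>x y. \<bar>W x y - W' x y\<bar>) + 3 * \<eta> + 2 * ?C" by (simp add: algebra_simps)

  \<comment> \<open>\<open>W'\<close> is close to \<open>w'\<close> (\<open>\<eta>\<close>), which
    is the recoloured \<open>w\<close> and so close to the recoloured \<open>W\<close>
    (\<open>\<eta>\<close>), which is close to \<open>Z\<alpha>\<close> (\<open>?C\<close>). On the
    other side \<open>V'\<close> is close to \<open>Z\<beta>\<close> (\<open>?C\<close>).\<close>
  have "cut_bound (\<lambda>x y. W' x y - w' (\<alpha> x) (\<alpha> y)) \<eta>"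
    using reg2[of "\<lambda>_ _. 1"] by simp
  moreover have "cut_bound (\<lambda>x y. w' (\<alpha> x) (\<alpha> y) - (q (\<alpha> x) (\<alpha> y) + W x y * \<rho> (\<alpha> x) (\<alpha> y))) \<eta>"
  proof -
    have "w' i j - (q i j + t * \<rho> i j) = - 1 * ((t - w i j) * \<rho> i j)" for i j t
      by (subst pq(6)[symmetric]) (simp add: \<rho>_def algebra_simps)
    then show ?thesis using cut_bound_cmult[OF reg1[of \<rho>, OF \<rho>1], of "-1"] by simp
  qed
  moreover have "cut_bound (\<lambda>x y. (q (\<alpha> x) (\<alpha> y) + W x y * \<rho> (\<alpha> x) (\<alpha> y)) - Z\<alpha> x y) ?C"
    using W_h[of \<rho>, OF \<rho>1] by (simp add: Z\<alpha>_def Z_def left_diff_distrib)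
  ultimately have "cut_bound (\<lambda>x y. W' x y - Z\<alpha> x y) (\<eta> + (\<eta> + ?C))"
    by (intro cut_bound_trans[where B="\<lambda>x y. w' (\<alpha> x) (\<alpha> y)"]
        cut_bound_trans[where B="\<lambda>x y. q (\<alpha> x) (\<alpha> y) + W x y * \<rho> (\<alpha> x) (\<alpha> y)"] b bdd_fun_kernel[OF Zk(2)])
  note 1 = pattern_prob_diff[OF W' Zk(2) this]
  have "cut_bound (\<lambda>x y. V' x y - Z\<beta> x y) ?C"
    using V_h[of \<rho>, OF \<rho>1] by (simp add: V'_def Z\<beta>_def Z_def left_diff_distrib)
  note 2 = pattern_prob_diff[OF V' Zk(1) this]
  have 3: "pattern_prob k Z\<beta> b = pattern_prob k Z\<alpha> b" for k b
    unfolding Z\<beta>_def Z\<alpha>_def by (rule pattern_prob_label_cong[OF _ _ law]) measurable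
  have "\<bar>pattern_prob k V' b - pattern_prob k W' b\<bar> \<le> real (card (index_pairs k)) * (2 * \<eta> + 2 * ?C)" for k b
  proof -
    have "\<bar>pattern_prob k V' b - pattern_prob k W' b\<bar> \<le> real (card (index_pairs k)) * ?C + real (card (index_pairs k)) * (\<eta> + (\<eta> + ?C))"
      using 1[of k b] 2[of k b] 3[of k b] by linarith
    then show ?thesis by (simp add: algebra_simps)
  qed
  with V' dist show thesis by (rule that)
qed

end

subsection \<open>Graphons and random graphs on the unit interval\<close>

abbreviation unif :: "real measure" where
  "unif \<equiv> restrict_space lborel {0..1}"

lemma emeasure_unif: "A \<in> sets unif \<Longrightarrow> emeasure unif A = emeasure lborel A"
  by (subst emeasure_restrict_space) (auto simp: sets_restrict_space)

lemma prob_space_unif: "prob_space unif"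
  by (rule prob_spaceI) (simp add: emeasure_restrict_space space_restrict_space)

text \<open>The measure of the part of \<open>E\<close> up to \<open>t\<close> is 1-Lipschitz in
  \<open>t\<close> and runs from 0 at -1 to the measure of \<open>E\<close> at 1; the intermediate
  value theorem gives the cut.\<close>

lemma unif_divisible:
  assumes E: "E \<in> sets unif" and c: "0 \<le> c" "c \<le> measure unif E"
  shows "\<exists>E'\<in>sets unif. E' \<subseteq> E \<and> measure unif E' = c"
proof -
  interpret prob_space unif by (rule prob_space_unif)
  have E01: "E \<subseteq> {0..1}" using sets.sets_into_space[OF E] by (simp add: space_restrict_space)
  have Eb [measurable]: "E \<in> sets borel" using E by (auto simp: sets_restrict_space)
  have cut [measurable]: "E \<inter> {..t} \<in> sets unif" for t
    using E01 Eb by (auto simp: sets_restrict_space_iff)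
  define F where "F t = measure unif (E \<inter> {..t})" for t
  have F_le: "F t \<le> F s + (t - s)" and F_mono: "F s \<le> F t" if "s \<le> t" for s t
  proof -
    show "F s \<le> F t" unfolding F_def using that by (intro finite_measure_mono) auto
    have s01: "{s<..t} \<inter> {0..1} \<in> sets unif" by (simp add: sets_restrict_space_iff)
    have "F t \<le> measure unif ((E \<inter> {..s}) \<union> ({s<..t} \<inter> {0..1}))"
      unfolding F_def using E01 s01 by (intro finite_measure_mono) auto
    also have "\<dots> \<le> F s + measure unif ({s<..t} \<inter> {0..1})"
      unfolding F_def using s01 by (intro measure_Un_le) auto
    also have "measure unif ({s<..t} \<inter> {0..1}) \<le> t - s"
    proof -
      have "emeasure unif ({s<..t} \<inter> {0..1}) \<le> emeasure lborel {s<..t}"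
        unfolding emeasure_unif[OF s01] by (intro emeasure_mono) auto
      then show ?thesis using that by (simp add: emeasure_eq_measure)
    qed
    finally show "F t \<le> F s + (t - s)" by simp
  qed
  have "dist (F s) (F t) \<le> 1 * dist s t" for s t
    using F_le[of s t] F_mono[of s t] F_le[of t s] F_mono[of t s] by (cases "s \<le> t") (auto simp: dist_real_def)
  then have "1-lipschitz_on UNIV F" by (intro lipschitz_onI) auto
  then have "continuous_on {-1..1} F" by (rule continuous_on_subset[OF lipschitz_on_continuous_on]) auto
  moreover have "E \<inter> {..-1} = {}" "E \<inter> {..1} = E" using E01 by auto
  then have "F (-1) = 0" "F 1 = measure unif E" by (simp_all add: F_def)
  ultimately obtain t where "F t = c" using IVT'[of F "-1" c 1] c by auto
  then show ?thesis by (intro bexI[of _ "E \<inter> {..t}"]) (auto simp: F_def)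
qed

interpretation U: divisible_kernel_space unif
  unfolding divisible_kernel_space_def divisible_kernel_space_axioms_def kernel_space_def
  using prob_space_unif unif_divisible by blast

abbreviation unit_square :: "(real \<times> real) set" where
  "unit_square \<equiv> {0..1} \<times> {0..1}"

lemma unit_square_borel: "unit_square \<in> sets borel"
  by (intro borel_Times) auto

lemma fst_snd_unif:
  "fst \<in> unif \<Otimes>\<^sub>M unif \<rightarrow>\<^sub>M (borel :: real measure)"
  "snd \<in> unif \<Otimes>\<^sub>M unif \<rightarrow>\<^sub>M (borel :: real measure)"
proof -
  have id: "(\<lambda>x. x) \<in> unif \<rightarrow>\<^sub>M borel" by (intro measurable_restrict_space1) simp
  show "fst \<in> unif \<Otimes>\<^sub>M unif \<rightarrow>\<^sub>M (borel :: real measure)"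
    "snd \<in> unif \<Otimes>\<^sub>M unif \<rightarrow>\<^sub>M (borel :: real measure)"
    using measurable_compose[OF measurable_fst id] measurable_compose[OF measurable_snd id] by (auto simp: eta_contract_eq)
qed

text \<open>This links Lebesgue measure on the square, in terms of which graphons are defined, to
  the product measure used for kernels. The sigma-algebras are compared through measurability of the
  identity in both directions.\<close>

lemma pair_unif: "unif \<Otimes>\<^sub>M unif = restrict_space lborel unit_square"
proof (rule pair_measure_eqI)
  show "sigma_finite_measure unif" by unfold_locales
  show "sigma_finite_measure unif" by unfold_locales
  have 1: "(\<lambda>p. p) \<in> unif \<Otimes>\<^sub>M unif \<rightarrow>\<^sub>M restrict_space lborel unit_square"
  proof (rule measurable_restrict_space2)
    note [measurable] = fst_snd_unif
    have "(\<lambda>p. (fst p, snd p)) \<in> unif \<Otimes>\<^sub>M unif \<rightarrow>\<^sub>M (borel :: (real \<times> real) measure)"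
      by measurable
    then show "(\<lambda>p. p) \<in> unif \<Otimes>\<^sub>M unif \<rightarrow>\<^sub>M lborel" by simp
  qed (auto simp: space_pair_measure space_restrict_space)
  have 2: "(\<lambda>p. p) \<in> restrict_space lborel unit_square \<rightarrow>\<^sub>M unif \<Otimes>\<^sub>M unif"
  proof -
    have "fst \<in> restrict_space lborel unit_square \<rightarrow>\<^sub>M unif" "snd \<in> restrict_space lborel unit_square \<rightarrow>\<^sub>M unif"
      by (intro measurable_restrict_space2 measurable_restrict_space1;
          force simp: space_restrict_space intro!: borel_measurable_continuous_onI continuous_intros)+
    then have "(\<lambda>p. (fst p, snd p)) \<in> restrict_space lborel unit_square \<rightarrow>\<^sub>M unif \<Otimes>\<^sub>M unif"
      by (intro measurable_Pair) auto
    then show ?thesis by simp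
  qed
  have sp: "space (unif \<Otimes>\<^sub>M unif) = unit_square" "space (restrict_space lborel unit_square) = unit_square"
    by (auto simp: space_pair_measure space_restrict_space)
  show "sets (unif \<Otimes>\<^sub>M unif) = sets (restrict_space lborel unit_square)"
  proof (intro equalityI subsetI)
    fix A assume A: "A \<in> sets (unif \<Otimes>\<^sub>M unif)"
    then have "A \<subseteq> unit_square" using sets.sets_into_space sp(1) by blast
    then show "A \<in> sets (restrict_space lborel unit_square)" using measurable_sets[OF 2 A] sp(2) by (simp add: Int_absorb2)
  next
    fix A assume A: "A \<in> sets (restrict_space lborel unit_square)"
    then have "A \<subseteq> unit_square" using sets.sets_into_space sp(2) by blast
    then show "A \<in> sets (unif \<Otimes>\<^sub>M unif)" using measurable_sets[OF 1 A] sp(1) by (simp add: Int_absorb2)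
  qed
  fix A B assume AB: "A \<in> sets unif" "B \<in> sets unif"
  then have AB': "A \<in> sets borel" "B \<in> sets borel" "A \<times> B \<subseteq> unit_square"
    by (auto simp: sets_restrict_space)
  have "emeasure (restrict_space lborel unit_square) (A \<times> B) = emeasure (lborel \<Otimes>\<^sub>M lborel) (A \<times> B)"
    using AB' unit_square_borel by (subst emeasure_restrict_space) (auto simp: lborel_prod)
  also have "\<dots> = emeasure lborel A * emeasure lborel B"
    using AB' by (intro lborel.emeasure_pair_measure_Times) auto
  finally show "emeasure unif A * emeasure unif B = emeasure (restrict_space lborel unit_square) (A \<times> B)"
    using AB by (simp add: emeasure_unif)
qed

abbreviation ae_eq :: "(real \<Rightarrow> real \<Rightarrow> real) \<Rightarrow> (real \<Rightarrow> real \<Rightarrow> real) \<Rightarrow> bool" where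
  "ae_eq V W \<equiv> AE p in unif \<Otimes>\<^sub>M unif. V (fst p) (snd p) = W (fst p) (snd p)"

lemma AE_unit_square_iff:
  "(AE p in unif \<Otimes>\<^sub>M unif. P p) \<longleftrightarrow> (AE p in lborel. p \<in> unit_square \<longrightarrow> P p)"
proof -
  show ?thesis unfolding pair_unif using unit_square_borel by (subst AE_restrict_space_iff) auto
qed

lemma AE_lborel_swap:
  assumes "AE p in (lborel :: (real \<times> real) measure). P p"
  shows "AE p in (lborel :: (real \<times> real) measure). P (snd p, fst p)"
proof -
  have eq: "(lborel :: (real \<times> real) measure) = distr (lborel \<Otimes>\<^sub>M lborel) (lborel \<Otimes>\<^sub>M lborel) (\<lambda>(x, y). (y, x))"
    using lborel_pair.distr_pair_swap by (simp add: lborel_prod)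
  have "AE p in distr (lborel \<Otimes>\<^sub>M lborel) (lborel \<Otimes>\<^sub>M lborel) (\<lambda>(x, y). (y, x :: real)). P p"
    using assms unfolding eq[symmetric] .
  from AE_distrD[OF measurable_pair_swap' this] show ?thesis
    unfolding lborel_prod by (simp add: case_prod_unfold)
qed

lemma kernel_in_graphons: "U.kernel W \<Longrightarrow> W \<in> graphons"
proof -
  assume W: "U.kernel W"
  have "case_prod W \<in> borel_measurable (restrict_space lborel unit_square)"
    using W unfolding U.kernel_def pair_unif by simp
  then have "(\<lambda>p. if p \<in> unit_square then case_prod W p else 0) \<in> borel_measurable lborel"
    using unit_square_borel by (subst (asm) measurable_restrict_space_iff[where c=0]) auto
  then have "(\<lambda>p. if p \<in> unit_square then case_prod W p else 0) \<in> borel_measurable lebesgue"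
    by (rule measurable_completion)
  then have "case_prod W \<in> borel_measurable (lebesgue_on unit_square)"
    using unit_square_borel by (subst measurable_restrict_space_iff[where c=0]) auto
  then show "W \<in> graphons"
    using W unfolding graphons_def U.kernel_def by simp
qed

lemma graphon_measurable:
  assumes "W \<in> graphons"
  shows "(\<lambda>p. if p \<in> unit_square then case_prod W p else 0) \<in> borel_measurable lebesgue"
proof -
  have "case_prod W \<in> borel_measurable (lebesgue_on unit_square)"
    using assms unfolding graphons_def by simp
  then show ?thesis
    using unit_square_borel by (subst (asm) measurable_restrict_space_iff[where c=0]) auto
qed

text \<open>A Lebesgue measurable function agrees almost everywhere with a Borel function
  \<open>f\<close>. Reading \<open>f\<close> at the sorted pair makes it symmetric, and clamping
  makes it [0, 1]-valued everywhere.\<close>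

lemma graphon_kernel:
  assumes "W \<in> graphons"
  obtains W' where "U.kernel W'" "ae_eq W W'"
proof -
  from completion_ex_borel_measurable_real[OF graphon_measurable[OF assms]]
  obtain f where f [measurable]: "f \<in> borel_measurable borel"
    and f_eq: "AE p in lborel. (if p \<in> unit_square then case_prod W p else 0) = f p" by auto
  define W' where "W' x y = max 0 (min 1 (f (min x y, max x y)))" for x y
  note [measurable] = fst_snd_unif
  have "(\<lambda>p. W' (fst p) (snd p)) \<in> borel_measurable (unif \<Otimes>\<^sub>M unif)"
    unfolding W'_def by measurable
  then have "U.kernel W'"
    unfolding U.kernel_def by (auto simp: W'_def min.commute max.commute case_prod_unfold)
  \<comment> \<open>Below the diagonal the value is read at the mirrored point, so the exceptional
    null set and its mirror image must both be avoided.\<close>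
  moreover have "AE p in lborel. p \<in> unit_square \<longrightarrow> W (fst p) (snd p) = W' (fst p) (snd p)"
    using f_eq AE_lborel_swap[OF f_eq]
  proof eventually_elim
    case (elim p)
    show ?case
    proof
      assume p: "p \<in> unit_square"
      have W01: "0 \<le> W (fst p) (snd p)" "W (fst p) (snd p) \<le> 1" "W (fst p) (snd p) = W (snd p) (fst p)"
        using assms p unfolding graphons_def by auto
      have "f (min (fst p) (snd p), max (fst p) (snd p)) = W (fst p) (snd p)"
        using elim p W01(3) by (cases "fst p \<le> snd p") (auto simp: case_prod_unfold min_def max_def split: if_splits)
      then show "W (fst p) (snd p) = W' (fst p) (snd p)" using W01 by (simp add: W'_def)
    qed
  qed
  ultimately show thesis by (intro that) (auto simp: AE_unit_square_iff)
qed

lemma d1_eq_avg: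
  assumes W: "U.kernel W'" "ae_eq W W'"
    and V: "U.kernel V'" "ae_eq V V'"
    and gr: "W \<in> graphons" "V \<in> graphons"
  shows "d1 W V = U.avg (\<lambda>x y. \<bar>W' x y - V' x y\<bar>)"
proof -
  note m = gr[THEN graphon_measurable]
  have b: "U.bdd_fun (\<lambda>x y. \<bar>W' x y - V' x y\<bar>)"
    by (intro U.bdd_fun_abs U.bdd_fun_diff U.bdd_fun_kernel W V)
  then have "(\<lambda>p. \<bar>W' (fst p) (snd p) - V' (fst p) (snd p)\<bar>) \<in> borel_measurable (restrict_space lborel unit_square)"
    using U.bdd_fun_measurable pair_unif by (simp add: case_prod_unfold)
  then have bm: "(\<lambda>p. indicator unit_square p *\<^sub>R \<bar>W' (fst p) (snd p) - V' (fst p) (snd p)\<bar>) \<in> borel_measurable lborel"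
    using unit_square_borel by (subst (asm) borel_measurable_restrict_space_iff) auto
  have "d1 W V = (\<integral>p. indicator unit_square p *\<^sub>R \<bar>W (fst p) (snd p) - V (fst p) (snd p)\<bar> \<partial>lebesgue)"
    unfolding d1_def using unit_square_borel by (subst integral_restrict_space) (auto simp: case_prod_unfold)
  also have "\<dots> = (\<integral>p. indicator unit_square p *\<^sub>R \<bar>W' (fst p) (snd p) - V' (fst p) (snd p)\<bar> \<partial>lebesgue)"
  proof (rule integral_cong_AE)
    show "(\<lambda>p. indicator unit_square p *\<^sub>R \<bar>W (fst p) (snd p) - V (fst p) (snd p)\<bar>) \<in> borel_measurable lebesgue"
    proof (rule measurable_cong[THEN iffD1])
      show "(\<lambda>p. \<bar>(if p \<in> unit_square then case_prod W p else 0) - (if p \<in> unit_square then case_prod V p else 0)\<bar>)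
         \<in> borel_measurable lebesgue" using m by (intro borel_measurable_abs borel_measurable_diff)
    qed (auto simp: indicator_def case_prod_unfold)
    show "(\<lambda>p. indicator unit_square p *\<^sub>R \<bar>W' (fst p) (snd p) - V' (fst p) (snd p)\<bar>) \<in> borel_measurable lebesgue"
      using bm by (rule measurable_completion)
    have "AE p in lborel. indicator unit_square p *\<^sub>R \<bar>W (fst p) (snd p) - V (fst p) (snd p)\<bar> =
        indicator unit_square p *\<^sub>R \<bar>W' (fst p) (snd p) - V' (fst p) (snd p)\<bar>"
      using W(2) V(2) unfolding AE_unit_square_iff by eventually_elim (auto simp: indicator_def)
    then show "AE p in lebesgue. indicator unit_square p *\<^sub>R \<bar>W (fst p) (snd p) - V (fst p) (snd p)\<bar> =
        indicator unit_square p *\<^sub>R \<bar>W' (fst p) (snd p) - V' (fst p) (snd p)\<bar>"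
      by (rule AE_completion)
  qed
  also have "\<dots> = (\<integral>p. indicator unit_square p *\<^sub>R \<bar>W' (fst p) (snd p) - V' (fst p) (snd p)\<bar> \<partial>lborel)"
    using bm by (rule integral_completion)
  also have "\<dots> = U.avg (\<lambda>x y. \<bar>W' x y - V' x y\<bar>)"
    unfolding U.avg_def pair_unif using unit_square_borel by (subst integral_restrict_space) auto
  finally show ?thesis .
qed

section \<open>The law of the random graph as a finite sum over edge patterns\<close>

definition patterns :: "nat \<Rightarrow> (nat \<times> nat \<Rightarrow> bool) set" where
  "patterns k = {b. \<forall>e. e \<notin> index_pairs k \<longrightarrow> \<not> b e}"

definition pattern_graph :: "nat \<Rightarrow> (nat \<times> nat \<Rightarrow> bool) \<Rightarrow> ugraph" where
  "pattern_graph k b = ({1..k}, {{i, j} | i j. 1 \<le> i \<and> i < j \<and> j \<le> k \<and> b (i, j)})"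

text \<open>Outside \<open>index_pairs k\<close> a pattern is fixed to False, the default value of
  the product distribution; this leaves finitely many patterns.\<close>

lemma finite_patterns [simp]: "finite (patterns k)"
proof -
  have "patterns k = PiE_dflt (index_pairs k) False (\<lambda>_. UNIV)"
    by (auto simp: patterns_def PiE_dflt_def)
  then show ?thesis by (simp add: finite_PiE_dflt)
qed

lemma pattern_graph_simple: "simple_graph (pattern_graph k b)" "fst (pattern_graph k b) = {1..k}"
  by (auto simp: pattern_graph_def simple_graph_def card_2_iff)

abbreviation edge_pmf :: "nat \<Rightarrow> (real \<Rightarrow> real \<Rightarrow> real) \<Rightarrow> (nat \<Rightarrow> real) \<Rightarrow> (nat \<times> nat \<Rightarrow> bool) pmf" where
  "edge_pmf k W x \<equiv> Pi_pmf (index_pairs k) False (\<lambda>e. bernoulli_pmf (W (x (fst e)) (x (snd e))))"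

lemma edge_choice_pmf_eq:
  "edge_choice_pmf k W x = map_pmf (pattern_graph k)
     (edge_pmf k W x)"
  unfolding edge_choice_pmf_def pattern_graph_def[abs_def] index_pairs_def by (simp add: case_prod_unfold)

lemma set_Pi_pmf_patterns: "set_pmf (Pi_pmf (index_pairs k) False p) \<subseteq> patterns k"
  using set_Pi_pmf_subset[OF finite_index_pairs] by (fastforce simp: patterns_def)

lemma finite_set_Pi_pmf_patterns: "finite (set_pmf (Pi_pmf (index_pairs k) False p))"
  by (rule finite_subset[OF set_Pi_pmf_patterns finite_patterns])

lemma edge_choice_prob:
  assumes "U.kernel W"
  shows "measure_pmf.prob (edge_choice_pmf k W x) S =
    (\<Sum>b\<in>patterns k. if pattern_graph k b \<in> S then pattern_weight k W b x else 0)"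
proof -
  let ?p = "edge_pmf k W x"
  note supp = set_Pi_pmf_patterns[of k "\<lambda>e. bernoulli_pmf (W (x (fst e)) (x (snd e)))"]
  have "measure_pmf.prob (edge_choice_pmf k W x) S = measure_pmf.prob ?p (pattern_graph k -` S)"
    unfolding edge_choice_pmf_eq by simp
  also have "\<dots> = measure_pmf.prob ?p (pattern_graph k -` S \<inter> patterns k)"
    using supp by (intro measure_pmf.finite_measure_eq_AE) (auto simp: AE_measure_pmf_iff)
  also have "\<dots> = (\<Sum>b\<in>pattern_graph k -` S \<inter> patterns k. pmf ?p b)"
    by (intro measure_measure_pmf_finite) simp
  also have "\<dots> = (\<Sum>b\<in>patterns k. if pattern_graph k b \<in> S then pmf ?p b else 0)"
    by (simp add: sum.inter_restrict Int_commute vimage_def flip: sum.inter_filter)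
  also have "\<dots> = (\<Sum>b\<in>patterns k. if pattern_graph k b \<in> S then pattern_weight k W b x else 0)"
  proof (intro sum.cong if_cong refl)
    fix b assume "b \<in> patterns k"
    then have "pmf ?p b = (\<Prod>e\<in>index_pairs k. pmf (bernoulli_pmf (W (x (fst e)) (x (snd e)))) (b e))"
      by (subst pmf_Pi') (auto simp: patterns_def)
    also have "\<dots> = pattern_weight k W b x"
    proof (intro prod.cong refl)
      fix e
      show "pmf (bernoulli_pmf (W (x (fst e)) (x (snd e)))) (b e) = edge_weight W (b e) (x (fst e)) (x (snd e))"
        using U.kernel_bounds[OF assms] by (cases "b e") (auto simp: edge_weight_def)
    qed
    finally show "pmf ?p b = pattern_weight k W b x" .
  qed
  finally show ?thesis .
qed

lemma pattern_weight_measurable: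
  assumes "U.kernel W"
  shows "(\<lambda>x. pattern_weight k W b x) \<in> borel_measurable (U.cube {1..k})"
  by (intro borel_measurable_prod U.edge_measurable U.edge_weight_bdd assms)

lemma edge_choice_prob_measurable:
  assumes "U.kernel W"
  shows "(\<lambda>x. measure_pmf.prob (edge_choice_pmf k W x) S) \<in> borel_measurable (U.cube {1..k})"
  unfolding edge_choice_prob[OF assms] using pattern_weight_measurable[OF assms]
  by (intro borel_measurable_sum) simp

text \<open>Preimages under \<open>f\<close> and \<open>g\<close> differ by a subset of a null set,
  which the completion makes measurable.\<close>

lemma borel_measurable_completion_AE:
  fixes f g :: "'a \<Rightarrow> 'b::topological_space"
  assumes g: "g \<in> borel_measurable M" and eq: "AE x in M. f x = g x"
  shows "f \<in> borel_measurable (completion M)"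
proof (rule measurableI)
  fix A :: "'b set" assume A: "A \<in> sets borel"
  show "f -` A \<inter> space (completion M) \<in> sets (completion M)"
  proof (rule completion.in_sets_AE)
    show "g -` A \<inter> space M \<in> sets (completion M)" using measurable_sets[OF g A] by simp
    show "AE x in completion M. x \<in> g -` A \<inter> space M \<longleftrightarrow> x \<in> f -` A \<inter> space (completion M)"
      using AE_completion[OF eq] by eventually_elim auto
  qed auto
qed simp

text \<open>For almost every choice of points the edge distributions of \<open>W\<close> and
  \<open>W'\<close> coincide. This yields measurability of the mixture over the completed cube and
  lets the probability be computed from \<open>W'\<close> on the ordinary product space.\<close>

lemma random_graph_prob_integral:
  assumes W: "U.kernel W'" "ae_eq W W'"
  shows "measure (random_graph k W) S = (\<integral>x. measure_pmf.prob (edge_choice_pmf k W' x) S \<partial>U.cube {1..k})"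
proof -
  interpret C: prob_space "U.cube {1..k}" by (rule U.prob_space_cube)
  note U.AE_edges[OF W(2), of k]
  then have eq: "AE x in U.cube {1..k}. edge_choice_pmf k W x = edge_choice_pmf k W' x"
  proof eventually_elim
    case (elim x)
    then have "edge_pmf k W x =
       edge_pmf k W' x"
      by (intro Pi_pmf_cong) auto
    then show ?case unfolding edge_choice_pmf_eq by simp
  qed
  have meas: "(\<lambda>x. measure_pmf (edge_choice_pmf k W x)) \<in> unit_cube {1..k} \<rightarrow>\<^sub>M subprob_algebra (count_space UNIV)"
  proof (rule measurable_subprob_algebra)
    fix A :: "ugraph set" assume "A \<in> sets (count_space UNIV)"
    show "(\<lambda>x. emeasure (measure_pmf (edge_choice_pmf k W x)) A) \<in> borel_measurable (unit_cube {1..k})"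
      unfolding unit_cube_def
    proof (rule borel_measurable_completion_AE)
      show "(\<lambda>x. ennreal (measure_pmf.prob (edge_choice_pmf k W' x) A)) \<in> borel_measurable (U.cube {1..k})"
        using edge_choice_prob_measurable[OF W(1)] by measurable
      show "AE x in U.cube {1..k}. emeasure (measure_pmf (edge_choice_pmf k W x)) A =
          ennreal (measure_pmf.prob (edge_choice_pmf k W' x) A)"
        using eq by eventually_elim (simp add: measure_pmf.emeasure_eq_measure)
    qed
  qed (auto simp: measure_pmf.subprob_space_axioms)
  have "emeasure (random_graph k W) S = (\<integral>\<^sup>+x. emeasure (measure_pmf (edge_choice_pmf k W x)) S \<partial>unit_cube {1..k})"
    unfolding random_graph_def using C.not_empty by (intro emeasure_bind[OF _ meas]) (auto simp: unit_cube_def)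
  also have "\<dots> = (\<integral>\<^sup>+x. emeasure (measure_pmf (edge_choice_pmf k W x)) S \<partial>U.cube {1..k})"
    unfolding unit_cube_def by (rule nn_integral_completion)
  also have "\<dots> = (\<integral>\<^sup>+x. ennreal (measure_pmf.prob (edge_choice_pmf k W' x) S) \<partial>U.cube {1..k})"
    using eq by (intro nn_integral_cong_AE, eventually_elim) (simp add: measure_pmf.emeasure_eq_measure)
  also have "\<dots> = ennreal (\<integral>x. measure_pmf.prob (edge_choice_pmf k W' x) S \<partial>U.cube {1..k})"
    using edge_choice_prob_measurable[OF W(1)]
    by (intro nn_integral_eq_integral C.integrable_const_bound[where B=1]) auto
  finally show ?thesis by (simp add: measure_def)
qed

lemma random_graph_prob:
  assumes W: "U.kernel W'" "ae_eq W W'"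
  shows "measure (random_graph k W) S = (\<Sum>b\<in>patterns k. if pattern_graph k b \<in> S then U.pattern_prob k W' b else 0)"
proof -
  interpret C: prob_space "U.cube {1..k}" by (rule U.prob_space_cube)
  have "\<bar>pattern_weight k W' b x\<bar> \<le> 1" for b x
    unfolding abs_prod by (intro prod_le_1 conjI abs_ge_zero U.edge_weight_bdd(2)[OF W(1)])
  then have "integrable (U.cube {1..k}) (\<lambda>x. pattern_weight k W' b x)" for b
    using pattern_weight_measurable[OF W(1)] by (intro C.integrable_const_bound[where B=1]) auto
  then have "integrable (U.cube {1..k}) (\<lambda>x. if pattern_graph k b \<in> S
      then pattern_weight k W' b x else 0)" for b
    by (cases "pattern_graph k b \<in> S") auto
  then show ?thesis
    unfolding random_graph_prob_integral[OF W] edge_choice_prob[OF W(1)] U.pattern_prob_def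
    by (subst Bochner_Integration.integral_sum) (auto intro!: sum.cong)
qed

subsection \<open>Fourth moments and equipartitions\<close>

text \<open>The weighted count of closed 4-cycles \<open>u v u' v'\<close>, equivalently the trace
  of the square of the Gram matrix of the columns of \<open>B\<close>.\<close>

definition c4_sum :: "'v set \<Rightarrow> ('v \<Rightarrow> 'v \<Rightarrow> real) \<Rightarrow> real" where
  "c4_sum V B = (\<Sum>v\<in>V. \<Sum>v'\<in>V. (\<Sum>u\<in>V. B u v * B u v')\<^sup>2)"

lemma c4_sum_nonneg: "0 \<le> c4_sum V B"
  unfolding c4_sum_def by (intro sum_nonneg) auto

lemma c4_sum_expand:
  "c4_sum V B = (\<Sum>v\<in>V. \<Sum>v'\<in>V. \<Sum>u\<in>V. \<Sum>u'\<in>V. B u v * B u v' * (B u' v * B u' v'))"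
  unfolding c4_sum_def by (simp add: power2_eq_square sum_product)

text \<open>Cauchy-Schwarz twice: the first application removes \<open>f\<close> and leaves a
  quadratic form in \<open>g\<close>, the second removes the products of values of \<open>g\<close>
  and leaves the 4-cycles.\<close>

lemma bilinear_form_le_c4_sum:
  assumes V: "finite V" and f: "\<And>v. v \<in> V \<Longrightarrow> \<bar>f v\<bar> \<le> 1" and g: "\<And>v. v \<in> V \<Longrightarrow> \<bar>g v\<bar> \<le> 1"
  shows "(\<Sum>u\<in>V. \<Sum>v\<in>V. B u v * f u * g v) ^ 4 \<le> real (card V) ^ 4 * c4_sum V B"
proof -
  define S where "S = (\<Sum>u\<in>V. \<Sum>v\<in>V. B u v * f u * g v)"
  define Q where "Q = (\<Sum>u\<in>V. (\<Sum>v\<in>V. B u v * g v)\<^sup>2)"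
  let ?N = "real (card V)"
  have sq: "(\<Sum>v\<in>V. (h v)\<^sup>2) \<le> ?N" if "\<And>v. v \<in> V \<Longrightarrow> \<bar>h v\<bar> \<le> 1" for h :: "'a \<Rightarrow> real"
    using sum_bounded_above[of V "\<lambda>v. (h v)\<^sup>2" 1] that by (simp add: abs_square_le_1)
  have pair: "(\<Sum>p\<in>V \<times> V. F (fst p) (snd p)) = (\<Sum>v\<in>V. \<Sum>v'\<in>V. F v v')" for F :: "'a \<Rightarrow> 'a \<Rightarrow> real"
    by (simp add: sum.cartesian_product case_prod_unfold)
  have "S\<^sup>2 = (\<Sum>u\<in>V. f u * (\<Sum>v\<in>V. B u v * g v))\<^sup>2"
    unfolding S_def by (simp add: sum_distrib_left mult_ac)
  also have "\<dots> \<le> (\<Sum>u\<in>V. (f u)\<^sup>2) * Q" unfolding Q_def by (rule Cauchy_Schwarz_ineq_sum)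
  also have "\<dots> \<le> ?N * Q" using sq[OF f] by (intro mult_right_mono) (auto simp: Q_def sum_nonneg)
  finally have S: "S\<^sup>2 \<le> ?N * Q" .
  have "Q = (\<Sum>u\<in>V. \<Sum>v\<in>V. \<Sum>v'\<in>V. (g v * g v') * (B u v * B u v'))"
    unfolding Q_def by (simp add: power2_eq_square sum_product mult_ac)
  also have "\<dots> = (\<Sum>v\<in>V. \<Sum>u\<in>V. \<Sum>v'\<in>V. (g v * g v') * (B u v * B u v'))" by (rule sum.swap)
  also have "\<dots> = (\<Sum>v\<in>V. \<Sum>v'\<in>V. \<Sum>u\<in>V. (g v * g v') * (B u v * B u v'))"
    by (rule sum.cong[OF refl]) (rule sum.swap)
  also have "\<dots> = (\<Sum>p\<in>V \<times> V. (g (fst p) * g (snd p)) * (\<Sum>u\<in>V. B u (fst p) * B u (snd p)))"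
    unfolding pair[of "\<lambda>v v'. (g v * g v') * (\<Sum>u\<in>V. B u v * B u v')"] by (simp add: sum_distrib_left)
  finally have "Q\<^sup>2 \<le> (\<Sum>p\<in>V \<times> V. (g (fst p) * g (snd p))\<^sup>2) * (\<Sum>p\<in>V \<times> V. (\<Sum>u\<in>V. B u (fst p) * B u (snd p))\<^sup>2)"
    by (simp only: Cauchy_Schwarz_ineq_sum)
  also have "(\<Sum>p\<in>V \<times> V. (\<Sum>u\<in>V. B u (fst p) * B u (snd p))\<^sup>2) = c4_sum V B"
    unfolding c4_sum_def by (rule pair)
  also have "(\<Sum>p\<in>V \<times> V. (g (fst p) * g (snd p))\<^sup>2) = (\<Sum>v\<in>V. (g v)\<^sup>2) * (\<Sum>v\<in>V. (g v)\<^sup>2)"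
    unfolding pair[of "\<lambda>v v'. (g v * g v')\<^sup>2"] by (simp add: sum_product power_mult_distrib)
  also have "\<dots> \<le> ?N * ?N" using sq[OF g] by (intro mult_mono sum_nonneg) auto
  finally have Q: "Q\<^sup>2 \<le> ?N * ?N * c4_sum V B" using c4_sum_nonneg[of V B] by (simp add: mult_right_mono)
  have "S ^ 4 = (S\<^sup>2)\<^sup>2" by simp
  also have "\<dots> \<le> (?N * Q)\<^sup>2" using S by (intro power_mono) auto
  also have "\<dots> \<le> ?N\<^sup>2 * (?N * ?N * c4_sum V B)" using Q by (simp add: power_mult_distrib mult_left_mono)
  also have "\<dots> = ?N ^ 4 * c4_sum V B" by (simp add: power2_eq_square power4_eq_xxxx)
  finally show ?thesis unfolding S_def .
qed

context kernel_space
begin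

text \<open>For a step function on equal classes, only the integrals of the test functions over the
  classes count, so the average is a bilinear form of the matrix and the previous estimate
  applies.\<close>

lemma cut_bound_of_c4_sum:
  fixes \<phi> :: "'a \<Rightarrow> nat"
  assumes \<phi> [measurable]: "labelling \<phi>" and V: "finite V" "V \<noteq> {}" "\<And>x. \<phi> x \<in> V"
    and mass: "\<And>v. v \<in> V \<Longrightarrow> prob {x\<in>space M. \<phi> x = v} = 1 / card V"
    and B: "\<And>u v. \<bar>B u v\<bar> \<le> 1" and c4: "c4_sum V B \<le> real (card V) ^ 4 * \<delta> ^ 4" and \<delta>: "0 \<le> \<delta>"
  shows "cut_bound (\<lambda>x y. B (\<phi> x) (\<phi> y)) \<delta>"
  unfolding cut_bound_def
proof safe
  fix f g :: "'a \<Rightarrow> real"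
  assume fg [measurable]: "f \<in> borel_measurable M" "g \<in> borel_measurable M"
    and f1: "\<forall>x. \<bar>f x\<bar> \<le> 1" and g1: "\<forall>x. \<bar>g x\<bar> \<le> 1"
  let ?N = "real (card V)"
  have N: "0 < ?N" using V by (simp add: card_gt_0_iff)
  \<comment> \<open>A class has mass \<open>1 / ?N\<close>, hence \<open>?N * I h v\<close> is the
    mean of \<open>h\<close> on the class and lies in [-1, 1].\<close>
  define I where "I h v = (\<integral>x. (if \<phi> x = v then h x else 0) \<partial>M)" for h :: "'a \<Rightarrow> real" and v
  define a where "a = avg (\<lambda>x y. B (\<phi> x) (\<phi> y) * f x * g y)"
  have I: "\<bar>?N * I h v\<bar> \<le> 1" if [measurable]: "h \<in> borel_measurable M" and h: "\<forall>x. \<bar>h x\<bar> \<le> 1" and "v \<in> V" for h v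
  proof -
    have "\<bar>I h v\<bar> \<le> (\<integral>x. \<bar>if \<phi> x = v then h x else 0\<bar> \<partial>M)"
      unfolding I_def using integral_norm_bound[of M "\<lambda>x. if \<phi> x = v then h x else 0"] by simp
    also have "\<dots> \<le> (\<integral>x. indicator {x\<in>space M. \<phi> x = v} x \<partial>M)"
      using h by (intro integral_mono integrable_const_bound[where B=1]) (auto simp: indicator_def)
    also have "\<dots> = 1 / ?N" using mass[OF \<open>v \<in> V\<close>] by simp
    finally show ?thesis using N by (simp add: abs_mult field_simps)
  qed
  have bF: "bdd_fun (\<lambda>x y. (if \<phi> x = u then f x else 0) * (if \<phi> y = v then g y else 0))" for u v
    using f1 g1 by (intro bdd_fun_mult bdd_fun_left[where B=1] bdd_fun_right[where B=1]) auto
  have "a = avg (\<lambda>x y. \<Sum>p\<in>V \<times> V. B (fst p) (snd p) * ((if \<phi> x = fst p then f x else 0) * (if \<phi> y = snd p then g y else 0)))"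
    unfolding a_def
  proof (intro arg_cong[of _ _ avg] ext)
    fix x y
    have "(\<Sum>p\<in>V \<times> V. B (fst p) (snd p) * ((if \<phi> x = fst p then f x else 0) * (if \<phi> y = snd p then g y else 0)))
      = (\<Sum>p\<in>V \<times> V. if p = (\<phi> x, \<phi> y) then B (\<phi> x) (\<phi> y) * f x * g y else 0)"
      by (intro sum.cong) auto
    also have "\<dots> = B (\<phi> x) (\<phi> y) * f x * g y" using V by (subst sum.delta) auto
    finally show "B (\<phi> x) (\<phi> y) * f x * g y = (\<Sum>p\<in>V \<times> V. B (fst p) (snd p) *
       ((if \<phi> x = fst p then f x else 0) * (if \<phi> y = snd p then g y else 0)))" by simp
  qed
  also have "\<dots> = (\<Sum>p\<in>V \<times> V. B (fst p) (snd p) *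
      avg (\<lambda>x y. (if \<phi> x = fst p then f x else 0) * (if \<phi> y = snd p then g y else 0)))"
    using V by (subst avg_sum) (auto simp: avg_cmult intro!: bdd_fun_mult[OF bdd_fun_const bF])
  also have "\<dots> = (\<Sum>p\<in>V \<times> V. B (fst p) (snd p) * (I f (fst p) * I g (snd p)))"
    by (intro sum.cong refl arg_cong[of _ _ "(*) _"], subst avg_fst[OF bF]) (simp add: I_def)
  also have "?N\<^sup>2 * \<dots> = (\<Sum>u\<in>V. \<Sum>v\<in>V. B u v * (?N * I f u) * (?N * I g v))"
    by (simp add: sum.cartesian_product case_prod_unfold sum_distrib_left power2_eq_square mult_ac)
  finally have "(?N\<^sup>2 * a) ^ 4 \<le> ?N ^ 4 * c4_sum V B"
    using bilinear_form_le_c4_sum[OF V(1), of "\<lambda>u. ?N * I f u" "\<lambda>v. ?N * I g v" B] I[OF fg(1) f1] I[OF fg(2) g1] by simp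
  also have "\<dots> \<le> ?N ^ 4 * (?N ^ 4 * \<delta> ^ 4)" using c4 by (intro mult_left_mono) auto
  also have "\<dots> = (?N\<^sup>2 * \<delta>) ^ 4" by (simp add: power_mult_distrib flip: power_mult power_add)
  finally have "\<bar>?N\<^sup>2 * a\<bar> ^ Suc 3 \<le> (?N\<^sup>2 * \<delta>) ^ Suc 3"
    unfolding Suc_numeral by (simp add: power_even_abs)
  then have "\<bar>?N\<^sup>2 * a\<bar> \<le> ?N\<^sup>2 * \<delta>" by (rule power_le_imp_le_base) (simp add: \<delta>)
  then show "\<bar>avg (\<lambda>x y. B (\<phi> x) (\<phi> y) * f x * g y)\<bar> \<le> \<delta>"
    using N by (simp add: a_def[symmetric] abs_mult)
qed

end

text \<open>The transport plan puts as much mass as possible on the cells with matching labels and spreads the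
  rest as a product.\<close>

lemma maximal_coupling:
  fixes p :: "nat \<Rightarrow> real" and lab :: "'v \<Rightarrow> nat" and s :: real
  assumes V: "finite V" and lab: "\<And>v. v \<in> V \<Longrightarrow> lab v < K" and p: "\<And>l. 0 \<le> p l" and s: "0 \<le> s"
    and total: "(\<Sum>l<K. p l) = card V * s"
  defines "z \<equiv> \<lambda>l. card {v\<in>V. lab v = l} * s"
  obtains m where "\<And>l v. 0 \<le> m l v" "\<And>l. l < K \<Longrightarrow> (\<Sum>v\<in>V. m l v) = p l" "\<And>v. v \<in> V \<Longrightarrow> (\<Sum>l<K. m l v) = s"
    "(\<Sum>v\<in>V. m (lab v) v) \<ge> (\<Sum>l<K. min (p l) (z l))"
proof -
  define n where "n l = real (card {v\<in>V. lab v = l})" for l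
  have z: "z l = n l * s" for l by (simp add: z_def n_def)
  define q where "q l = min (p l) (z l)" for l
  have q: "0 \<le> q l" "q l \<le> p l" "q l \<le> n l * s" for l
    using p[of l] s by (auto simp: q_def z n_def)
  \<comment> \<open>The matched mass \<open>q l\<close> of a label is shared equally by its
    vertices, with default 0 for a label that has none.\<close>
  define a where "a l = (if n l = 0 then 0 else q l / n l)" for l
  have na: "n l * a l = q l" for l using q(1)[of l] q(3)[of l] by (auto simp: a_def)
  have a: "0 \<le> a l" "a l \<le> s" for l
  proof -
    show "0 \<le> a l" unfolding a_def using q(1)[of l] by (auto simp: n_def)
    show "a l \<le> s" unfolding a_def using q(3)[of l] s by (auto simp: n_def divide_le_eq mult.commute)
  qed
  have sumV: "(\<Sum>v\<in>V. h (lab v)) = (\<Sum>l<K. n l * h l)" for h :: "nat \<Rightarrow> real"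
  proof -
    have "(\<Sum>v\<in>V. h (lab v)) = (\<Sum>v\<in>V. \<Sum>l<K. if lab v = l then h l else 0)"
      using lab by (intro sum.cong refl) simp
    also have "\<dots> = (\<Sum>l<K. \<Sum>v\<in>V. if lab v = l then h l else 0)" by (rule sum.swap)
    also have "\<dots> = (\<Sum>l<K. n l * h l)"
      using V by (intro sum.cong refl) (simp add: n_def flip: sum.inter_filter)
    finally show ?thesis .
  qed
  define D where "D = (\<Sum>l<K. p l - q l)"
  have D0: "0 \<le> D" unfolding D_def using q by (intro sum_nonneg) auto
  have D: "(\<Sum>v\<in>V. s - a (lab v)) = D"
    using sumV[of a] by (simp add: D_def sum_subtractf na total)
  \<comment> \<open>\<open>p l - q l\<close> and \<open>s - a (lab v)\<close> are the masses still
    missing in row \<open>l\<close> and column \<open>v\<close>, each with total \<open>D\<close>.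
    If \<open>D = 0\<close>, both vanish wherever they count, and division by zero contributes
    0.\<close>
  define m where "m l v = (if lab v = l then a l else 0) + (p l - q l) * (s - a (lab v)) / D" for l v
  have zero: "p l - q l = 0" if "D = 0" "l < K" for l
    using that sum_nonneg_0[of "{..<K}" "\<lambda>l. p l - q l" l] q by (auto simp: D_def)
  have zero': "s - a (lab v) = 0" if "D = 0" "v \<in> V" for v
    using that sum_nonneg_0[of V "\<lambda>v. s - a (lab v)" v] a D V by auto
  show thesis
  proof
    show "0 \<le> m l v" for l v
      unfolding m_def using a q D0 by (auto intro!: add_nonneg_nonneg divide_nonneg_nonneg mult_nonneg_nonneg)
    show "(\<Sum>v\<in>V. m l v) = p l" if "l < K" for l
    proof -
      have "(\<Sum>v\<in>V. m l v) = n l * a l + (p l - q l) * (\<Sum>v\<in>V. s - a (lab v)) / D"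
        unfolding m_def using V by (simp add: sum.distrib n_def sum_distrib_left sum_divide_distrib flip: sum.inter_filter)
      then show ?thesis unfolding D na using zero[OF _ that] by auto
    qed
    show "(\<Sum>l<K. m l v) = s" if "v \<in> V" for v
    proof -
      have "(\<Sum>l<K. m l v) = a (lab v) + (\<Sum>l<K. p l - q l) * (s - a (lab v)) / D"
        unfolding m_def using lab[OF that] by (simp add: sum.distrib sum_distrib_right sum_divide_distrib)
      then show ?thesis unfolding D_def[symmetric] using zero'[OF _ that] by auto
    qed
    have "(\<Sum>l<K. q l) = (\<Sum>v\<in>V. a (lab v))" unfolding sumV na ..
    also have "\<dots> \<le> (\<Sum>v\<in>V. m (lab v) v)"
      unfolding m_def using a q D0 by (intro sum_mono) (auto intro!: divide_nonneg_nonneg mult_nonneg_nonneg)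
    finally show "(\<Sum>v\<in>V. m (lab v) v) \<ge> (\<Sum>l<K. min (p l) (z l))" unfolding q_def .
  qed
qed

context divisible_kernel_space
begin

text \<open>The maximal coupling of the two label distributions matches at least the sum of their
  minima, hence at least 1 minus the sum of their differences; \<open>split_labels\<close> realises
  it by a vertex map.\<close>

lemma equipartition_matching_labels:
  fixes \<alpha> :: "'a \<Rightarrow> nat" and lab :: "'v \<Rightarrow> nat"
  assumes \<alpha> [measurable]: "labelling \<alpha>" and \<alpha>K: "\<And>x. \<alpha> x < K"
    and V: "finite V" "V \<noteq> {}" and lab: "\<And>v. v \<in> V \<Longrightarrow> lab v < K"
    and close: "(\<Sum>l<K. \<bar>prob {x\<in>space M. \<alpha> x = l} - card {v\<in>V. lab v = l} / card V\<bar>) \<le> \<tau>"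
  obtains \<phi> where "labelling \<phi>" "\<And>x. \<phi> x \<in> V"
    "\<And>v. v \<in> V \<Longrightarrow> prob {x\<in>space M. \<phi> x = v} = 1 / card V"
    "prob {x\<in>space M. lab (\<phi> x) \<noteq> \<alpha> x} \<le> \<tau>"
proof -
  define p where "p l = prob {x\<in>space M. \<alpha> x = l}" for l
  define s where "s = 1 / real (card V)"
  have cV: "0 < card V" using V by (simp add: card_gt_0_iff)
  have part: "(\<Sum>l<K. prob {x\<in>space M. \<alpha> x = l \<and> R x}) = prob {x\<in>space M. R x}"
    if [measurable]: "Measurable.pred M R" for R
  proof -
    have "prob (\<Union>l<K. {x\<in>space M. \<alpha> x = l \<and> R x}) = (\<Sum>l<K. prob {x\<in>space M. \<alpha> x = l \<and> R x})"
      by (intro finite_measure_finite_Union) (auto simp: disjoint_family_on_def)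
    moreover have "(\<Union>l<K. {x\<in>space M. \<alpha> x = l \<and> R x}) = {x\<in>space M. R x}" using \<alpha>K by auto
    ultimately show ?thesis by simp
  qed
  have p1: "(\<Sum>l<K. p l) = 1" using part[of "\<lambda>_. True"] by (simp add: p_def prob_space)
  obtain m where m: "\<And>l v. 0 \<le> m l v" "\<And>l. l < K \<Longrightarrow> (\<Sum>v\<in>V. m l v) = p l"
      "\<And>v. v \<in> V \<Longrightarrow> (\<Sum>l<K. m l v) = s"
      "(\<Sum>v\<in>V. m (lab v) v) \<ge> (\<Sum>l<K. min (p l) (card {v\<in>V. lab v = l} * s))"
    using maximal_coupling[of V lab K p s] V lab p1 cV by (auto simp: p_def s_def)
  have "\<exists>\<phi>\<in>M \<rightarrow>\<^sub>M count_space UNIV. (\<forall>x. \<phi> x \<in> V) \<and>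
      (\<forall>l\<in>{..<K}. \<forall>v\<in>V. prob {x\<in>space M. \<alpha> x = l \<and> \<phi> x = v} = m l v)"
    using m V by (intro split_labels) (auto simp: p_def)
  then obtain \<phi> where \<phi> [measurable]: "labelling \<phi>" and \<phi>V: "\<And>x. \<phi> x \<in> V"
    and \<phi>m: "\<And>l v. l < K \<Longrightarrow> v \<in> V \<Longrightarrow> prob {x\<in>space M. \<alpha> x = l \<and> \<phi> x = v} = m l v" by auto
  have mass: "prob {x\<in>space M. \<phi> x = v} = 1 / card V" if "v \<in> V" for v
    using part[of "\<lambda>x. \<phi> x = v"] m(3)[OF that] \<phi>m[OF _ that] by (simp add: s_def)
  define L where "L x = lab (\<phi> x)" for x
  have [measurable]: "labelling L"
    unfolding L_def by (rule measurable_compose[OF \<phi>]) simp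
  have "prob {x\<in>space M. lab (\<phi> x) = \<alpha> x} = prob (\<Union>v\<in>V. {x\<in>space M. \<alpha> x = lab v \<and> \<phi> x = v})"
    using \<phi>V by (intro arg_cong[of _ _ prob]) auto
  also have "\<dots> = (\<Sum>v\<in>V. prob {x\<in>space M. \<alpha> x = lab v \<and> \<phi> x = v})"
    using V by (intro finite_measure_finite_Union) (auto simp: disjoint_family_on_def)
  also have "\<dots> = (\<Sum>v\<in>V. m (lab v) v)" using lab by (intro sum.cong refl \<phi>m) auto
  finally have "prob {x\<in>space M. lab (\<phi> x) = \<alpha> x} \<ge> (\<Sum>l<K. min (p l) (card {v\<in>V. lab v = l} * s))"
    using m(4) by simp
  moreover have "(\<Sum>l<K. min (p l) (card {v\<in>V. lab v = l} * s)) \<ge> (\<Sum>l<K. p l - \<bar>p l - card {v\<in>V. lab v = l} / card V\<bar>)"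
    by (intro sum_mono) (auto simp: s_def)
  moreover have "(\<Sum>l<K. p l - \<bar>p l - card {v\<in>V. lab v = l} / card V\<bar>) \<ge> 1 - \<tau>"
    using close p1 by (simp add: sum_subtractf p_def)
  moreover have "prob {x\<in>space M. \<not> L x = \<alpha> x} = 1 - prob {x\<in>space M. L x = \<alpha> x}"
  proof (rule prob_neg)
    have "Measurable.pred M (\<lambda>x. \<exists>l. L x = l \<and> \<alpha> x = l)" by measurable
    then show "{x\<in>space M. L x = \<alpha> x} \<in> events" by (simp add: pred_def eq_commute)
  qed
  ultimately have "prob {x\<in>space M. lab (\<phi> x) \<noteq> \<alpha> x} \<le> \<tau>" unfolding L_def by linarith
  with \<phi> \<phi>V mass show thesis by (rule that)
qed

end

section \<open>Moments of the sample: 4-cycles of residuals and label frequencies\<close>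

lemma expectation_prod_components:
  fixes f :: "'i \<Rightarrow> bool \<Rightarrow> real"
  assumes A: "finite A" and E: "E \<subseteq> A"
  shows "measure_pmf.expectation (Pi_pmf A d p) (\<lambda>b. \<Prod>e\<in>E. f e (b e)) =
    (\<Prod>e\<in>E. measure_pmf.expectation (p e) (f e))"
proof -
  let ?P = "Pi_pmf A d p"
  have fin: "finite E" using E A by (rule finite_subset)
  have "prob_space.indep_vars (measure_pmf ?P) (\<lambda>_. borel) (\<lambda>e b. f e (b e)) E"
    by (rule prob_space.indep_vars_compose2[OF measure_pmf.prob_space_axioms
          prob_space.indep_vars_subset[OF measure_pmf.prob_space_axioms indep_vars_Pi_pmf[OF A] E]]) simp
  moreover have "integrable ?P (\<lambda>b. f e (b e))" for e
  proof (rule measure_pmf.integrable_const_bound[where B="\<bar>f e True\<bar> + \<bar>f e False\<bar>"])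
    have "norm (f e c) \<le> \<bar>f e True\<bar> + \<bar>f e False\<bar>" for c by (cases c) auto
    then show "AE b in ?P. norm (f e (b e)) \<le> \<bar>f e True\<bar> + \<bar>f e False\<bar>" by simp
  qed simp
  ultimately have "measure_pmf.expectation ?P (\<lambda>b. \<Prod>e\<in>E. f e (b e)) = (\<Prod>e\<in>E. measure_pmf.expectation ?P (\<lambda>b. f e (b e)))"
    by (intro prob_space.indep_vars_lebesgue_integral[OF measure_pmf.prob_space_axioms fin])
  also have "\<dots> = (\<Prod>e\<in>E. measure_pmf.expectation (p e) (f e))"
  proof (intro prod.cong refl)
    fix e assume "e \<in> E"
    then have "map_pmf (\<lambda>b. b e) ?P = p e" using E A by (subst Pi_pmf_component) auto
    then show "measure_pmf.expectation ?P (\<lambda>b. f e (b e)) = measure_pmf.expectation (p e) (f e)"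
      using integral_map_pmf[of "\<lambda>b. b e" ?P "f e"] by simp
  qed
  finally show ?thesis .
qed

definition adj :: "ugraph \<Rightarrow> nat \<Rightarrow> nat \<Rightarrow> real" where
  "adj G u v = (if {u, v} \<in> snd G then 1 else 0)"

lemma adj_simps: "adj G u v = adj G v u" "0 \<le> adj G u v" "adj G u v \<le> 1"
  by (auto simp: adj_def insert_commute)

lemma adj_pattern_graph:
  assumes "u \<in> {1..N}" "v \<in> {1..N}" "u \<noteq> v"
  shows "adj (pattern_graph N b) u v = of_bool (b (min u v, max u v))"
proof -
  have "{u, v} \<in> snd (pattern_graph N b) \<longleftrightarrow> b (min u v, max u v)"
    using assms by (cases "u < v") (force simp: pattern_graph_def doubleton_eq_iff min_def max_def)+
  then show ?thesis by (simp add: adj_def)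
qed

text \<open>With four distinct vertices the cycle has four distinct edges, independent given the
  points, so the expectation factorises.\<close>

lemma expectation_c4_term:
  fixes x :: "nat \<Rightarrow> real"
  assumes W: "U.kernel W" and t: "\<And>i j. t i j = t j i"
    and V: "u \<in> {1..N}" "u' \<in> {1..N}" "v \<in> {1..N}" "v' \<in> {1..N}" and d: "distinct [u, u', v, v']"
  defines "P \<equiv> edge_pmf N W x"
    and "B \<equiv> \<lambda>b u v. adj (pattern_graph N b) u v - t u v" and "D \<equiv> \<lambda>u v. W (x u) (x v) - t u v"
  shows "measure_pmf.expectation P (\<lambda>b. B b u v * B b u v' * (B b u' v * B b u' v')) = D u v * D u v' * (D u' v * D u' v')"
proof -
  define f where "f e c = of_bool c - t (fst e) (snd e)" for e c
  let ?e = "\<lambda>u v. (min u v, max u v) :: nat \<times> nat"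
  let ?E = "{?e u v, ?e u v', ?e u' v, ?e u' v'}"
  have B: "B b a c = f (?e a c) (b (?e a c))" if "a \<in> {1..N}" "c \<in> {1..N}" "a \<noteq> c" for a c b
    unfolding B_def f_def adj_pattern_graph[OF that] using t[of a c] by (auto simp: min_def max_def)
  have E: "measure_pmf.expectation (bernoulli_pmf (W (x (fst (?e a c))) (x (snd (?e a c))))) (f (?e a c)) = D a c" for a c
  proof -
    have "W (x (min a c)) (x (max a c)) = W (x a) (x c)" "t (min a c) (max a c) = t a c"
      using W t[of a c] unfolding U.kernel_def by (auto simp: min_def max_def)
    then show ?thesis using U.kernel_bounds[OF W] by (simp add: f_def D_def algebra_simps)
  qed
  have neq: "?e u v \<noteq> ?e u v'" "?e u v \<noteq> ?e u' v" "?e u v \<noteq> ?e u' v'" "?e u v' \<noteq> ?e u' v" "?e u v' \<noteq> ?e u' v'" "?e u' v \<noteq> ?e u' v'"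
    using d by (auto simp: min_def max_def split: if_splits)
  have ind: "?E \<subseteq> index_pairs N" using V d by (auto simp: index_pairs_def min_def max_def)
  have prod4: "(\<Prod>e\<in>?E. h e) = h (?e u v) * h (?e u v') * (h (?e u' v) * h (?e u' v'))" for h :: "nat \<times> nat \<Rightarrow> real"
    using neq by simp
  have "measure_pmf.expectation P (\<lambda>b. B b u v * B b u v' * (B b u' v * B b u' v')) =
     measure_pmf.expectation P (\<lambda>b. \<Prod>e\<in>?E. f e (b e))"
    unfolding prod4 using V d by (simp add: B)
  also have "\<dots> = (\<Prod>e\<in>?E. measure_pmf.expectation (bernoulli_pmf (W (x (fst e)) (x (snd e)))) (f e))"
    unfolding P_def by (rule expectation_prod_components[OF finite_index_pairs ind])
  also have "\<dots> = D u v * D u v' * (D u' v * D u' v')" unfolding prod4 E ..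
  finally show ?thesis .
qed

context kernel_space
begin

text \<open>Off-diagonal products have expectation 0 by independence and centring; the
  \<open>card V\<close> diagonal ones are at most 1.\<close>

lemma integral_cube_square_sum:
  assumes V: "finite V" and \<xi> [measurable]: "\<xi> \<in> borel_measurable M" and \<xi>1: "\<And>x. \<bar>\<xi> x\<bar> \<le> 1" and \<xi>0: "(\<integral>x. \<xi> x \<partial>M) = 0"
  shows "(\<integral>x. (\<Sum>i\<in>V. \<xi> (x i))\<^sup>2 \<partial>cube V) \<le> card V"
proof -
  interpret C: prob_space "cube V" by (rule prob_space_cube)
  have prod1: "\<bar>\<xi> x * \<xi> y\<bar> \<le> 1" for x y unfolding abs_mult using \<xi>1 by (intro mult_le_one) auto
  have int: "integrable (cube V) (\<lambda>x. \<xi> (x i) * \<xi> (x j))" if "i \<in> V" "j \<in> V" for i j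
    using prod1 that by (intro C.integrable_const_bound[where B=1]) auto
  have "(\<integral>x. (\<Sum>i\<in>V. \<xi> (x i))\<^sup>2 \<partial>cube V) = (\<Sum>i\<in>V. \<Sum>j\<in>V. \<integral>x. \<xi> (x i) * \<xi> (x j) \<partial>cube V)"
    unfolding power2_eq_square sum_product using int by (simp add: Bochner_Integration.integral_sum)
  also have "\<dots> \<le> (\<Sum>i\<in>V. \<Sum>j\<in>V. if i = j then 1 else 0)"
  proof (intro sum_mono)
    fix i j assume ij: "i \<in> V" "j \<in> V"
    show "(\<integral>x. \<xi> (x i) * \<xi> (x j) \<partial>cube V) \<le> (if i = j then 1 else 0)"
    proof (cases "i = j")
      case True
      have "\<bar>\<integral>x. \<xi> (x i) * \<xi> (x j) \<partial>cube V\<bar> \<le> 1" using prod1 by (rule C.abs_integral_le)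
      with True show ?thesis by simp
    next
      case False
      have b: "bdd_fun (\<lambda>x y. \<xi> x * \<xi> y)"
        using \<xi>1 by (intro bdd_fun_mult bdd_fun_left[where B=1] bdd_fun_right[where B=1]) auto
      have "(\<integral>x. \<xi> (x i) * \<xi> (x j) \<partial>cube V) = avg (\<lambda>x y. \<xi> x * \<xi> y)"
        using False ij V b by (intro integral_cube_pair) auto
      also have "\<dots> = 0" by (subst avg_fst[OF b]) (simp add: \<xi>0)
      finally show ?thesis using False by simp
    qed
  qed
  also have "\<dots> = card V" using V by simp
  finally show ?thesis .
qed

lemma expected_label_deviation:
  fixes \<alpha> :: "'a \<Rightarrow> nat"
  assumes V: "finite V" "V \<noteq> {}" and \<alpha> [measurable]: "labelling \<alpha>"
  shows "integrable (cube V) (\<lambda>x. (prob {y\<in>space M. \<alpha> y = l} - card {i\<in>V. \<alpha> (x i) = l} / card V)\<^sup>2)"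
    "(\<integral>x. (prob {y\<in>space M. \<alpha> y = l} - card {i\<in>V. \<alpha> (x i) = l} / card V)\<^sup>2 \<partial>cube V) \<le> 1 / card V"
proof -
  interpret C: prob_space "cube V" by (rule prob_space_cube)
  define p where "p = prob {y\<in>space M. \<alpha> y = l}"
  define \<xi> where "\<xi> x = (if \<alpha> x = l then 1 else 0) - p" for x
  have N: "0 < card V" using V by (simp add: card_gt_0_iff)
  have [measurable]: "\<xi> \<in> borel_measurable M" unfolding \<xi>_def by measurable
  have p01: "0 \<le> p" "p \<le> 1" by (auto simp: p_def)
  have \<xi>1: "\<bar>\<xi> x\<bar> \<le> 1" for x using p01 by (auto simp: \<xi>_def)
  have "(\<integral>x. (if \<alpha> x = l then 1 else 0 :: real) \<partial>M) = (\<integral>x. indicator {y\<in>space M. \<alpha> y = l} x \<partial>M)"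
    by (intro Bochner_Integration.integral_cong) auto
  then have "(\<integral>x. (if \<alpha> x = l then 1 else 0 :: real) \<partial>M) = p" by (simp add: p_def)
  moreover have "integrable M (\<lambda>x. if \<alpha> x = l then 1 else 0 :: real)"
    by (intro integrable_const_bound[where B=1]) auto
  ultimately have \<xi>0: "(\<integral>x. \<xi> x \<partial>M) = 0" unfolding \<xi>_def by (simp add: prob_space)
  have eq: "(p - card {i\<in>V. \<alpha> (x i) = l} / card V)\<^sup>2 = (\<Sum>i\<in>V. \<xi> (x i))\<^sup>2 / (card V)\<^sup>2" for x
  proof -
    have "(\<Sum>i\<in>V. \<xi> (x i)) = card {i\<in>V. \<alpha> (x i) = l} - card V * p"
      unfolding \<xi>_def using V by (simp add: sum_subtractf flip: sum.inter_filter)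
    then have "(\<Sum>i\<in>V. \<xi> (x i)) = - (card V * (p - card {i\<in>V. \<alpha> (x i) = l} / card V))"
      using N by (simp add: right_diff_distrib)
    then show ?thesis using N by (simp add: power_mult_distrib)
  qed
  have "\<bar>\<Sum>i\<in>V. \<xi> (x i)\<bar> \<le> card V" for x
    using order_trans[OF sum_abs sum_bounded_above[of V "\<lambda>i. \<bar>\<xi> (x i)\<bar>" 1]] \<xi>1 by simp
  then have "integrable (cube V) (\<lambda>x. (\<Sum>i\<in>V. \<xi> (x i))\<^sup>2)"
    by (intro C.integrable_const_bound[where B="(card V)\<^sup>2"])
      (auto simp: power_mono simp flip: abs_le_square_iff)
  then show "integrable (cube V) (\<lambda>x. (prob {y\<in>space M. \<alpha> y = l} - card {i\<in>V. \<alpha> (x i) = l} / card V)\<^sup>2)"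
    unfolding p_def[symmetric] eq by simp
  have "(\<integral>x. (\<Sum>i\<in>V. \<xi> (x i))\<^sup>2 \<partial>cube V) / (card V)\<^sup>2 \<le> card V / (card V)\<^sup>2"
    by (intro divide_right_mono integral_cube_square_sum V \<xi>1 \<xi>0) auto
  then show "(\<integral>x. (prob {y\<in>space M. \<alpha> y = l} - card {i\<in>V. \<alpha> (x i) = l} / card V)\<^sup>2 \<partial>cube V) \<le> 1 / card V"
    unfolding p_def[symmetric] eq using N by (simp add: power2_eq_square)
qed

text \<open>Single out the edge from \<open>u\<close> to \<open>v\<close>. The two edges at
  \<open>v'\<close> do not involve \<open>v\<close>, and the remaining edge from \<open>u'\<close>
  to \<open>v\<close> does not involve \<open>u\<close>, so \<open>cut_bound_cube\<close>
  applies.\<close>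

lemma integral_c4_term:
  assumes V: "finite V" "u \<in> V" "u' \<in> V" "v \<in> V" "v' \<in> V" and d: "distinct [u, u', v, v']"
    and D: "bdd_fun D" "\<And>x y. \<bar>D x y\<bar> \<le> 1" "cut_bound D \<eta>"
  shows "integrable (cube V) (\<lambda>x. D (x u) (x v) * D (x u) (x v') * (D (x u') (x v) * D (x u') (x v')))"
    "(\<integral>x. D (x u) (x v) * D (x u) (x v') * (D (x u') (x v) * D (x u') (x v')) \<partial>cube V) \<le> \<eta>"
proof -
  interpret C: prob_space "cube V" by (rule prob_space_cube)
  have [measurable]: "measurable2 D" by (rule bdd_fun_measurable[OF D(1)])
  note [measurable] = V(2-5)
  have b2: "\<bar>D a b * D c e\<bar> \<le> 1" for a b c e unfolding abs_mult using D(2) by (intro mult_le_one) auto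
  have b4: "\<bar>D a b * D c e * (D a' b' * D c' e')\<bar> \<le> 1" for a b c e a' b' c' e'
    unfolding abs_mult[of "D a b * D c e"] using b2 by (intro mult_le_one) auto
  have "(\<lambda>x. D (x u) (x v) * D (x u) (x v') * (D (x u') (x v) * D (x u') (x v'))) \<in> borel_measurable (cube V)"
    by measurable
  then show "integrable (cube V) (\<lambda>x. D (x u) (x v) * D (x u) (x v') * (D (x u') (x v) * D (x u') (x v')))"
    using b4 by (intro C.integrable_const_bound[where B=1]) auto
  have "\<bar>\<integral>x. D (x u) (x v) * (D (x u) (x v') * D (x u') (x v')) * D (x u') (x v) \<partial>cube V\<bar> \<le> \<eta>"
    using V d b2 D by (intro cut_bound_cube) auto
  then show "(\<integral>x. D (x u) (x v) * D (x u) (x v') * (D (x u') (x v) * D (x u') (x v')) \<partial>cube V) \<le> \<eta>"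
    by (simp add: mult_ac)
qed

end

text \<open>Cut distance up to relabelling: \<open>\<phi>\<close> blows \<open>G\<close> up to a
  step function with one class of equal measure per vertex, and the choice of \<open>\<phi>\<close>
  plays the role of a measure preserving rearrangement.\<close>

definition near :: "real \<Rightarrow> ugraph \<Rightarrow> (real \<Rightarrow> real \<Rightarrow> real) \<Rightarrow> bool" where
  "near c G W \<longleftrightarrow> (\<exists>\<phi>\<in>unif \<rightarrow>\<^sub>M count_space UNIV. (\<forall>x. \<phi> x \<in> fst G) \<and>
     (\<forall>v\<in>fst G. U.prob {x\<in>space unif. \<phi> x = v} = 1 / card (fst G)) \<and>
     U.cut_bound (\<lambda>x y. W x y - adj G (\<phi> x) (\<phi> y)) c)"

text \<open>Three steps: \<open>W\<close> is close to its step approximation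
  (\<open>\<eta>\<close>); replacing \<open>\<alpha>\<close> by the labels of assigned vertices
  matters only where one of two points is mismatched (\<open>2 * \<tau>\<close>); the step function
  is close to \<open>G\<close> by the 4-cycle bound (\<open>\<delta>\<close>).\<close>

lemma near_sampleI:
  fixes \<alpha> :: "real \<Rightarrow> nat"
  assumes W: "U.kernel W" and \<alpha>: "U.labelling \<alpha>" "\<And>x. \<alpha> x < K"
    and w: "\<And>i j. 0 \<le> w i j" "\<And>i j. w i j \<le> 1" and cut: "U.cut_bound (\<lambda>x y. W x y - w (\<alpha> x) (\<alpha> y)) \<eta>"
    and V: "finite (fst G)" "fst G \<noteq> {}" and lab: "\<And>v. v \<in> fst G \<Longrightarrow> lab v < K"
    and c4: "c4_sum (fst G) (\<lambda>u v. adj G u v - w (lab u) (lab v)) \<le> real (card (fst G)) ^ 4 * \<delta> ^ 4" and \<delta>: "0 \<le> \<delta>"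
    and count: "(\<Sum>l<K. \<bar>U.prob {x\<in>space unif. \<alpha> x = l} - card {v\<in>fst G. lab v = l} / card (fst G)\<bar>) \<le> \<tau>"
  shows "near (\<eta> + 2 * \<tau> + \<delta>) G W"
proof -
  note [measurable] = \<alpha>(1)
  obtain \<phi> where \<phi> [measurable]: "U.labelling \<phi>" and \<phi>V: "\<And>x. \<phi> x \<in> fst G"
    and mass: "\<And>v. v \<in> fst G \<Longrightarrow> U.prob {x\<in>space unif. \<phi> x = v} = 1 / card (fst G)"
    and mis: "U.prob {x\<in>space unif. lab (\<phi> x) \<noteq> \<alpha> x} \<le> \<tau>"
    by (rule U.equipartition_matching_labels[OF \<alpha> V lab count], assumption) (rule that)
  define L where "L x = lab (\<phi> x)" for x
  have [measurable]: "U.labelling L"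
    unfolding L_def by (rule measurable_compose[OF \<phi>]) simp
  define h where "h x = (if L x = \<alpha> x then 0 else 1 :: real)" for x
  have pm [measurable]: "Measurable.pred unif (\<lambda>x. \<exists>l. L x = l \<and> \<alpha> x = l)" by measurable
  have h_eq: "h = (\<lambda>x. if (\<exists>l. L x = l \<and> \<alpha> x = l) then 0 else 1)" by (auto simp: h_def fun_eq_iff)
  have hm [measurable]: "h \<in> borel_measurable unif" unfolding h_eq by measurable
  have "(\<integral>x. h x \<partial>unif) = (\<integral>x. indicator {x\<in>space unif. lab (\<phi> x) \<noteq> \<alpha> x} x \<partial>unif)"
    by (intro Bochner_Integration.integral_cong) (auto simp: h_def L_def)
  also have "\<dots> = U.prob {x\<in>space unif. lab (\<phi> x) \<noteq> \<alpha> x}"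
    by (subst Bochner_Integration.integral_indicator) (auto simp: Int_def intro!: arg_cong[of _ _ "measure unif"])
  finally have h\<tau>: "(\<integral>x. h x \<partial>unif) \<le> \<tau>" using mis by simp
  have w1: "\<bar>w i j\<bar> \<le> 1" for i j using w[of i j] by auto
  have adj1: "\<bar>adj G u v\<bar> \<le> 1" for u v using adj_simps[of G u v] by auto
  have B1: "\<bar>adj G u v - w i j\<bar> \<le> 1" for u v i j using w[of i j] adj_simps(2,3)[of G u v] by auto
  have b: "U.bdd_fun W" "U.bdd_fun (\<lambda>x y. w (\<alpha> x) (\<alpha> y))" "U.bdd_fun (\<lambda>x y. w (L x) (L y))"
    "U.bdd_fun (\<lambda>x y. adj G (\<phi> x) (\<phi> y))" "U.bdd_fun (\<lambda>x y. h x)" "U.bdd_fun (\<lambda>x y. h y)"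
    by (rule U.bdd_fun_kernel[OF W] U.bdd_fun_label[where B=1] U.bdd_fun_left[where B=1] U.bdd_fun_right[where B=1];
        simp add: w1 adj1 h_def \<alpha>(1) hm[unfolded h_def])+
  have "U.avg (\<lambda>x y. \<bar>w (\<alpha> x) (\<alpha> y) - w (L x) (L y)\<bar>) \<le> U.avg (\<lambda>x y. h x + h y)"
  proof (rule U.avg_mono)
    fix x y
    show "\<bar>w (\<alpha> x) (\<alpha> y) - w (L x) (L y)\<bar> \<le> h x + h y"
      using w[of "\<alpha> x" "\<alpha> y"] w[of "L x" "L y"] by (auto simp: h_def)
  qed (intro U.bdd_fun_abs U.bdd_fun_diff U.bdd_fun_add b)+
  also have "\<dots> = U.avg (\<lambda>x y. h x) + U.avg (\<lambda>x y. h y)" by (rule U.avg_add[OF b(5,6)])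
  also have "U.avg (\<lambda>x y. h y) = U.avg (\<lambda>x y. h x)" by (rule U.avg_swap[OF b(5)])
  also have "U.avg (\<lambda>x y. h x) = (\<integral>x. h x \<partial>unif)"
    by (subst U.avg_fst[OF b(5)]) (simp add: U.prob_space[unfolded space_restrict_space, simplified])
  also have "\<dots> + \<dots> \<le> 2 * \<tau>" using h\<tau> by simp
  finally have step: "U.cut_bound (\<lambda>x y. w (\<alpha> x) (\<alpha> y) - w (L x) (L y)) (2 * \<tau>)"
    by (rule U.cut_bound_mono[OF U.cut_bound_avg_abs[OF U.bdd_fun_diff[OF b(2,3)]]])
  have "U.cut_bound (\<lambda>x y. adj G (\<phi> x) (\<phi> y) - w (L x) (L y)) \<delta>"
    unfolding L_def
    by (rule U.cut_bound_of_c4_sum[where B="\<lambda>u v. adj G u v - w (lab u) (lab v)", OF \<phi> V \<phi>V mass B1 c4 \<delta>])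
  then have "U.cut_bound (\<lambda>x y. w (L x) (L y) - adj G (\<phi> x) (\<phi> y)) \<delta>" by (rule U.cut_bound_minus)
  then have "U.cut_bound (\<lambda>x y. W x y - adj G (\<phi> x) (\<phi> y)) (\<eta> + 2 * \<tau> + \<delta>)"
    by (intro U.cut_bound_trans[OF U.cut_bound_trans[OF cut step]] b)
  with \<phi>V mass show ?thesis unfolding near_def by (intro bexI[OF _ \<phi>]) blast
qed

subsection \<open>Sampling\<close>

abbreviation sum4 :: "nat set \<Rightarrow> (nat \<Rightarrow> nat \<Rightarrow> nat \<Rightarrow> nat \<Rightarrow> real) \<Rightarrow> real" where
  "sum4 V F \<equiv> \<Sum>v\<in>V. \<Sum>v'\<in>V. \<Sum>u\<in>V. \<Sum>u'\<in>V. F u u' v v'"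

text \<open>Four indices form six pairs. The value is at least 1 unless all indices are distinct,
  and each summand leaves three free indices, whence the bound \<open>6 * real N ^ 3\<close> for
  degenerate terms.\<close>

abbreviation coincidences :: "nat \<Rightarrow> nat \<Rightarrow> nat \<Rightarrow> nat \<Rightarrow> real" where
  "coincidences u u' v v' \<equiv> of_bool (v = v') + of_bool (u = u') + of_bool (u = v) + of_bool (u = v') + of_bool (u' = v) + of_bool (u' = v')"

lemma sum4_coincidences:
  fixes V :: "nat set"
  assumes "finite V"
  shows "sum4 V (\<lambda>u u' v v'. coincidences u u' v v') = 6 * real (card V) ^ 3"
proof -
  have 1: "(\<Sum>b\<in>V. of_bool (a = b)) = (1 :: real)" "(\<Sum>b\<in>V. of_bool (b = a)) = (1 :: real)" if "a \<in> V" for a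
    using assms that by (simp_all add: of_bool_def)
  show ?thesis
    by (simp add: sum.distrib 1 sum_distrib_left[symmetric] power3_eq_cube cong: sum.cong)
qed

text \<open>Conditionally on the points, a nondegenerate term is a product of four residuals, with
  integral at most \<open>\<eta>\<close>; degenerate terms are bounded by 1. The majorant
  \<open>\<Psi>\<close> is an explicit finite sum, so integrability over the points is checked for
  it.\<close>

lemma expected_c4_sum:
  fixes \<alpha> :: "real \<Rightarrow> nat"
  assumes W: "U.kernel W" and \<alpha> [measurable]: "U.labelling \<alpha>"
    and w: "\<And>i j. w i j = w j i" "\<And>i j. 0 \<le> w i j" "\<And>i j. w i j \<le> (1 :: real)"
    and cut: "U.cut_bound (\<lambda>x y. W x y - w (\<alpha> x) (\<alpha> y)) \<eta>"
  obtains \<Psi> where "integrable (U.cube {1..N}) \<Psi>" "(\<integral>x. \<Psi> x \<partial>U.cube {1..N}) \<le> real N ^ 4 * \<eta> + 6 * real N ^ 3"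
    "\<And>x. measure_pmf.expectation (edge_pmf N W x)
       (\<lambda>b. c4_sum {1..N} (\<lambda>u v. adj (pattern_graph N b) u v - w (\<alpha> (x u)) (\<alpha> (x v)))) \<le> \<Psi> x"
proof -
  interpret C: prob_space "U.cube {1..N}" by (rule U.prob_space_cube)
  let ?V = "{1..N}"
  define D where "D x y = W x y - w (\<alpha> x) (\<alpha> y)" for x y
  have D: "U.bdd_fun D" "\<And>x y. \<bar>D x y\<bar> \<le> 1" "U.cut_bound D \<eta>"
  proof -
    show "U.bdd_fun D" unfolding D_def
      by (rule U.bdd_fun_diff[OF U.bdd_fun_kernel[OF W] U.bdd_fun_label[OF \<alpha>, where B=1]]) (simp add: w)
    show "\<bar>D x y\<bar> \<le> 1" for x y
      unfolding D_def using w(2,3)[of "\<alpha> x" "\<alpha> y"] U.kernel_bounds[OF W, of x y] by auto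
    show "U.cut_bound D \<eta>" unfolding D_def by (rule cut)
  qed
  define X where "X u u' v v' x = D (x u) (x v) * D (x u) (x v') * (D (x u') (x v) * D (x u') (x v'))" for u u' v v' and x :: "nat \<Rightarrow> real"
  define Y where "Y u u' v v' x = (if distinct [u, u', v, v'] then X u u' v v' x else 0)" for u u' v v' and x :: "nat \<Rightarrow> real"
  define \<Psi> where "\<Psi> x = sum4 ?V (\<lambda>u u' v v'. Y u u' v v' x) + 6 * real N ^ 3" for x
  have \<eta>: "0 \<le> \<eta>" by (rule U.cut_bound_nonneg[OF cut])
  have Y: "integrable (U.cube ?V) (Y u u' v v')" "(\<integral>x. Y u u' v v' x \<partial>U.cube ?V) \<le> \<eta>"
    if "u \<in> ?V" "u' \<in> ?V" "v \<in> ?V" "v' \<in> ?V" for u u' v v'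
  proof -
    have "integrable (U.cube ?V) (Y u u' v v') \<and> (\<integral>x. Y u u' v v' x \<partial>U.cube ?V) \<le> \<eta>"
    proof (cases "distinct [u, u', v, v']")
      case True
      then show ?thesis
        using U.integral_c4_term[OF _ that True D] by (simp add: Y_def[abs_def] X_def[abs_def])
    next
      case False
      then have "Y u u' v v' = (\<lambda>x. 0)" by (auto simp: Y_def)
      then show ?thesis using \<eta> by simp
    qed
    then show "integrable (U.cube ?V) (Y u u' v v')" "(\<integral>x. Y u u' v v' x \<partial>U.cube ?V) \<le> \<eta>" by auto
  qed
  show thesis
  proof
    show int: "integrable (U.cube ?V) \<Psi>"
      unfolding \<Psi>_def by (intro Bochner_Integration.integrable_add Bochner_Integration.integrable_sum Y C.integrable_const)
    have "(\<integral>x. \<Psi> x \<partial>U.cube ?V) = (\<integral>x. sum4 ?V (\<lambda>u u' v v'. Y u u' v v' x) \<partial>U.cube ?V) + (\<integral>x. 6 * real N ^ 3 \<partial>U.cube ?V)"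
      unfolding \<Psi>_def by (intro Bochner_Integration.integral_add Bochner_Integration.integrable_sum Y C.integrable_const)
    also have "(\<integral>x. sum4 ?V (\<lambda>u u' v v'. Y u u' v v' x) \<partial>U.cube ?V) =
        sum4 ?V (\<lambda>u u' v v'. (\<integral>x. Y u u' v v' x \<partial>U.cube ?V))"
      by (subst Bochner_Integration.integral_sum; (intro Bochner_Integration.integrable_sum Y sum.cong refl)?; assumption?)+
    also have "\<dots> \<le> sum4 ?V (\<lambda>u u' v v'. \<eta>)"
      by (intro sum_mono Y)
    also have "\<dots> = real N ^ 4 * \<eta>" by (simp add: power4_eq_xxxx)
    also have "(\<integral>x. 6 * real N ^ 3 \<partial>U.cube ?V) = 6 * real N ^ 3"
      by (simp only: lebesgue_integral_const C.prob_space scaleR_one)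
    finally show "(\<integral>x. \<Psi> x \<partial>U.cube ?V) \<le> real N ^ 4 * \<eta> + 6 * real N ^ 3" by simp
    fix x
    let ?P = "edge_pmf N W x"
    define B where "B b u v = adj (pattern_graph N b) u v - w (\<alpha> (x u)) (\<alpha> (x v))" for b u v
    note fin = finite_set_Pi_pmf_patterns[of N "\<lambda>e. bernoulli_pmf (W (x (fst e)) (x (snd e)))"]
    have B1: "\<bar>B b u v\<bar> \<le> 1" for b u v
      unfolding B_def using w(2,3)[of "\<alpha> (x u)" "\<alpha> (x v)"] adj_simps(2,3)[of "pattern_graph N b" u v] by auto
    have b2: "\<bar>B b u v * B b u' v'\<bar> \<le> 1" for b u v u' v' unfolding abs_mult using B1 by (intro mult_le_one) auto
    have b4: "B b u v * B b u v' * (B b u' v * B b u' v') \<le> 1" for b u v u' v'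
    proof -
      have "\<bar>B b u v * B b u v' * (B b u' v * B b u' v')\<bar> \<le> 1"
        unfolding abs_mult[of "B b u v * B b u v'"] using b2 by (intro mult_le_one) auto
      then show ?thesis by simp
    qed
    have term_le: "measure_pmf.expectation ?P (\<lambda>b. B b u v * B b u v' * (B b u' v * B b u' v')) \<le> Y u u' v v' x +
       coincidences u u' v v'"
      if "u \<in> ?V" "u' \<in> ?V" "v \<in> ?V" "v' \<in> ?V" for u u' v v'
    proof (cases "distinct [u, u', v, v']")
      case True
      have "measure_pmf.expectation ?P (\<lambda>b. B b u v * B b u v' * (B b u' v * B b u' v')) = X u u' v v' x"
        unfolding B_def X_def D_def using w(1) by (intro expectation_c4_term[OF W _ that True]) simp
      then show ?thesis using True by (simp add: Y_def)
    next
      case False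
      have "measure_pmf.expectation ?P (\<lambda>b. B b u v * B b u v' * (B b u' v * B b u' v')) \<le> measure_pmf.expectation ?P (\<lambda>b. 1)"
        using b4 by (intro integral_mono integrable_measure_pmf_finite fin) auto
      also have "\<dots> \<le> Y u u' v v' x +
         coincidences u u' v v'"
        using False by (auto simp: Y_def)
      finally show ?thesis .
    qed
    have "measure_pmf.expectation ?P (\<lambda>b. c4_sum ?V (B b)) =
      sum4 ?V (\<lambda>u u' v v'. measure_pmf.expectation ?P (\<lambda>b. B b u v * B b u v' * (B b u' v * B b u' v')))"
      unfolding c4_sum_expand by (simp add: Bochner_Integration.integral_sum integrable_measure_pmf_finite fin)
    also have "\<dots> \<le> sum4 ?V (\<lambda>u u' v v'. Y u u' v v' x +
       coincidences u u' v v')"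
      by (intro sum_mono term_le)
    also have "\<dots> = sum4 ?V (\<lambda>u u' v v'. Y u u' v v' x) +
       sum4 ?V (\<lambda>u u' v v'. coincidences u u' v v')"
      unfolding sum.distrib[symmetric] ..
    also have "\<dots> = \<Psi> x" unfolding \<Psi>_def using sum4_coincidences[of ?V] by simp
    finally show "measure_pmf.expectation ?P (\<lambda>b. c4_sum ?V (\<lambda>u v. adj (pattern_graph N b) u v - w (\<alpha> (x u)) (\<alpha> (x v)))) \<le> \<Psi> x"
      unfolding B_def .
  qed
qed

lemma near_mono: "near c G W \<Longrightarrow> c \<le> d \<Longrightarrow> near d G W"
  unfolding near_def using U.cut_bound_mono by blast

text \<open>The fourth moment of the cut norm, unlike the cut norm itself, is a polynomial in the edges of the
  sample, so that its expectation can be computed; Markov's inequality then replaces concentration.\<close>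

theorem sampling:
  assumes c: "0 < c"
  obtains N0 where "1 \<le> N0"
    "\<And>N W. N0 \<le> N \<Longrightarrow> U.kernel W \<Longrightarrow> measure (random_graph N W) {G. \<not> near c G W} < 1/3"
proof -
  \<comment> \<open>These choices give \<open>\<eta> + 2 * \<tau> + \<delta> \<le> c\<close> for
    nearness. In the failure probability, \<open>\<eta> / \<delta> ^ 4\<close> is at most 1/12, and
    the two terms of \<open>N0\<close> push the contributions of degenerate 4-cycles and of label
    frequencies below 1/12 each.\<close>
  define \<delta> where "\<delta> = c / 4"
  define \<tau> where "\<tau> = c / 8"
  define \<eta> where "\<eta> = min (c / 4) (\<delta> ^ 4 / 12)"
  have pos: "0 < \<delta>" "0 < \<tau>" "0 < \<eta>" "\<eta> \<le> c / 4" "\<eta> \<le> \<delta> ^ 4 / 12" using c by (auto simp: \<delta>_def \<tau>_def \<eta>_def)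
  obtain K where K: "0 < K" "\<And>W W'. U.kernel W \<Longrightarrow> U.kernel W' \<Longrightarrow> \<exists>\<alpha> w w'. U.regular_pair \<eta> K W W' \<alpha> w w'"
    using U.weak_regularity[OF pos(3)] by blast
  obtain N0 :: nat where N0: "max (72 / \<delta> ^ 4) (12 * (real K * real K) / \<tau>\<^sup>2) < N0" using reals_Archimedean2 by blast
  have "measure (random_graph N W) {G. \<not> near c G W} < 1/3" if N: "max 1 N0 \<le> N" and W: "U.kernel W" for N W
  proof -
    let ?V = "{1..N}"
    have N1: "0 < real N" using N by simp
    obtain \<alpha> w w' where reg: "U.regular_pair \<eta> K W W \<alpha> w w'" using K(2)[OF W W] by blast
    have \<alpha> [measurable]: "U.labelling \<alpha>" and \<alpha>K: "\<And>x. \<alpha> x < K"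
      and w: "\<And>i j. w i j = w j i" "\<And>i j. 0 \<le> w i j" "\<And>i j. w i j \<le> 1"
      using reg unfolding U.regular_pair_def by simp_all
    have cut: "U.cut_bound (\<lambda>x y. W x y - w (\<alpha> x) (\<alpha> y)) \<eta>"
      using reg unfolding U.regular_pair_def by (elim conjE allE[of _ "\<lambda>_ _. 1"]) simp
    obtain \<Psi> where \<Psi>: "integrable (U.cube ?V) \<Psi>" "(\<integral>x. \<Psi> x \<partial>U.cube ?V) \<le> real N ^ 4 * \<eta> + 6 * real N ^ 3"
      "\<And>x. measure_pmf.expectation (edge_pmf N W x)
         (\<lambda>b. c4_sum ?V (\<lambda>u v. adj (pattern_graph N b) u v - w (\<alpha> (x u)) (\<alpha> (x v)))) \<le> \<Psi> x"
      by (rule expected_c4_sum[OF W \<alpha> w cut]) (rule that)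
    define d where "d x l = U.prob {y\<in>space unif. \<alpha> y = l} - card {i\<in>?V. \<alpha> (x i) = l} / card ?V" for x l
    \<comment> \<open>By Cauchy-Schwarz over the \<open>K\<close> labels, \<open>q x \<le> 1\<close>
      forces the total deviation of the label frequencies to be at most
      \<open>\<tau>\<close>.\<close>
    define q where "q x = K / \<tau>\<^sup>2 * (\<Sum>l<K. (d x l)\<^sup>2)" for x
    have dev: "integrable (U.cube ?V) (\<lambda>x. (d x l)\<^sup>2)" "(\<integral>x. (d x l)\<^sup>2 \<partial>U.cube ?V) \<le> 1 / real N" for l
      unfolding d_def using U.expected_label_deviation[of ?V \<alpha> l] N by auto
    have q_int: "integrable (U.cube ?V) q" unfolding q_def using dev(1) by (intro Bochner_Integration.integrable_mult_right Bochner_Integration.integrable_sum)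
    have q_le: "(\<integral>x. q x \<partial>U.cube ?V) \<le> K / \<tau>\<^sup>2 * (K / N)"
    proof -
      have "(\<integral>x. q x \<partial>U.cube ?V) = K / \<tau>\<^sup>2 * (\<Sum>l<K. \<integral>x. (d x l)\<^sup>2 \<partial>U.cube ?V)"
        unfolding q_def using dev(1) by simp
      also have "\<dots> \<le> K / \<tau>\<^sup>2 * (\<Sum>l<K. 1 / real N)" by (intro mult_left_mono sum_mono dev) auto
      finally show ?thesis by simp
    qed
    let ?M = "real N ^ 4 * \<delta> ^ 4"
    have M: "0 < ?M" using N1 pos by simp
    have bad: "measure_pmf.prob (edge_choice_pmf N W x) {G. \<not> near c G W} \<le> \<Psi> x / ?M + q x" for x
    proof -
      let ?P = "edge_pmf N W x"
      let ?c4 = "\<lambda>b. c4_sum ?V (\<lambda>u v. adj (pattern_graph N b) u v - w (\<alpha> (x u)) (\<alpha> (x v)))"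
      have q0: "0 \<le> q x" unfolding q_def by (intro mult_nonneg_nonneg sum_nonneg) auto
      \<comment> \<open>Markov's inequality for both failure modes at once: if the sum is below 1,
        both summands are, and \<open>near_sampleI\<close> applies.\<close>
      have ge1: "1 \<le> ?c4 b / ?M + q x" if "\<not> near c (pattern_graph N b) W" for b
      proof (rule ccontr)
        assume less: "\<not> 1 \<le> ?c4 b / ?M + q x"
        then have "?c4 b / ?M < 1" using q0 by simp
        then have 1: "?c4 b \<le> ?M" using M by simp
        have "0 \<le> ?c4 b / ?M" using c4_sum_nonneg M by (intro divide_nonneg_pos) auto
        then have "q x \<le> 1" using less by simp
        then have "K * (\<Sum>l<K. (d x l)\<^sup>2) \<le> \<tau>\<^sup>2" using pos by (simp add: q_def field_simps)
        moreover have "(\<Sum>l<K. \<bar>d x l\<bar>)\<^sup>2 \<le> K * (\<Sum>l<K. (d x l)\<^sup>2)"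
          using sum_squared_le_sum_of_squares[of "\<lambda>l. \<bar>d x l\<bar>" "{..<K}"]
          by (simp only: power2_abs card_lessThan mult.commute[of _ "real K"])
        ultimately have "(\<Sum>l<K. \<bar>d x l\<bar>)\<^sup>2 \<le> \<tau>\<^sup>2" by (rule order_trans[rotated])
        then have 2: "(\<Sum>l<K. \<bar>d x l\<bar>) \<le> \<tau>" by (rule power2_le_imp_le) (simp add: pos(2) less_imp_le)
        have "near (\<eta> + 2 * \<tau> + \<delta>) (pattern_graph N b) W"
        proof (rule near_sampleI[OF W \<alpha> \<alpha>K w(2,3) cut, where lab="\<lambda>i. \<alpha> (x i)"], unfold pattern_graph_simple)
          show "c4_sum ?V (\<lambda>u v. adj (pattern_graph N b) u v - w (\<alpha> (x u)) (\<alpha> (x v))) \<le> real (card ?V) ^ 4 * \<delta> ^ 4"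
            using 1 by simp
        qed (use N pos 2 \<alpha>K in \<open>simp_all add: d_def\<close>)
        then have "near c (pattern_graph N b) W"
          by (rule near_mono) (use pos in \<open>auto simp: \<tau>_def \<delta>_def\<close>)
        with that show False by blast
      qed
      note fin = finite_set_Pi_pmf_patterns[of N "\<lambda>e. bernoulli_pmf (W (x (fst e)) (x (snd e)))"]
      have "measure_pmf.prob (edge_choice_pmf N W x) {G. \<not> near c G W} =
          measure_pmf.expectation ?P (indicator {b. \<not> near c (pattern_graph N b) W})"
        unfolding edge_choice_pmf_eq by (simp add: vimage_def)
      also have "\<dots> \<le> measure_pmf.expectation ?P (\<lambda>b. ?c4 b / ?M + q x)"
      proof (intro integral_mono integrable_measure_pmf_finite fin)
        fix b
        have "0 \<le> ?c4 b / ?M" using c4_sum_nonneg M by (intro divide_nonneg_pos) auto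
        then show "indicator {b. \<not> near c (pattern_graph N b) W} b \<le> ?c4 b / ?M + q x"
          using ge1[of b] q0 by (auto simp: indicator_def)
      qed
      also have "\<dots> = measure_pmf.expectation ?P ?c4 / ?M + q x"
        by (subst Bochner_Integration.integral_add) (auto simp: integrable_measure_pmf_finite fin)
      also have "\<dots> \<le> \<Psi> x / ?M + q x" using \<Psi>(3)[of x] M by (intro add_right_mono divide_right_mono) auto
      finally show ?thesis .
    qed
    have "measure (random_graph N W) {G. \<not> near c G W} = (\<integral>x. measure_pmf.prob (edge_choice_pmf N W x) {G. \<not> near c G W} \<partial>U.cube ?V)"
      by (intro random_graph_prob_integral W) simp
    also have "\<dots> \<le> (\<integral>x. \<Psi> x / ?M + q x \<partial>U.cube ?V)"
    proof (intro integral_mono bad)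
      interpret C: prob_space "U.cube ?V" by (rule U.prob_space_cube)
      show "integrable (U.cube ?V) (\<lambda>x. measure_pmf.prob (edge_choice_pmf N W x) {G. \<not> near c G W})"
        using edge_choice_prob_measurable[OF W] by (intro C.integrable_const_bound[where B=1]) auto
      show "integrable (U.cube ?V) (\<lambda>x. \<Psi> x / ?M + q x)"
        using \<Psi>(1) q_int by (intro Bochner_Integration.integrable_add) auto
    qed
    also have "\<dots> = (\<integral>x. \<Psi> x \<partial>U.cube ?V) / ?M + (\<integral>x. q x \<partial>U.cube ?V)"
      using \<Psi>(1) q_int by (subst Bochner_Integration.integral_add) auto
    also have "\<dots> \<le> (real N ^ 4 * \<eta> + 6 * real N ^ 3) / ?M + K / \<tau>\<^sup>2 * (K / N)"
      using \<Psi>(2) q_le M by (intro add_mono divide_right_mono) auto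
    also have "(real N ^ 4 * \<eta> + 6 * real N ^ 3) / ?M = \<eta> / \<delta> ^ 4 + 6 / (N * \<delta> ^ 4)"
      using N1 pos by (simp add: add_divide_distrib power4_eq_xxxx power3_eq_cube)
    also have "\<eta> / \<delta> ^ 4 \<le> 1 / 12" using pos by (simp add: divide_le_eq)
    also have "6 / (N * \<delta> ^ 4) < 1 / 12"
    proof -
      have "72 / \<delta> ^ 4 < real N" using N0 N by simp
      then show ?thesis using N1 pos by (simp add: field_simps)
    qed
    also have "K / \<tau>\<^sup>2 * (K / N) < 1 / 12"
    proof -
      have "12 * (real K * real K) / \<tau>\<^sup>2 < real N" using N0 N by simp
      then show ?thesis using N1 pos by (simp add: field_simps)
    qed
    finally show ?thesis by simp
  qed
  then show thesis by (intro that[of "max 1 N0"]) auto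
qed

subsection \<open>The distance to a testable property\<close>

lemma hom_density_pattern_graph:
  assumes W: "U.kernel W'" "ae_eq W W'"
    and A: "A \<subseteq> index_pairs k"
  shows "hom_density (pattern_graph k (\<lambda>e. e \<in> A)) W = (\<integral>x. (\<Prod>e\<in>A. W' (x (fst e)) (x (snd e))) \<partial>U.cube {1..k})"
proof -
  have pairs: "{(i, j). i < j \<and> {i, j} \<in> snd (pattern_graph k (\<lambda>e. e \<in> A))} = A"
  proof (intro set_eqI, clarify, intro iffI)
    fix i j assume "(i, j) \<in> {(i, j). i < j \<and> {i, j} \<in> snd (pattern_graph k (\<lambda>e. e \<in> A))}"
    then obtain a b where "i < j" "a < b" "(a, b) \<in> A" "{i, j} = {a, b}"
      by (auto simp: pattern_graph_def)
    then show "(i, j) \<in> A" by (auto simp: doubleton_eq_iff)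
  next
    fix i j assume ij: "(i, j) \<in> A"
    then have "1 \<le> i" "i < j" "j \<le> k" using A by (auto simp: index_pairs_def)
    then show "(i, j) \<in> {(i, j). i < j \<and> {i, j} \<in> snd (pattern_graph k (\<lambda>e. e \<in> A))}"
      using ij by (auto simp: pattern_graph_def)
  qed
  have meas: "(\<lambda>x. \<Prod>e\<in>A. W' (x (fst e)) (x (snd e))) \<in> borel_measurable (U.cube {1..k})"
    using A by (intro borel_measurable_prod U.edge_measurable U.bdd_fun_kernel W) auto
  note U.AE_edges[OF W(2), of k]
  then have eq: "AE x in U.cube {1..k}. (\<Prod>e\<in>A. W (x (fst e)) (x (snd e))) = (\<Prod>e\<in>A. W' (x (fst e)) (x (snd e)))"
    by eventually_elim (use A in \<open>auto intro!: prod.cong\<close>)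
  have "hom_density (pattern_graph k (\<lambda>e. e \<in> A)) W = (\<integral>x. (\<Prod>e\<in>A. W (x (fst e)) (x (snd e))) \<partial>unit_cube {1..k})"
    unfolding hom_density_def pairs pattern_graph_simple by (simp add: case_prod_unfold)
  also have "\<dots> = (\<integral>x. (\<Prod>e\<in>A. W' (x (fst e)) (x (snd e))) \<partial>unit_cube {1..k})"
    unfolding unit_cube_def
    by (intro integral_cong_AE borel_measurable_completion_AE[OF meas eq] measurable_completion meas AE_completion eq)
  also have "\<dots> = (\<integral>x. (\<Prod>e\<in>A. W' (x (fst e)) (x (snd e))) \<partial>U.cube {1..k})"
    unfolding unit_cube_def by (intro integral_completion meas)
  finally show ?thesis .
qed

text \<open>Inclusion-exclusion: removing the factors \<open>1 - W\<close> one at a time reduces a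
  pattern probability to homomorphism densities, on which isomorphic graphons agree.\<close>

lemma random_graph_iso_eq:
  assumes gr: "V \<in> graphons" "W \<in> graphons" and iso: "graphon_iso V W"
  shows "measure (random_graph k V) S = measure (random_graph k W) S"
proof -
  obtain V' where V: "U.kernel V'" "ae_eq V V'"
    using graphon_kernel[OF gr(1)] .
  obtain W' where W: "U.kernel W'" "ae_eq W W'"
    using graphon_kernel[OF gr(2)] .
  interpret C: prob_space "U.cube {1..k}" by (rule U.prob_space_cube)
  define F where "F X A B x = (\<Prod>e\<in>A. X (x (fst e)) (x (snd e))) * (\<Prod>e\<in>B. 1 - X (x (fst e)) (x (snd e)))"
    for X :: "real \<Rightarrow> real \<Rightarrow> real" and A B :: "(nat \<times> nat) set" and x :: "nat \<Rightarrow> real"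
  have int: "integrable (U.cube {1..k}) (F X A B)" if X: "U.kernel X" and AB: "A \<subseteq> index_pairs k" "B \<subseteq> index_pairs k" for X A B
  proof (rule C.integrable_const_bound[where B=1])
    have "0 \<le> (\<Prod>e\<in>A. X (x (fst e)) (x (snd e)))" "(\<Prod>e\<in>A. X (x (fst e)) (x (snd e))) \<le> 1"
       "0 \<le> (\<Prod>e\<in>B. 1 - X (x (fst e)) (x (snd e)))" "(\<Prod>e\<in>B. 1 - X (x (fst e)) (x (snd e))) \<le> 1" for x
      using U.kernel_bounds[OF X] by (auto intro!: prod_nonneg prod_le_1)
    then show "AE x in U.cube {1..k}. norm (F X A B x) \<le> 1"
      unfolding F_def by (intro AE_I2) (auto simp: abs_mult intro!: mult_le_one)
    have "(\<lambda>x. X (x (fst e)) (x (snd e))) \<in> borel_measurable (U.cube {1..k})" if "e \<in> index_pairs k" for e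
      by (rule U.edge_measurable[OF U.bdd_fun_kernel[OF X] that])
    then show "F X A B \<in> borel_measurable (U.cube {1..k})"
      unfolding F_def[abs_def] using AB
      by (intro borel_measurable_times borel_measurable_prod borel_measurable_diff borel_measurable_const) auto
  qed
  have eq: "(\<integral>x. F V' A B x \<partial>U.cube {1..k}) = (\<integral>x. F W' A B x \<partial>U.cube {1..k})"
    if "finite B" "A \<subseteq> index_pairs k" "B \<subseteq> index_pairs k" "A \<inter> B = {}" for A B
    using that
  proof (induction B arbitrary: A rule: finite_induct)
    case empty
    then show ?case
      using hom_density_pattern_graph[OF V, of A k] hom_density_pattern_graph[OF W, of A k]
        iso[unfolded graphon_iso_def, rule_format, OF pattern_graph_simple(1)[of k "\<lambda>e. e \<in> A"]]
      unfolding F_def by simp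
  next
    case (insert e B)
    have sub: "A \<subseteq> index_pairs k" "B \<subseteq> index_pairs k" "insert e A \<subseteq> index_pairs k" "e \<notin> A" "A \<inter> B = {}" "insert e A \<inter> B = {}"
      using insert.prems insert.hyps by auto
    have finA: "finite A" using sub(1) finite_index_pairs by (rule finite_subset)
    have step: "F X A (insert e B) x = F X A B x - F X (insert e A) B x" for X x
      unfolding F_def using insert.hyps sub(4) finA by (simp add: algebra_simps)
    have "(\<integral>x. F X A (insert e B) x \<partial>U.cube {1..k}) = (\<integral>x. F X A B x \<partial>U.cube {1..k}) - (\<integral>x. F X (insert e A) B x \<partial>U.cube {1..k})"
      if "U.kernel X" for X
      unfolding step using sub by (intro Bochner_Integration.integral_diff int that)
    then show ?case using insert.IH[OF sub(1,2,5)] insert.IH[OF sub(3,2,6)] V(1) W(1) by simp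
  qed
  have pp: "U.pattern_prob k X b = (\<integral>x. F X {e\<in>index_pairs k. b e} {e\<in>index_pairs k. \<not> b e} x \<partial>U.cube {1..k})" for X b
    unfolding U.pattern_prob_def F_def edge_weight_def
    by (intro Bochner_Integration.integral_cong refl) (simp add: prod.If_cases Int_def)
  have "U.pattern_prob k V' b = U.pattern_prob k W' b" for b
    unfolding pp by (intro eq) auto
  then show ?thesis unfolding random_graph_prob[OF V] random_graph_prob[OF W] by (simp cong: if_cong)
qed

lemma pattern_prob_nonneg: "U.kernel W \<Longrightarrow> 0 \<le> U.pattern_prob k W b"
  unfolding U.pattern_prob_def
  by (intro Bochner_Integration.integral_nonneg prod_nonneg) (simp add: U.edge_weight_bdd)

text \<open>The random graph is supported on pattern graphs, so events need to be compared on these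
  only.\<close>

lemma random_graph_mono:
  assumes "W \<in> graphons" and "\<And>b. b \<in> patterns k \<Longrightarrow> pattern_graph k b \<in> S \<Longrightarrow> pattern_graph k b \<in> T"
  shows "measure (random_graph k W) S \<le> measure (random_graph k W) T"
proof -
  obtain W' where W: "U.kernel W'" "ae_eq W W'"
    using graphon_kernel[OF assms(1)] .
  show ?thesis
    unfolding random_graph_prob[OF W] using assms(2) pattern_prob_nonneg[OF W(1)] by (intro sum_mono) auto
qed

lemma random_graph_compl:
  assumes "W \<in> graphons"
  shows "measure (random_graph k W) (- S) = 1 - measure (random_graph k W) S"
proof -
  obtain W' where W: "U.kernel W'" "ae_eq W W'"
    using graphon_kernel[OF assms] .
  interpret C: prob_space "U.cube {1..k}" by (rule U.prob_space_cube)
  have "measure_pmf.prob (edge_choice_pmf k W' x) (- S) = 1 - measure_pmf.prob (edge_choice_pmf k W' x) S" for x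
    using measure_pmf.prob_compl[of S "edge_choice_pmf k W' x"] by (simp add: Compl_eq_Diff_UNIV)
  moreover have "integrable (U.cube {1..k}) (\<lambda>x. measure_pmf.prob (edge_choice_pmf k W' x) S)"
    using edge_choice_prob_measurable[OF W(1)] by (intro C.integrable_const_bound[where B=1]) auto
  moreover have "(\<integral>x. (1::real) \<partial>U.cube {1..k}) = 1"
    by (simp only: lebesgue_integral_const C.prob_space scaleR_one)
  ultimately show ?thesis
    unfolding random_graph_prob_integral[OF W] by (simp only: Bochner_Integration.integral_diff C.integrable_const)
qed

text \<open>This merges rules for all precisions \<open>n\<close> into one: at sample size
  \<open>k\<close> it picks the largest \<open>n \<le> k\<close> whose threshold
  \<open>\<kappa> n\<close> has been passed. The restriction \<open>n \<le> k\<close> keeps the set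
  finite.\<close>

lemma diagonal_index:
  fixes \<kappa> :: "nat \<Rightarrow> nat"
  obtains \<iota> where "\<And>k. \<kappa> 0 \<le> k \<Longrightarrow> \<kappa> (\<iota> k) \<le> k" "\<And>n k. max n (\<kappa> n) \<le> k \<Longrightarrow> n \<le> \<iota> k"
proof
  define \<iota> where "\<iota> k = Max {n. n \<le> k \<and> \<kappa> n \<le> k}" for k
  have fin: "finite {n. n \<le> k \<and> \<kappa> n \<le> k}" for k by simp
  show "\<kappa> (\<iota> k) \<le> k" if "\<kappa> 0 \<le> k" for k
    using Max_in[OF fin[of k]] that unfolding \<iota>_def by blast
  show "n \<le> \<iota> k" if "max n (\<kappa> n) \<le> k" for n k
    unfolding \<iota>_def using that by (intro Max_ge[OF fin]) simp
qed

section \<open>Elementary properties of the distance to a set\<close>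

lemma d1_kernel:
  assumes "U.kernel V" "U.kernel W" shows "d1 V W = U.avg (\<lambda>x y. \<bar>V x y - W x y\<bar>)"
  using assms by (intro d1_eq_avg kernel_in_graphons) auto

lemma d1_nonneg: "0 \<le> d1 V W"
  unfolding d1_def by (intro Bochner_Integration.integral_nonneg) auto

lemma d1_self: "d1 W W = 0"
  unfolding d1_def by (simp add: case_prod_unfold)

lemma d1_triangle:
  assumes "U \<in> graphons" "V \<in> graphons" "W \<in> graphons" shows "d1 U W \<le> d1 U V + d1 V W"
proof -
  obtain U' where U: "U.kernel U'" "ae_eq U U'"
    using graphon_kernel[OF assms(1)] .
  obtain V' where V: "U.kernel V'" "ae_eq V V'"
    using graphon_kernel[OF assms(2)] .
  obtain W' where W: "U.kernel W'" "ae_eq W W'"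
    using graphon_kernel[OF assms(3)] .
  note b = U.bdd_fun_abs U.bdd_fun_diff U.bdd_fun_kernel U.bdd_fun_add U(1) V(1) W(1)
  have "U.avg (\<lambda>x y. \<bar>U' x y - W' x y\<bar>) \<le> U.avg (\<lambda>x y. \<bar>U' x y - V' x y\<bar> + \<bar>V' x y - W' x y\<bar>)"
    by (intro U.avg_mono b) auto
  also have "\<dots> = U.avg (\<lambda>x y. \<bar>U' x y - V' x y\<bar>) + U.avg (\<lambda>x y. \<bar>V' x y - W' x y\<bar>)"
    by (intro U.avg_add b)
  finally show ?thesis
    using d1_eq_avg[OF U W] d1_eq_avg[OF U V] d1_eq_avg[OF V W] assms by simp
qed

lemma d1_set_le: "V \<in> R \<Longrightarrow> d1_set W R \<le> d1 W V"
  unfolding d1_set_def by (intro cINF_lower bdd_belowI2[where m=0] d1_nonneg)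

lemma d1_set_less_iff: "R \<noteq> {} \<Longrightarrow> d1_set W R < e \<longleftrightarrow> (\<exists>V\<in>R. d1 W V < e)"
  unfolding d1_set_def by (intro cINF_less_iff bdd_belowI2[where m=0] d1_nonneg)

lemma d1_set_nonneg: "R \<noteq> {} \<Longrightarrow> 0 \<le> d1_set W R"
  unfolding d1_set_def by (intro cINF_greatest d1_nonneg)

lemma d1_set_member: "W \<in> R \<Longrightarrow> d1_set W R = 0"
  using d1_set_le[of W R W] d1_set_nonneg[of R W] by (auto simp: d1_self)

lemma d1_set_triangle:
  assumes "R \<noteq> {}" "R \<subseteq> graphons" "V \<in> graphons" "W \<in> graphons"
  shows "d1_set V R \<le> d1 V W + d1_set W R"
proof (rule field_le_epsilon)
  fix e :: real assume "0 < e"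
  then have "d1_set W R < d1_set W R + e" by simp
  then obtain X where X: "X \<in> R" "d1 W X < d1_set W R + e" using d1_set_less_iff[OF assms(1)] by blast
  then have "d1_set V R \<le> d1 V X" by (intro d1_set_le)
  also have "\<dots> \<le> d1 V W + d1 W X" using X assms by (intro d1_triangle) auto
  finally show "d1_set V R \<le> d1 V W + d1_set W R + e" using X by simp
qed

text \<open>The tester turns closeness of small samples back into closeness in \<open>L\<^sub>1\<close>: the transferred graphon
  passes the test with probability above one third, so it cannot be far from \<open>R\<close>.\<close>

lemma d1_set_stable:
  assumes R: "R \<noteq> {}" "R \<subseteq> graphons" and test: "testable_property R" and e: "0 < e"
  obtains c where "0 < c" "\<And>G V W. finite (fst G) \<Longrightarrow> U.kernel V \<Longrightarrow> U.kernel W \<Longrightarrow> near c G V \<Longrightarrow> near c G W \<Longrightarrow>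
      d1_set V R \<le> d1_set W R + e"
proof -
  \<comment> \<open>One third pays for the choice of an almost nearest \<open>X\<close>, one for the
    transfer error \<open>5 * \<eta>\<close>, and one for the distance of \<open>V'\<close> from
    \<open>R\<close>.\<close>
  define e' where "e' = e / 3"
  have e': "0 < e'" using e by (simp add: e'_def)
  obtain P where P1: "\<And>W k. W \<in> R \<Longrightarrow> 1 \<le> k \<Longrightarrow> 2/3 \<le> measure (random_graph k W) P"
    and P2: "\<forall>\<epsilon>>0. \<exists>k0\<ge>1. \<forall>k\<ge>k0. \<forall>W\<in>graphons. d1_set W R \<ge> \<epsilon> \<longrightarrow> measure (random_graph k W) P \<le> 1/3"
    using test unfolding testable_property_def by blast
  obtain k where k: "1 \<le> k" "\<And>W. W \<in> graphons \<Longrightarrow> e' \<le> d1_set W R \<Longrightarrow> measure (random_graph k W) P \<le> 1/3"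
    using P2 e' by blast
  define C where "C = real (card (patterns k)) * real (card (index_pairs k))"
  have C0: "0 \<le> C" by (simp add: C_def)
  \<comment> \<open>With \<open>K * K * c = \<eta>\<close> the transfer errors are
    \<open>3 * \<eta> + 2 * \<eta>\<close> in distance and, per edge of a pattern,
    \<open>2 * \<eta> + 2 * \<eta>\<close> in probability. Summed over all patterns the latter is
    \<open>C * (4 * \<eta>)\<close>, below 4/13 and so below the gap 1/3 between 2/3 and
    1/3.\<close>
  define \<eta> where "\<eta> = min (e' / 5) (1 / (13 * (C + 1)))"
  have \<eta>: "0 < \<eta>" "5 * \<eta> \<le> e'" using e' C0 by (auto simp: \<eta>_def)
  have "C * (4 * \<eta>) \<le> C * (4 * (1 / (13 * (C + 1))))" using C0 by (intro mult_left_mono) (auto simp: \<eta>_def)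
  also have "\<dots> < 1/3" using C0 by (simp add: field_simps)
  finally have C\<eta>: "C * (4 * \<eta>) < 1/3" .
  obtain K where K: "0 < K" "\<And>W W'. U.kernel W \<Longrightarrow> U.kernel W' \<Longrightarrow> \<exists>\<alpha> w w'. U.regular_pair \<eta> K W W' \<alpha> w w'"
    using U.weak_regularity[OF \<eta>(1)] by blast
  define c where "c = \<eta> / (real K * real K)"
  have c: "0 < c" "real K * real K * c = \<eta>" using \<eta> K(1) by (auto simp: c_def)
  have "d1_set V R \<le> d1_set W R + e"
    if fin: "finite (fst G)" and V: "U.kernel V" and W: "U.kernel W" and nV: "near c G V" and nW: "near c G W" for G V W
  proof -
    have "d1_set W R < d1_set W R + e'" using e' by simp
    then obtain X where X: "X \<in> R" "d1 W X < d1_set W R + e'" using d1_set_less_iff[OF R(1)] by blast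
    then have Xg: "X \<in> graphons" using R by auto
    obtain X' where X': "U.kernel X'" "ae_eq X X'"
      using graphon_kernel[OF Xg] .
    have dWX: "d1 W X = U.avg (\<lambda>x y. \<bar>W x y - X' x y\<bar>)"
      by (rule d1_eq_avg[OF W AE_I2[OF refl] X' kernel_in_graphons[OF W] Xg])
    obtain \<alpha> w w' where reg: "U.regular_pair \<eta> K W X' \<alpha> w w'" using K(2)[OF W X'(1)] by blast
    obtain \<phi> where \<phi>: "U.labelling \<phi>" "\<And>x. \<phi> x \<in> fst G"
        "\<And>v. v \<in> fst G \<Longrightarrow> U.prob {x\<in>space unif. \<phi> x = v} = 1 / card (fst G)"
        "U.cut_bound (\<lambda>x y. V x y - adj G (\<phi> x) (\<phi> y)) c"
      using nV unfolding near_def by blast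
    obtain \<psi> where \<psi>: "U.labelling \<psi>" "\<And>x. \<psi> x \<in> fst G"
        "\<And>v. v \<in> fst G \<Longrightarrow> U.prob {x\<in>space unif. \<psi> x = v} = 1 / card (fst G)"
        "U.cut_bound (\<lambda>x y. W x y - adj G (\<psi> x) (\<psi> y)) c"
      using nW unfolding near_def by blast
    have mass: "U.prob {x\<in>space unif. \<phi> x = v} = U.prob {x\<in>space unif. \<psi> x = v}" if "v \<in> fst G" for v
      using \<phi>(3)[OF that] \<psi>(3)[OF that] by simp
    obtain V' where V': "U.kernel V'"
      "U.avg (\<lambda>x y. \<bar>V x y - V' x y\<bar>) \<le> U.avg (\<lambda>x y. \<bar>W x y - X' x y\<bar>) + 3 * \<eta> + 2 * (real K * real K * c)"
      "\<And>k b. \<bar>U.pattern_prob k V' b - U.pattern_prob k X' b\<bar> \<le> real (card (index_pairs k)) * (2 * \<eta> + 2 * (real K * real K * c))"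
      by (rule U.transfer[OF V W X'(1) reg \<phi>(1) \<psi>(1) \<phi>(2) \<psi>(2) fin mass adj_simps \<phi>(4) \<psi>(4)]) (assumption | rule that)+
    have "measure (random_graph k X) P - measure (random_graph k V') P \<le> (\<Sum>b\<in>patterns k. real (card (index_pairs k)) * (4 * \<eta>))"
    proof -
      have "measure (random_graph k X) P - measure (random_graph k V') P =
         (\<Sum>b\<in>patterns k. if pattern_graph k b \<in> P then U.pattern_prob k X' b - U.pattern_prob k V' b else 0)"
        unfolding random_graph_prob[OF X'] random_graph_prob[OF V'(1), OF AE_I2[OF refl]] sum_subtractf[symmetric]
        by (intro sum.cong) auto
      also have "\<dots> \<le> (\<Sum>b\<in>patterns k. real (card (index_pairs k)) * (4 * \<eta>))"
        using V'(3)[of k] \<eta>(1) unfolding c(2) by (intro sum_mono) (auto simp: abs_le_iff)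
      finally show ?thesis .
    qed
    also have "\<dots> < 1/3" using C\<eta> by (simp add: C_def mult.assoc)
    finally have "1/3 < measure (random_graph k V') P" using P1[OF X(1) k(1)] by linarith
    then have "d1_set V' R < e'" using k(2)[OF kernel_in_graphons[OF V'(1)]] by linarith
    moreover have "d1_set V R \<le> d1 V V' + d1_set V' R"
      by (intro d1_set_triangle R kernel_in_graphons V V')
    moreover have "d1 V V' \<le> d1 W X + 5 * \<eta>"
      using V'(2) unfolding c(2) d1_kernel[OF V V'(1)] dWX by simp
    ultimately show ?thesis using X(2) \<eta>(2) by (simp add: e'_def)
  qed
  with c(1) show thesis by (rule that)
qed

text \<open>Composing the vertex map with the isomorphism gives the same classes under new
  names.\<close>

lemma near_iso:
  assumes G: "simple_graph G" and H: "simple_graph H" and iso: "graph_iso G H" and near: "near c G W"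
  shows "near c H W"
proof -
  obtain \<pi> where \<pi>: "bij_betw \<pi> (fst G) (fst H)" "snd H = (\<lambda>e. \<pi> ` e) ` snd G" using iso unfolding graph_iso_def by blast
  have inj: "inj_on \<pi> (fst G)" using \<pi>(1) by (rule bij_betw_imp_inj_on)
  have card: "card (fst G) = card (fst H)" using \<pi>(1) by (rule bij_betw_same_card)
  obtain \<phi> where \<phi>: "U.labelling \<phi>" "\<And>x. \<phi> x \<in> fst G"
      "\<And>v. v \<in> fst G \<Longrightarrow> U.prob {x\<in>space unif. \<phi> x = v} = 1 / card (fst G)"
      "U.cut_bound (\<lambda>x y. W x y - adj G (\<phi> x) (\<phi> y)) c"
    using near unfolding near_def by blast
  have adj: "adj H (\<pi> u) (\<pi> v) = adj G u v" if "u \<in> fst G" "v \<in> fst G" for u v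
  proof -
    have "{\<pi> u, \<pi> v} = \<pi> ` e \<longleftrightarrow> {u, v} = e" if "e \<in> snd G" for e
    proof -
      have "e \<subseteq> fst G" using G that unfolding simple_graph_def by blast
      then show ?thesis using inj_on_image_eq_iff[OF inj, of "{u, v}" e] \<open>u \<in> fst G\<close> \<open>v \<in> fst G\<close> by simp
    qed
    then have "{\<pi> u, \<pi> v} \<in> snd H \<longleftrightarrow> {u, v} \<in> snd G" unfolding \<pi>(2) by blast
    then show ?thesis by (simp add: adj_def)
  qed
  have "(\<lambda>x. \<pi> (\<phi> x)) \<in> unif \<rightarrow>\<^sub>M count_space UNIV"
    by (rule measurable_compose[OF \<phi>(1)]) simp
  moreover have "\<pi> (\<phi> x) \<in> fst H" for x using \<phi>(2) \<pi>(1) by (auto simp: bij_betw_def)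
  moreover have "U.prob {x\<in>space unif. \<pi> (\<phi> x) = v} = 1 / card (fst H)" if "v \<in> fst H" for v
  proof -
    have "v \<in> \<pi> ` fst G" using that bij_betw_imp_surj_on[OF \<pi>(1)] by simp
    then obtain u where u: "u \<in> fst G" "v = \<pi> u" by blast
    then have "{x\<in>space unif. \<pi> (\<phi> x) = v} = {x\<in>space unif. \<phi> x = u}"
      using inj \<phi>(2) by (auto dest: inj_onD)
    then show ?thesis using \<phi>(3)[OF u(1)] card by simp
  qed
  moreover have "U.cut_bound (\<lambda>x y. W x y - adj H (\<pi> (\<phi> x)) (\<pi> (\<phi> y))) c"
    using \<phi>(2,4) by (simp add: adj)
  ultimately show ?thesis unfolding near_def by (intro bexI[of _ "\<lambda>x. \<pi> (\<phi> x)"]) blast+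
qed

lemma testable_property_of_functional:
  assumes R: "R \<subseteq> graphons" and f: "testable_functional (\<lambda>W. d1_set W R)"
  shows "testable_property R"
proof (cases "R = {}")
  case True
  \<comment> \<open>The tester that rejects every graph.\<close>
  show ?thesis
    unfolding testable_property_def True by (intro exI[of _ "{}"]) (auto simp: graph_property_def)
next
  case False
  obtain g where g: "graph_parameter g"
    and g_test: "\<forall>\<epsilon>>0. \<exists>k0\<ge>1. \<forall>W\<in>graphons. \<forall>k\<ge>k0. measure (random_graph k W) {G. \<bar>d1_set W R - g G\<bar> > \<epsilon>} < 1/3"
    using f unfolding testable_functional_def by blast
  define \<epsilon> where "\<epsilon> n = 1 / (real n + 1)" for n
  have \<epsilon>: "0 < \<epsilon> n" for n by (simp add: \<epsilon>_def)
  have "\<forall>n. \<exists>k0. \<forall>W\<in>graphons. \<forall>k\<ge>k0. measure (random_graph k W) {G. \<bar>d1_set W R - g G\<bar> > \<epsilon> n} < 1/3"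
    using g_test \<epsilon> by blast
  from choice[OF this] obtain \<kappa> where \<kappa>: "\<And>n W k. W \<in> graphons \<Longrightarrow> \<kappa> n \<le> k \<Longrightarrow>
      measure (random_graph k W) {G. \<bar>d1_set W R - g G\<bar> > \<epsilon> n} < 1/3" by blast
  obtain \<iota> where \<iota>: "\<And>k. \<kappa> 0 \<le> k \<Longrightarrow> \<kappa> (\<iota> k) \<le> k" "\<And>n k. max n (\<kappa> n) \<le> k \<Longrightarrow> n \<le> \<iota> k"
    using diagonal_index[of \<kappa>] by blast
  \<comment> \<open>Graphs below the first threshold are all accepted, because members of
    \<open>R\<close> must be accepted at every sample size; rejection is required only for large
    samples.\<close>
  define P where "P = {G. simple_graph G \<and> (\<kappa> 0 \<le> card (fst G) \<longrightarrow> g G \<le> \<epsilon> (\<iota> (card (fst G))))}"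
  have P: "pattern_graph k b \<in> P \<longleftrightarrow> (\<kappa> 0 \<le> k \<longrightarrow> g (pattern_graph k b) \<le> \<epsilon> (\<iota> k))" for k b
    unfolding P_def by (simp add: pattern_graph_simple)
  have "graph_property P"
    unfolding graph_property_def
  proof (intro conjI allI impI)
    fix G H assume GH: "simple_graph G \<and> simple_graph H \<and> graph_iso G H \<and> G \<in> P"
    then have "card (fst G) = card (fst H)" unfolding graph_iso_def by (auto dest: bij_betw_same_card)
    moreover have "g G = g H" using g GH unfolding graph_parameter_def by blast
    ultimately show "H \<in> P" using GH by (simp add: P_def)
  qed (auto simp: P_def)
  moreover have "2/3 \<le> measure (random_graph k W) P" if W: "W \<in> R" for W k
  proof -
    have Wg: "W \<in> graphons" using W R by auto
    have "measure (random_graph k W) (- P) \<le> 1/3"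
    proof (cases "\<kappa> 0 \<le> k")
      case True
      have "measure (random_graph k W) (- P) \<le> measure (random_graph k W) {G. \<bar>d1_set W R - g G\<bar> > \<epsilon> (\<iota> k)}"
        using True by (intro random_graph_mono[OF Wg]) (auto simp: P d1_set_member[OF W])
      then show ?thesis using \<kappa>[OF Wg \<iota>(1)[OF True]] by simp
    next
      case False
      then have "measure (random_graph k W) (- P) \<le> measure (random_graph k W) {}"
        by (intro random_graph_mono[OF Wg]) (auto simp: P)
      then show ?thesis by simp
    qed
    then show ?thesis using random_graph_compl[OF Wg, of k P] by simp
  qed
  moreover have "\<exists>k0\<ge>1. \<forall>k\<ge>k0. \<forall>W\<in>graphons. d1_set W R \<ge> e \<longrightarrow> measure (random_graph k W) P \<le> 1/3" if e: "0 < e" for e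
  proof -
    \<comment> \<open>The factor 2 is needed because acceptance allows an estimate up to
      \<open>\<epsilon> (\<iota> k)\<close>, which must still differ from a distance of at least
      \<open>e\<close> by more than \<open>\<epsilon> (\<iota> k)\<close>.\<close>
    obtain n :: nat where n: "2 / e < n" using reals_Archimedean2 by blast
    moreover have "0 < 2 / e" using e by simp
    ultimately have n0: "0 < real n" by linarith
    have "\<epsilon> n < e / 2" using n n0 e by (simp add: \<epsilon>_def field_simps)
    have "measure (random_graph k W) P \<le> 1/3"
      if k: "max 1 (max (\<kappa> 0) (max n (\<kappa> n))) \<le> k" and W: "W \<in> graphons" and d: "e \<le> d1_set W R" for k W
    proof -
      have "n \<le> \<iota> k" using \<iota>(2)[of n k] k by simp
      then have "\<epsilon> (\<iota> k) \<le> \<epsilon> n" by (simp add: \<epsilon>_def frac_le)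
      then have "2 * \<epsilon> (\<iota> k) < e" using \<open>\<epsilon> n < e / 2\<close> by simp
      then have "measure (random_graph k W) P \<le> measure (random_graph k W) {G. \<bar>d1_set W R - g G\<bar> > \<epsilon> (\<iota> k)}"
        using k d by (intro random_graph_mono[OF W]) (auto simp: P)
      then show ?thesis using \<kappa>[OF W \<iota>(1)[of k]] k by simp
    qed
    then show ?thesis by (intro exI[of _ "max 1 (max (\<kappa> 0) (max n (\<kappa> n)))"]) auto
  qed
  ultimately show ?thesis unfolding testable_property_def by blast
qed

text \<open>Isomorphic graphons have the same random graphs, so a functional that can be estimated from
  random graphs is automatically invariant.\<close>

lemma testable_functionalI:
  assumes g: "graph_parameter g"
    and test: "\<And>\<epsilon>. 0 < \<epsilon> \<Longrightarrow> \<exists>k0\<ge>1. \<forall>W\<in>graphons. \<forall>k\<ge>k0. measure (random_graph k W) {G. \<bar>f W - g G\<bar> > \<epsilon>} < 1/3"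
  shows "testable_functional f"
  unfolding testable_functional_def graphon_functional_def
proof (intro conjI ballI impI)
  fix V W assume gr: "V \<in> graphons" "W \<in> graphons" and iso: "graphon_iso V W"
  have "\<bar>f V - f W\<bar> \<le> 0"
  proof (rule field_le_epsilon)
    fix e :: real assume "0 < e"
    then obtain k where k: "\<And>W. W \<in> graphons \<Longrightarrow> measure (random_graph k W) {G. \<bar>f W - g G\<bar> > e / 2} < 1/3"
      using test[of "e / 2"] by auto
    show "\<bar>f V - f W\<bar> \<le> 0 + e"
    proof (rule ccontr)
      assume far: "\<not> \<bar>f V - f W\<bar> \<le> 0 + e"
      \<comment> \<open>An estimate within \<open>e / 2\<close> of \<open>f V\<close> misses
        \<open>f W\<close> by more than \<open>e / 2\<close>, so an event of probability above 2/3
        would lie in one of probability below 1/3.\<close>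
      have "measure (random_graph k V) (- {G. \<bar>f V - g G\<bar> > e / 2}) \<le> measure (random_graph k V) {G. \<bar>f W - g G\<bar> > e / 2}"
      proof (rule random_graph_mono[OF gr(1)])
        fix b assume "pattern_graph k b \<in> - {G. \<bar>f V - g G\<bar> > e / 2}"
        then show "pattern_graph k b \<in> {G. \<bar>f W - g G\<bar> > e / 2}" using far by (simp only: Compl_iff mem_Collect_eq)
      qed
      also have "\<dots> = measure (random_graph k W) {G. \<bar>f W - g G\<bar> > e / 2}"
        by (rule random_graph_iso_eq[OF gr iso])
      finally show False using random_graph_compl[OF gr(1), of k "{G. \<bar>f V - g G\<bar> > e / 2}"] k[OF gr(1)] k[OF gr(2)] by simp
    qed
  qed
  then show "f V = f W" by simp
next
  show "\<exists>g. graph_parameter g \<and> (\<forall>\<epsilon>>0. \<exists>k0\<ge>1. \<forall>W\<in>graphons. \<forall>k\<ge>k0. measure (random_graph k W) {G. \<bar>f W - g G\<bar> > \<epsilon>} < 1/3)"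
    using g test by blast
qed

lemma testable_functional_of_property:
  assumes R: "R \<subseteq> graphons" and test: "testable_property R"
  shows "testable_functional (\<lambda>W. d1_set W R)"
proof (cases "R = {}")
  case True
  \<comment> \<open>Here the distance is the constant \<open>Inf {}\<close>, estimated without error
    by a constant parameter.\<close>
  show ?thesis
    by (rule testable_functionalI[where g="\<lambda>_. Inf {}"]) (auto simp: graph_parameter_def d1_set_def True)
next
  case False
  define \<epsilon> where "\<epsilon> n = 1 / (real n + 1)" for n
  have \<epsilon>: "0 < \<epsilon> n" for n by (simp add: \<epsilon>_def)
  have "\<forall>n. \<exists>c>0. \<forall>G V W. finite (fst G) \<longrightarrow> U.kernel V \<longrightarrow> U.kernel W \<longrightarrow> near c G V \<longrightarrow> near c G W \<longrightarrow>
      d1_set V R \<le> d1_set W R + \<epsilon> n"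
    using d1_set_stable[OF False R test \<epsilon>] by metis
  from choice[OF this] obtain c where c: "\<And>n. 0 < c n"
    "\<And>n G V W. finite (fst G) \<Longrightarrow> U.kernel V \<Longrightarrow> U.kernel W \<Longrightarrow> near (c n) G V \<Longrightarrow> near (c n) G W \<Longrightarrow>
      d1_set V R \<le> d1_set W R + \<epsilon> n" by blast
  have "\<forall>n. \<exists>N0. \<forall>N W. N0 \<le> N \<longrightarrow> U.kernel W \<longrightarrow> measure (random_graph N W) {G. \<not> near (c n) G W} < 1/3"
    using sampling[OF c(1)] by metis
  from choice[OF this] obtain \<kappa> where \<kappa>: "\<And>n N W. \<kappa> n \<le> N \<Longrightarrow> U.kernel W \<Longrightarrow>
      measure (random_graph N W) {G. \<not> near (c n) G W} < 1/3" by blast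
  obtain \<iota> where \<iota>: "\<And>k. \<kappa> 0 \<le> k \<Longrightarrow> \<kappa> (\<iota> k) \<le> k" "\<And>n k. max n (\<kappa> n) \<le> k \<Longrightarrow> n \<le> \<iota> k"
    using diagonal_index[of \<kappa>] by blast
  \<comment> \<open>For graphs with no near kernel the choice made in \<open>g\<close> is arbitrary;
    samples of this kind have probability below 1/3 once they are large. Since \<open>g\<close>
    depends on \<open>G\<close> only through the set \<open>N G\<close>, equality of these sets for
    isomorphic graphs makes the choices equal.\<close>
  define N where "N G = {V. U.kernel V \<and> near (c (\<iota> (card (fst G)))) G V}" for G
  define g where "g G = d1_set (SOME V. V \<in> N G) R" for G
  have "graph_parameter g"
    unfolding graph_parameter_def
  proof (intro allI impI)
    fix G H assume GH: "simple_graph G \<and> simple_graph H \<and> graph_iso G H"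
    then obtain \<pi> where \<pi>: "bij_betw \<pi> (fst G) (fst H)" "snd H = (\<lambda>e. \<pi> ` e) ` snd G" unfolding graph_iso_def by blast
    have "graph_iso H G"
      unfolding graph_iso_def
    proof (intro exI conjI)
      let ?\<rho> = "inv_into (fst G) \<pi>"
      show "bij_betw ?\<rho> (fst H) (fst G)" using \<pi>(1) by (rule bij_betw_inv_into)
      have "?\<rho> ` \<pi> ` e = e" if "e \<in> snd G" for e
        using GH that \<pi>(1) unfolding simple_graph_def by (intro inv_into_image_cancel) (auto simp: bij_betw_def)
      then show "snd G = (\<lambda>e. ?\<rho> ` e) ` snd H" unfolding \<pi>(2) image_image by auto
    qed
    moreover have "card (fst G) = card (fst H)" using \<pi>(1) by (rule bij_betw_same_card)
    ultimately have "N G = N H" unfolding N_def using GH near_iso by metis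
    then show "g G = g H" by (simp add: g_def)
  qed
  moreover have "\<exists>k0\<ge>1. \<forall>W\<in>graphons. \<forall>k\<ge>k0. measure (random_graph k W) {G. \<bar>d1_set W R - g G\<bar> > e} < 1/3" if e: "0 < e" for e
  proof -
    obtain n :: nat where n: "1 / e < n" using reals_Archimedean2 by blast
    moreover have "0 < 1 / e" using e by simp
    ultimately have n0: "0 < real n" by linarith
    have "\<epsilon> n < e" using n n0 e by (simp add: \<epsilon>_def field_simps)
    have "measure (random_graph k W) {G. \<bar>d1_set W R - g G\<bar> > e} < 1/3"
      if W: "W \<in> graphons" and k: "max 1 (max (\<kappa> 0) (max n (\<kappa> n))) \<le> k" for k W
    proof -
      obtain W' where W': "U.kernel W'" "ae_eq W W'"
        using graphon_kernel[OF W] .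
      have W'g: "W' \<in> graphons" by (rule kernel_in_graphons[OF W'(1)])
      \<comment> \<open>\<open>near\<close> and \<open>sampling\<close> concern kernels, so
        \<open>W\<close> is exchanged for its representative \<open>W'\<close> at distance
        0.\<close>
      have same: "d1_set W R = d1_set W' R"
      proof -
        have "d1 W W' = 0" using d1_eq_avg[OF W' W'(1) AE_I2[OF refl] W W'g] by simp
        moreover have "d1 W' W = 0" using d1_eq_avg[OF W'(1) AE_I2[OF refl] W' W'g W] by simp
        ultimately show ?thesis
          using d1_set_triangle[OF False R W W'g] d1_set_triangle[OF False R W'g W] by simp
      qed
      have "n \<le> \<iota> k" using \<iota>(2)[of n k] k by simp
      then have "\<epsilon> (\<iota> k) \<le> \<epsilon> n" by (simp add: \<epsilon>_def frac_le)
      then have \<epsilon>k: "\<epsilon> (\<iota> k) < e" using \<open>\<epsilon> n < e\<close> by simp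
      have "measure (random_graph k W) {G. \<bar>d1_set W R - g G\<bar> > e} \<le> measure (random_graph k W) {G. \<not> near (c (\<iota> k)) G W'}"
      proof (rule random_graph_mono[OF W], rule ccontr)
        fix b assume b: "pattern_graph k b \<in> {G. \<bar>d1_set W R - g G\<bar> > e}"
          and "pattern_graph k b \<notin> {G. \<not> near (c (\<iota> k)) G W'}"
        then have near: "near (c (\<iota> k)) (pattern_graph k b) W'" by simp
        let ?V = "SOME V. V \<in> N (pattern_graph k b)"
        have "W' \<in> N (pattern_graph k b)" unfolding N_def using near W'(1) by (simp add: pattern_graph_simple)
        then have "?V \<in> N (pattern_graph k b)" by (rule someI[of "\<lambda>V. V \<in> N (pattern_graph k b)"])
        then have V: "U.kernel ?V" "near (c (\<iota> k)) (pattern_graph k b) ?V"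
          unfolding N_def by (simp_all add: pattern_graph_simple)
        have "\<bar>d1_set W' R - d1_set ?V R\<bar> \<le> \<epsilon> (\<iota> k)"
          using c(2)[OF _ W'(1) V(1) near V(2)] c(2)[OF _ V(1) W'(1) V(2) near] by (simp add: pattern_graph_simple abs_le_iff)
        then show False using b \<epsilon>k same by (simp add: g_def)
      qed
      also have "\<dots> = measure (random_graph k W') {G. \<not> near (c (\<iota> k)) G W'}"
        unfolding random_graph_prob[OF W'] random_graph_prob[OF W'(1) AE_I2[OF refl]] ..
      also have "\<dots> < 1/3" using \<kappa>[OF \<iota>(1) W'(1)] k by simp
      finally show ?thesis .
    qed
    then show ?thesis by (intro exI[of _ "max 1 (max (\<kappa> 0) (max n (\<kappa> n)))"]) auto
  qed
  ultimately show ?thesis by (rule testable_functionalI)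
qed

theorem theorem3p26:
  fixes R :: "(real \<Rightarrow> real \<Rightarrow> real) set"
  assumes "graphon_property R"
  shows "testable_property R \<longleftrightarrow> testable_functional (\<lambda>W. d1_set W R)"
  using assms testable_property_of_functional testable_functional_of_property
  unfolding graphon_property_def by blast

end
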